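(* Let $n\ge2$, let $M_1,M_2$ be the quantum transport matrices of the $SL_n$-quiver and $\mathbb A=M_1^TM_2$. Let $M_\gamma$ be any $n\times n$ matrix (with entries in an associative algebra containing the entries of $\mathbb A$) satisfying $$R_n^T(q)\,\overset1{M_\gamma}\otimes\overset2{M_\gamma}=\overset2{M_\gamma}\otimes\overset1{M_\gamma}\,R_n(q)$$ and such that the entries of $M_\gamma$ commute with the entries of $\mathbb A$. Then the matrix $\mathbb A_{\mathrm{gen}}:=M_\gamma^TS^T\mathbb A\,S\,M_\gamma$ satisfies the quantum reflection equation $$R_n(q)\,\overset1{\mathbb A}_{\mathrm{gen}}\,R_n^{t_1}(q)\,\overset2{\mathbb A}_{\mathrm{gen}}=\overset2{\mathbb A}_{\mathrm{gen}}\,R_n^{t_1}(q)\,\overset1{\mathbb A}_{\mathrm{gen}}\,R_n(q).$$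
   Context: $R$-matrix. $R_n(q)=q^{-1/n}\big[\sum_{i,j}e_{ii}\otimes e_{jj}+(q-1)\sum_ie_{ii}\otimes e_{ii}+(q-q^{-1})\sum_{i>j}e_{ij}\otimes e_{ji}\big]$, $e_{ij}$ matrix units; $R_n^T$ is the total transpose and $R_n^{t_1}$ the transpose in the first tensor factor. $(\overset1M\otimes\overset2N)_{(ik),(jl)}=M_{ij}N_{kl}$, $(\overset2N\otimes\overset1M)_{(ik),(jl)}=N_{kl}M_{ij}$; noncommuting entries are multiplied in the written order. Transposition of quantum matrices permutes entries only and does not change the order of operators. $S_{ij}=(-1)^{n-i}\delta_{i,n+1-j}$. Faces and skew form. Let $I=\{(a,b,c)\in\mathbb Z_{\ge0}^3: a+b+c=n\}$, drawn as a triangular lattice with $(n,0,0)$ at the bottom left, $(0,n,0)$ at the bottom right, $(0,0,n)$ at the top. For each $(a,b,c)\in\mathbb Z_{\ge 0}^3$ with $a+b+c=n-1$ (a white triangle) take the three half-arrows $(a+1,b,c)\to(a,b,c+1)\to(a,b+1,c)\to(a+1,b,c)$; for each $(a,b,c)\in\mathbb Z_{\ge0}^3$ with $a+b+c=n-2$ (a black triangle) take the three half-arrows $(a+1,b,c+1)\to(a+1,b+1,c)\to(a,b+1,c+1)\to(a+1,b,c+1)$. Define the skew-symmetric bilinear form on $\mathbb Q^I$ by $\langle\alpha,\beta\rangle=\frac12(\#\{\alpha\to\beta\}-\#\{\beta\to\alpha\})$. Quantum torus. Basis $Z_\lambda$, $\lambda\in\mathbb Q^I$, over a field containing all rational powers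 of the formal variable $q$, with $Z_\lambda Z_\mu=q^{-\langle\lambda,\mu\rangle}Z_{\lambda+\mu}$; Weyl form $:\prod_\alpha Z_\alpha^{r_\alpha}:\,=Z_{\sum r_\alpha\alpha}$. Network. The dual directed planar graph has white vertices $w_{abc}$ ($a+b+c=n-1$) and black vertices $b_{abc}$ ($a+b+c=n-2$) at the centers of the corresponding triangles. Edges: $w_{abc}\to b_{a,b-1,c}$ (if $b\ge1$), $w_{abc}\to b_{a,b,c-1}$ (if $c\ge 1$), $b_{abc}\to w_{a+1,b,c}$; source $i$ (right side, $1\le i\le n$) $\to w_{0,i-1,n-i}$; $w_{i-1,0,n-i}\to$ left sink $i'$; $w_{n-i,i-1,0}\to$ bottom sink $i''$. Faces are labelled by $I$. The weight of a directed path $P$ from a source to a sink is $w(P)=\,:\prod_\alpha Z_\alpha:$ over all faces $\alpha$ to the right of $P$ (for paths to left sinks: the faces above the path; for paths to bottom sinks: the faces on the side containing $(n,0,0)$ and $(0,0,n)$). $(\mathcal M_1)_{ij}=\sum_{P:j\leadsto i'}w(P)$, $(\mathcal M_2)_{ij}=\sum_{P:j\leadsto i''}w(P)$; $D_1=\,:\prod_{I}Z_{a,b,c}^{c/n}:$, $D_2=\,:\prod_{I}Z_{a,b,c}^{a/n}:$, $Q=\mathrm{diag}(q^{j-1/2})_{j=1}^n$; $M_1=QS\mathcal M_1D_1^{-1}$, $M_2=QS\mathcal M_2D_1^{-1}D_2^{-1}$. $\mathbb A_{ij}=\sum_k(M_1)_{ki}(M_2)_{kj}$. *)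

theory Defs
  imports Complex_Main "HOL-Library.Poly_Mapping"
begin

section \<open>Ground field\<close>

text \<open>
  A field containing all rational powers of the formal variable \<open>q\<close>: \<open>qpow r\<close> stands for \<open>q\<close> to
  the power \<open>r\<close>. That \<open>q\<close> is a formal variable means that it is transcendental over the prime
  field; after clearing denominators the coefficients may be taken to be images of integers. The
  characteristic is arbitrary, so the conclusion is about these images.
\<close>

class qfield = field +
  fixes qpow :: "rat \<Rightarrow> 'a"
  assumes qpow_0: "qpow 0 = 1"
    and qpow_add: "qpow (r + s) = qpow r * qpow s"
    and qpow_transcendental:
      "\<lbrakk>(\<Sum>i\<le>d. of_int (c i) * qpow 1 ^ i) = 0; i \<le> d\<rbrakk> \<Longrightarrow> of_int (c i) = 0"


section \<open>Faces and the skew form\<close>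

type_synonym face = "nat \<times> nat \<times> nat"
type_synonym expo = "face \<Rightarrow>\<^sub>0 rat"

definition faces :: "nat \<Rightarrow> face set" where
  "faces n = {(a, b, c). a + b + c = n}"

text \<open>
  \<open>white_arrow (a, b, c) \<alpha> \<beta>\<close>: one of the three half-arrows of the white triangle \<open>(a, b, c)\<close>
  leads from \<open>\<alpha>\<close> to \<open>\<beta>\<close>; likewise for black triangles.
\<close>

fun white_arrow :: "face \<Rightarrow> face \<Rightarrow> face \<Rightarrow> bool" where
  "white_arrow (a, b, c) \<alpha> \<beta> \<longleftrightarrow>
     (\<alpha>, \<beta>) \<in> {((a + 1, b, c), (a, b, c + 1)),
               ((a, b, c + 1), (a, b + 1, c)),
               ((a, b + 1, c), (a + 1, b, c))}"

fun black_arrow :: "face \<Rightarrow> face \<Rightarrow> face \<Rightarrow> bool" where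
  "black_arrow (a, b, c) \<alpha> \<beta> \<longleftrightarrow>
     (\<alpha>, \<beta>) \<in> {((a + 1, b, c + 1), (a + 1, b + 1, c)),
               ((a + 1, b + 1, c), (a, b + 1, c + 1)),
               ((a, b + 1, c + 1), (a + 1, b, c + 1))}"

text \<open>
  No size \<open>n\<close> appears here: a white triangle touching \<open>\<alpha> = (a, b, c)\<close> automatically has coordinate
  sum \<open>a + b + c - 1\<close>, a black one \<open>a + b + c - 2\<close>. Faces belonging to different \<open>n\<close> are not joined
  by arrows, so all sizes can be treated at once, and on vectors supported on \<open>faces n\<close> the form
  below is the form of the triangle of size \<open>n\<close>.
\<close>

definition num_arrows :: "face \<Rightarrow> face \<Rightarrow> nat" where
  "num_arrows \<alpha> \<beta> = card {t. white_arrow t \<alpha> \<beta>} + card {t. black_arrow t \<alpha> \<beta>}"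

definition face_form :: "face \<Rightarrow> face \<Rightarrow> rat" where
  "face_form \<alpha> \<beta> = (of_nat (num_arrows \<alpha> \<beta>) - of_nat (num_arrows \<beta> \<alpha>)) / 2"

definition skew :: "expo \<Rightarrow> expo \<Rightarrow> rat" where
  "skew \<kappa> \<mu> = (\<Sum>\<alpha>\<in>Poly_Mapping.keys \<kappa>. \<Sum>\<beta>\<in>Poly_Mapping.keys \<mu>.
     Poly_Mapping.lookup \<kappa> \<alpha> * Poly_Mapping.lookup \<mu> \<beta> * face_form \<alpha> \<beta>)"

lemma skew_superset:
  assumes "finite A" "finite B" "Poly_Mapping.keys \<kappa> \<subseteq> A" "Poly_Mapping.keys \<mu> \<subseteq> B"
  shows "skew \<kappa> \<mu> = (\<Sum>\<alpha>\<in>A. \<Sum>\<beta>\<in>B. Poly_Mapping.lookup \<kappa> \<alpha> * Poly_Mapping.lookup \<mu> \<beta> * face_form \<alpha> \<beta>)"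
proof -
  have "(\<Sum>\<beta>\<in>B. Poly_Mapping.lookup \<kappa> \<alpha> * Poly_Mapping.lookup \<mu> \<beta> * face_form \<alpha> \<beta>)
      = (\<Sum>\<beta>\<in>Poly_Mapping.keys \<mu>. Poly_Mapping.lookup \<kappa> \<alpha> * Poly_Mapping.lookup \<mu> \<beta> * face_form \<alpha> \<beta>)" for \<alpha>
    by (rule sum.mono_neutral_right) (use assms in \<open>auto simp: in_keys_iff\<close>)
  then show ?thesis
    unfolding skew_def
    by (simp, intro sum.mono_neutral_left) (use assms in \<open>auto simp: in_keys_iff\<close>)
qed

lemma skew_add_left: "skew (\<kappa> + \<kappa>') \<mu> = skew \<kappa> \<mu> + skew \<kappa>' \<mu>"
proof -
  let ?A = "Poly_Mapping.keys \<kappa> \<union> Poly_Mapping.keys \<kappa>'"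
  have "Poly_Mapping.keys (\<kappa> + \<kappa>') \<subseteq> ?A" by (rule Poly_Mapping.keys_add)
  then show ?thesis
    by (simp add: skew_superset[where A = ?A and B = "Poly_Mapping.keys \<mu>"] lookup_add
        distrib_right sum.distrib)
qed

lemma skew_antisym: "skew \<mu> \<kappa> = - skew \<kappa> \<mu>"
proof -
  have "face_form \<beta> \<alpha> = - face_form \<alpha> \<beta>" for \<alpha> \<beta>
    by (simp add: face_form_def field_simps)
  then have "skew \<mu> \<kappa> = (\<Sum>\<beta>\<in>Poly_Mapping.keys \<mu>. \<Sum>\<alpha>\<in>Poly_Mapping.keys \<kappa>. - (Poly_Mapping.lookup \<kappa> \<alpha> * Poly_Mapping.lookup \<mu> \<beta> * face_form \<alpha> \<beta>))"
    unfolding skew_def by (intro sum.cong refl) (metis mult.commute mult_minus_right)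
  also have "\<dots> = - skew \<kappa> \<mu>"
    unfolding skew_def by (subst sum.swap) (simp add: sum_negf)
  finally show ?thesis .
qed

lemma skew_add_right: "skew \<kappa> (\<mu> + \<mu>') = skew \<kappa> \<mu> + skew \<kappa> \<mu>'"
  by (metis (no_types) skew_add_left skew_antisym minus_add_distrib)

lemma skew_self [simp]: "skew \<kappa> \<kappa> = 0"
  using skew_antisym[of \<kappa> \<kappa>] by simp

lemma skew_0 [simp]: "skew 0 \<kappa> = 0" "skew \<kappa> 0 = 0"
  by (simp_all add: skew_def)

lemma skew_minus_right: "skew \<kappa> (- \<mu>) = - skew \<kappa> \<mu>"
  using skew_add_right[of \<kappa> \<mu> "- \<mu>"] by simp


section \<open>Quantum torus\<close>

text \<open>
  \<open>'k qtorus\<close> has basis \<open>qZ \<kappa>\<close> for all finitely supported rational \<open>\<kappa>\<close> on triples; the quantum torus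
  of the triangle of size \<open>n\<close> is the subalgebra spanned by the \<open>qZ \<kappa>\<close> with \<open>\<kappa>\<close> supported on
  \<open>faces n\<close>, and everything constructed below lies in it.
\<close>

typedef (overloaded) 'k qtorus = "UNIV :: (expo \<Rightarrow>\<^sub>0 'k::zero) set"
  morphisms coeffs Abs_qtorus ..

lemmas [simp] = Abs_qtorus_inverse[OF UNIV_I] coeffs_inverse coeffs_inject

lemma qtorus_eqI: "coeffs x = coeffs y \<Longrightarrow> x = y" by simp

definition qZ :: "expo \<Rightarrow> 'k::qfield qtorus" where
  "qZ \<kappa> = Abs_qtorus (Poly_Mapping.single \<kappa> 1)"

definition qscale :: "'k \<Rightarrow> 'k::qfield qtorus \<Rightarrow> 'k qtorus" where
  "qscale c x = Abs_qtorus (Poly_Mapping.map ((*) c) (coeffs x))"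

definition tw_mult :: "(expo \<Rightarrow>\<^sub>0 'k::qfield) \<Rightarrow> (expo \<Rightarrow>\<^sub>0 'k) \<Rightarrow> (expo \<Rightarrow>\<^sub>0 'k)" where
  "tw_mult f g = (\<Sum>\<kappa>\<in>Poly_Mapping.keys f. \<Sum>\<mu>\<in>Poly_Mapping.keys g.
     Poly_Mapping.single (\<kappa> + \<mu>)
       (Poly_Mapping.lookup f \<kappa> * Poly_Mapping.lookup g \<mu> * qpow (- skew \<kappa> \<mu>)))"

lemma tw_mult_superset:
  assumes "finite A" "finite B" "Poly_Mapping.keys f \<subseteq> A" "Poly_Mapping.keys g \<subseteq> B"
  shows "tw_mult f g = (\<Sum>\<kappa>\<in>A. \<Sum>\<mu>\<in>B.
     Poly_Mapping.single (\<kappa> + \<mu>)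
       (Poly_Mapping.lookup f \<kappa> * Poly_Mapping.lookup g \<mu> * qpow (- skew \<kappa> \<mu>)))"
proof -
  have "(\<Sum>\<mu>\<in>B. Poly_Mapping.single (\<kappa> + \<mu>)
       (Poly_Mapping.lookup f \<kappa> * Poly_Mapping.lookup g \<mu> * qpow (- skew \<kappa> \<mu>)))
      = (\<Sum>\<mu>\<in>Poly_Mapping.keys g. Poly_Mapping.single (\<kappa> + \<mu>)
       (Poly_Mapping.lookup f \<kappa> * Poly_Mapping.lookup g \<mu> * qpow (- skew \<kappa> \<mu>)))" for \<kappa>
    by (rule sum.mono_neutral_right) (use assms in \<open>auto simp: in_keys_iff\<close>)
  then show ?thesis
    unfolding tw_mult_def
    by (simp, intro sum.mono_neutral_left) (use assms in \<open>auto simp: in_keys_iff\<close>)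
qed

lemma tw_mult_add_left: "tw_mult (f + f') g = tw_mult f g + tw_mult f' g"
proof -
  let ?A = "Poly_Mapping.keys f \<union> Poly_Mapping.keys f'"
  have "Poly_Mapping.keys (f + f') \<subseteq> ?A" by (rule Poly_Mapping.keys_add)
  then show ?thesis
    by (simp add: tw_mult_superset[where A = ?A and B = "Poly_Mapping.keys g"] lookup_add
        distrib_right sum.distrib single_add)
qed

lemma tw_mult_add_right: "tw_mult g (f + f') = tw_mult g f + tw_mult g f'"
proof -
  let ?A = "Poly_Mapping.keys f \<union> Poly_Mapping.keys f'"
  have "Poly_Mapping.keys (f + f') \<subseteq> ?A" by (rule Poly_Mapping.keys_add)
  then show ?thesis
    by (simp add: tw_mult_superset[where B = ?A and A = "Poly_Mapping.keys g"] lookup_add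
        distrib_right distrib_left sum.distrib single_add)
qed

lemma tw_mult_0 [simp]: "tw_mult 0 g = 0" "tw_mult g 0 = 0"
  by (simp_all add: tw_mult_def)

lemma tw_mult_single:
  "tw_mult (Poly_Mapping.single \<kappa> a) (Poly_Mapping.single \<mu> b)
     = Poly_Mapping.single (\<kappa> + \<mu>) (a * b * qpow (- skew \<kappa> \<mu>))"
  by (subst tw_mult_superset[where A = "{\<kappa>}" and B = "{\<mu>}"]) auto

lemma single_add_induct [case_names zero add]:
  fixes f :: "'a \<Rightarrow>\<^sub>0 'b::comm_monoid_add"
  assumes "P 0" and "\<And>k v f. P f \<Longrightarrow> P (Poly_Mapping.single k v + f)"
  shows "P f"
proof (induction f rule: update_induct)
  case const
  then show ?case by (rule assms(1))
next
  case (update f a b)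
  have "Poly_Mapping.update a b f = Poly_Mapping.single a b + f"
    using update(1)
    by (intro poly_mapping_eqI) (auto simp: lookup_update lookup_add lookup_single in_keys_iff)
  then show ?case using assms(2)[OF update(3)] by simp
qed

lemma tw_mult_assoc: "tw_mult (tw_mult f g) h = tw_mult f (tw_mult g h)"
proof (induction f rule: single_add_induct)
  case (add \<kappa> a f)
  have "tw_mult (tw_mult (Poly_Mapping.single \<kappa> a) g) h
      = tw_mult (Poly_Mapping.single \<kappa> a) (tw_mult g h)"
  proof (induction g rule: single_add_induct)
    case (add \<mu> b g)
    have "tw_mult (tw_mult (Poly_Mapping.single \<kappa> a) (Poly_Mapping.single \<mu> b)) h
        = tw_mult (Poly_Mapping.single \<kappa> a) (tw_mult (Poly_Mapping.single \<mu> b) h)"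
    proof (induction h rule: single_add_induct)
      case (add \<nu> c h)
      have "qpow (- skew \<kappa> \<mu>) * qpow (- skew (\<kappa> + \<mu>) \<nu>)
          = qpow (- skew \<mu> \<nu>) * (qpow (- skew \<kappa> (\<mu> + \<nu>)) :: 'a)"
        by (simp add: qpow_add[symmetric] skew_add_left skew_add_right algebra_simps)
      with add show ?case
        by (simp add: tw_mult_add_right tw_mult_single add.assoc mult_ac)
    qed simp
    with add show ?case by (simp add: tw_mult_add_right tw_mult_add_left)
  qed simp
  with add show ?case by (simp add: tw_mult_add_left)
qed simp

lemma tw_mult_1: "tw_mult (Poly_Mapping.single 0 1) f = f" "tw_mult f (Poly_Mapping.single 0 1) = f"
  by (induction f rule: single_add_induct)
    (simp_all add: tw_mult_add_right tw_mult_add_left tw_mult_single qpow_0 del: single_one)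

instantiation qtorus :: (qfield) ring_1
begin

definition "0 = Abs_qtorus 0"
definition "1 = qZ 0"
definition "x + y = Abs_qtorus (coeffs x + coeffs y)"
definition "x - y = Abs_qtorus (coeffs x - coeffs y)"
definition "- x = Abs_qtorus (- coeffs x)"
definition "x * y = Abs_qtorus (tw_mult (coeffs x) (coeffs y))"

instance
proof
  fix x y z :: "'a qtorus"
  show "x * y * z = x * (y * z)"
    by (simp add: times_qtorus_def tw_mult_assoc)
  show "1 * x = x" "x * 1 = x"
    by (simp_all add: times_qtorus_def one_qtorus_def qZ_def tw_mult_1 del: single_one)
  show "(x + y) * z = x * z + y * z" "z * (x + y) = z * x + z * y"
    by (simp_all add: times_qtorus_def plus_qtorus_def tw_mult_add_left tw_mult_add_right)
  show "(0::'a qtorus) \<noteq> 1"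
    by (simp add: zero_qtorus_def one_qtorus_def qZ_def Abs_qtorus_inject)
qed (simp_all add: plus_qtorus_def minus_qtorus_def uminus_qtorus_def zero_qtorus_def
      Abs_qtorus_inject add_ac)

end

lemma qZ_mult: "qZ \<kappa> * qZ \<mu> = qscale (qpow (- skew \<kappa> \<mu>)) (qZ (\<kappa> + \<mu>))"
  by (simp add: qZ_def qscale_def times_qtorus_def tw_mult_single map_single)

text \<open>\<open>weyl A r\<close> is the Weyl ordered product of the powers \<open>Z\<close> to the \<open>r \<alpha>\<close> over \<open>\<alpha> \<in> A\<close>.\<close>

definition weyl :: "face set \<Rightarrow> (face \<Rightarrow> rat) \<Rightarrow> 'k::qfield qtorus" where
  "weyl A r = qZ (\<Sum>\<alpha>\<in>A. Poly_Mapping.single \<alpha> (r \<alpha>))"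

text \<open>
  The two-sided inverse, meaningful only when it exists; by \<open>minv_qZ\<close> below this is the case for all
  Weyl monomials, in particular for \<open>D1\<close> and \<open>D2\<close>.
\<close>

definition minv :: "'a::ring_1 \<Rightarrow> 'a" where
  "minv x = (THE y. x * y = 1 \<and> y * x = 1)"

lemma minv_eqI: "x * y = 1 \<Longrightarrow> y * x = 1 \<Longrightarrow> minv x = y"
  unfolding minv_def by (rule the_equality) (auto, metis mult.assoc mult_1_left mult_1_right)

lemma minv_qZ: "minv (qZ \<kappa>) = qZ (- \<kappa>)"
proof (rule minv_eqI)
  show "qZ \<kappa> * qZ (- \<kappa>) = (1 :: 'a qtorus)"
    by (simp add: qZ_def one_qtorus_def times_qtorus_def tw_mult_single skew_minus_right qpow_0)
  show "qZ (- \<kappa>) * qZ \<kappa> = (1 :: 'a qtorus)"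
    by (simp add: qZ_def one_qtorus_def times_qtorus_def tw_mult_single skew_antisym[of "- \<kappa>"]
        skew_minus_right qpow_0)
qed


section \<open>Associative algebras\<close>

locale assoc_algebra = vector_space scale
  for scale :: "'k::field \<Rightarrow> 'b::ring_1 \<Rightarrow> 'b" +
  assumes scale_mult_left: "scale c x * y = scale c (x * y)"
    and scale_mult_right: "x * scale c y = scale c (x * y)"

inductive_set subalgebra_generated :: "('k \<Rightarrow> 'b::ring_1 \<Rightarrow> 'b) \<Rightarrow> 'b set \<Rightarrow> 'b set"
  for scale :: "'k \<Rightarrow> 'b \<Rightarrow> 'b" and X :: "'b set" where
  gen: "x \<in> X \<Longrightarrow> x \<in> subalgebra_generated scale X"
| one: "1 \<in> subalgebra_generated scale X"
| add: "\<lbrakk>x \<in> subalgebra_generated scale X; y \<in> subalgebra_generated scale X\<rbrakk>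
        \<Longrightarrow> x + y \<in> subalgebra_generated scale X"
| mult: "\<lbrakk>x \<in> subalgebra_generated scale X; y \<in> subalgebra_generated scale X\<rbrakk>
        \<Longrightarrow> x * y \<in> subalgebra_generated scale X"
| scale: "x \<in> subalgebra_generated scale X \<Longrightarrow> scale c x \<in> subalgebra_generated scale X"

definition algebra_embedding ::
  "('k \<Rightarrow> 'a::ring_1 \<Rightarrow> 'a) \<Rightarrow> ('k \<Rightarrow> 'b::ring_1 \<Rightarrow> 'b) \<Rightarrow> 'a set \<Rightarrow> ('a \<Rightarrow> 'b) \<Rightarrow> bool" where
  "algebra_embedding scaleA scaleB U \<phi> \<longleftrightarrow>
     inj_on \<phi> U \<and> \<phi> 1 = 1 \<and>
     (\<forall>x\<in>U. \<forall>y\<in>U. \<phi> (x + y) = \<phi> x + \<phi> y \<and> \<phi> (x * y) = \<phi> x * \<phi> y) \<and>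
     (\<forall>c. \<forall>x\<in>U. \<phi> (scaleA c x) = scaleB c (\<phi> x))"

lemma assoc_algebra_qscale: "assoc_algebra (qscale :: 'k::qfield \<Rightarrow> _)"
proof -
  have LM: "Poly_Mapping.lookup (Poly_Mapping.map ((*) c) f) k = c * Poly_Mapping.lookup f k"
    for c :: 'k and f :: "expo \<Rightarrow>\<^sub>0 'k" and k
    by (simp add: Poly_Mapping.map.rep_eq when_def)
  have map_0: "Poly_Mapping.map ((*) c) (0 :: expo \<Rightarrow>\<^sub>0 'k) = 0" for c :: 'k
    by (rule poly_mapping_eqI) (simp add: LM)
  have map_add: "Poly_Mapping.map ((*) c) (f + g) = Poly_Mapping.map ((*) c) f + Poly_Mapping.map ((*) c) g"
    for c :: 'k and f g :: "expo \<Rightarrow>\<^sub>0 'k"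
    by (rule poly_mapping_eqI) (simp add: LM lookup_add distrib_left)
  have map_l: "tw_mult (Poly_Mapping.map ((*) c) f) g = Poly_Mapping.map ((*) c) (tw_mult f g)"
    and map_r: "tw_mult g (Poly_Mapping.map ((*) c) f) = Poly_Mapping.map ((*) c) (tw_mult g f)"
    for c :: 'k and f g
  proof -
    have *: "tw_mult (Poly_Mapping.single \<kappa> (c * a)) g
          = Poly_Mapping.map ((*) c) (tw_mult (Poly_Mapping.single \<kappa> a) g)"
         "tw_mult g (Poly_Mapping.single \<kappa> (c * a))
          = Poly_Mapping.map ((*) c) (tw_mult g (Poly_Mapping.single \<kappa> a))" for \<kappa> a g
      by (induction g rule: single_add_induct)
        (simp_all add: tw_mult_add_left tw_mult_add_right tw_mult_single map_add map_0 map_single mult_ac)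
    show "tw_mult (Poly_Mapping.map ((*) c) f) g = Poly_Mapping.map ((*) c) (tw_mult f g)"
      by (induction f rule: single_add_induct)
        (simp_all add: tw_mult_add_left map_add map_0 map_single *)
    show "tw_mult g (Poly_Mapping.map ((*) c) f) = Poly_Mapping.map ((*) c) (tw_mult g f)"
      by (induction f rule: single_add_induct)
        (simp_all add: tw_mult_add_right map_add map_0 map_single *)
  qed
  show ?thesis
  proof
    fix a b :: 'k and x y :: "'k qtorus"
    show "qscale a (x + y) = qscale a x + qscale a y"
      by (simp add: qscale_def plus_qtorus_def map_add)
    show "qscale (a + b) x = qscale a x + qscale b x"
      by (rule qtorus_eqI, rule poly_mapping_eqI)
        (simp add: qscale_def plus_qtorus_def LM lookup_add distrib_right)
    show "qscale a (qscale b x) = qscale (a * b) x"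
      by (rule qtorus_eqI, rule poly_mapping_eqI) (simp add: qscale_def LM mult.assoc)
    show "qscale 1 x = x"
      by (rule qtorus_eqI, rule poly_mapping_eqI) (simp add: qscale_def LM)
    show "qscale a x * y = qscale a (x * y)" "x * qscale a y = qscale a (x * y)"
      by (simp_all add: qscale_def times_qtorus_def map_l map_r)
  qed
qed


section \<open>Matrices\<close>

text \<open>
  A square matrix is a function of two indices, relevant only for indices in an explicit finite
  set \<open>X\<close>: \<open>{1..n}\<close>, or \<open>pairs n\<close> for matrices on the tensor square. The pair \<open>(i, k)\<close> carries the
  first tensor factor in \<open>i\<close> and the second in \<open>k\<close>.
\<close>

definition pairs :: "nat \<Rightarrow> (nat \<times> nat) set" where
  "pairs n = {1..n} \<times> {1..n}"

definition mmul :: "('i \<Rightarrow> 'i \<Rightarrow> 'b::semiring_0) \<Rightarrow> 'i set \<Rightarrow> ('i \<Rightarrow> 'i \<Rightarrow> 'b) \<Rightarrow> ('i \<Rightarrow> 'i \<Rightarrow> 'b)"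
    ("(_ \<odot>\<^bsub>_\<^esub> _)" [70, 0, 71] 70) where
  "(A \<odot>\<^bsub>X\<^esub> B) = (\<lambda>i j. \<Sum>k\<in>X. A i k * B k j)"

definition mat_eq :: "'i set \<Rightarrow> ('i \<Rightarrow> 'i \<Rightarrow> 'b) \<Rightarrow> ('i \<Rightarrow> 'i \<Rightarrow> 'b) \<Rightarrow> bool" where
  "mat_eq X A B \<longleftrightarrow> (\<forall>i\<in>X. \<forall>j\<in>X. A i j = B i j)"

definition trans_mat :: "('i \<Rightarrow> 'i \<Rightarrow> 'b) \<Rightarrow> ('i \<Rightarrow> 'i \<Rightarrow> 'b)" where
  "trans_mat A = (\<lambda>i j. A j i)"

definition trans1 :: "('i \<times> 'i \<Rightarrow> 'i \<times> 'i \<Rightarrow> 'b) \<Rightarrow> ('i \<times> 'i \<Rightarrow> 'i \<times> 'i \<Rightarrow> 'b)" where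
  "trans1 A = (\<lambda>(i, k) (j, l). A (j, k) (i, l))"

text \<open>\<open>tensor12 M N\<close> and \<open>tensor21 N M\<close> both have \<open>M\<close> in the first and \<open>N\<close> in the second tensor
  factor and differ in the order in which the entries are multiplied.\<close>

definition tensor12 :: "('i \<Rightarrow> 'i \<Rightarrow> 'b::times) \<Rightarrow> ('i \<Rightarrow> 'i \<Rightarrow> 'b) \<Rightarrow> ('i \<times> 'i \<Rightarrow> 'i \<times> 'i \<Rightarrow> 'b)" where
  "tensor12 M N = (\<lambda>(i, k) (j, l). M i j * N k l)"

definition tensor21 :: "('i \<Rightarrow> 'i \<Rightarrow> 'b::times) \<Rightarrow> ('i \<Rightarrow> 'i \<Rightarrow> 'b) \<Rightarrow> ('i \<times> 'i \<Rightarrow> 'i \<times> 'i \<Rightarrow> 'b)" where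
  "tensor21 N M = (\<lambda>(i, k) (j, l). N k l * M i j)"

definition id_mat :: "'i \<Rightarrow> 'i \<Rightarrow> 'b::zero_neq_one" where
  "id_mat = (\<lambda>i j. if i = j then 1 else 0)"

definition in_first :: "('i \<Rightarrow> 'i \<Rightarrow> 'b::ring_1) \<Rightarrow> ('i \<times> 'i \<Rightarrow> 'i \<times> 'i \<Rightarrow> 'b)" where
  "in_first M = tensor12 M id_mat"

definition in_second :: "('i \<Rightarrow> 'i \<Rightarrow> 'b::ring_1) \<Rightarrow> ('i \<times> 'i \<Rightarrow> 'i \<times> 'i \<Rightarrow> 'b)" where
  "in_second M = tensor12 id_mat M"

definition unit_mat :: "nat \<Rightarrow> nat \<Rightarrow> nat \<Rightarrow> nat \<Rightarrow> 'b::zero_neq_one" where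
  "unit_mat i j = (\<lambda>r c. if r = i \<and> c = j then 1 else 0)"

definition R_mat :: "nat \<Rightarrow> nat \<times> nat \<Rightarrow> nat \<times> nat \<Rightarrow> 'k::qfield" where
  "R_mat n = (\<lambda>x y. qpow (- 1 / of_nat n) *
     ((\<Sum>i=1..n. \<Sum>j=1..n. tensor12 (unit_mat i i) (unit_mat j j) x y)
      + (qpow 1 - 1) * (\<Sum>i=1..n. tensor12 (unit_mat i i) (unit_mat i i) x y)
      + (qpow 1 - qpow (- 1)) *
          (\<Sum>(i, j)\<in>{(i, j)\<in>pairs n. i > j}. tensor12 (unit_mat i j) (unit_mat j i) x y)))"

definition S_mat :: "nat \<Rightarrow> nat \<Rightarrow> nat \<Rightarrow> 'b::ring_1" where
  "S_mat n = (\<lambda>i j. if j = n + 1 - i then (- 1) ^ (n - i) else 0)"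

definition scalar_mat :: "('k \<Rightarrow> 'b::ring_1 \<Rightarrow> 'b) \<Rightarrow> ('i \<Rightarrow> 'i \<Rightarrow> 'k) \<Rightarrow> ('i \<Rightarrow> 'i \<Rightarrow> 'b)" where
  "scalar_mat scale A = (\<lambda>i j. scale (A i j) 1)"


section \<open>The network\<close>

datatype vertex =
    White nat nat nat
  | Black nat nat nat
  | Source nat
  | LeftSink nat
  | BottomSink nat

inductive edge :: "nat \<Rightarrow> vertex \<Rightarrow> vertex \<Rightarrow> bool" for n where
  "\<lbrakk>a + b + c = n - 1; b \<ge> 1\<rbrakk> \<Longrightarrow> edge n (White a b c) (Black a (b - 1) c)"
| "\<lbrakk>a + b + c = n - 1; c \<ge> 1\<rbrakk> \<Longrightarrow> edge n (White a b c) (Black a b (c - 1))"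
| "a + b + c + 2 = n \<Longrightarrow> edge n (Black a b c) (White (a + 1) b c)"
| "i \<in> {1..n} \<Longrightarrow> edge n (Source i) (White 0 (i - 1) (n - i))"
| "i \<in> {1..n} \<Longrightarrow> edge n (White (i - 1) 0 (n - i)) (LeftSink i)"
| "i \<in> {1..n} \<Longrightarrow> edge n (White (n - i) (i - 1) 0) (BottomSink i)"

definition paths :: "nat \<Rightarrow> vertex \<Rightarrow> vertex \<Rightarrow> vertex list set" where
  "paths n s t = {P. P \<noteq> [] \<and> hd P = s \<and> last P = t \<and> successively (edge n) P}"

text \<open>
  The faces touching a vertex. Faces are the vertices of the triangular lattice and the network is
  drawn dually to it: an edge from \<open>u\<close> to \<open>v\<close> crosses exactly one lattice edge, whose two ends
  are the common elements of \<open>corners n u\<close> and \<open>corners n v\<close> (lemma \<open>edge_crosses\<close> below). For a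
  source or a sink, which lies on the boundary of the triangle, this is a boundary lattice edge.
\<close>

fun corners :: "nat \<Rightarrow> vertex \<Rightarrow> face set" where
  "corners n (White a b c) = {(a + 1, b, c), (a, b + 1, c), (a, b, c + 1)}"
| "corners n (Black a b c) = {(a + 1, b, c + 1), (a + 1, b + 1, c), (a, b + 1, c + 1)}"
| "corners n (Source i) = {(0, i - 1, n - i + 1), (0, i, n - i)}"
| "corners n (LeftSink i) = {(i - 1, 0, n - i + 1), (i, 0, n - i)}"
| "corners n (BottomSink i) = {(n - i + 1, i - 1, 0), (n - i, i, 0)}"

lemma edge_crosses:
  assumes "edge n u v"
  shows "card (corners n u \<inter> corners n v) = 2" and "corners n u \<inter> corners n v \<subseteq> faces n"
proof -
  have "\<exists>x y. x \<noteq> y \<and> corners n u \<inter> corners n v = {x, y} \<and> x \<in> faces n \<and> y \<in> faces n"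
    using assms
  proof cases
    case (1 a b c)
    show ?thesis
      by (rule exI[of _ "(a + 1, b, c)"], rule exI[of _ "(a, b, c + 1)"])
        (use 1 in \<open>auto simp: faces_def\<close>)
  next
    case (2 a b c)
    show ?thesis
      by (rule exI[of _ "(a + 1, b, c)"], rule exI[of _ "(a, b + 1, c)"])
        (use 2 in \<open>auto simp: faces_def\<close>)
  next
    case (3 a b c)
    show ?thesis
      by (rule exI[of _ "(a + 1, b + 1, c)"], rule exI[of _ "(a + 1, b, c + 1)"])
        (use 3 in \<open>auto simp: faces_def\<close>)
  next
    case (4 i)
    show ?thesis
      by (rule exI[of _ "(0, i, n - i)"], rule exI[of _ "(0, i - 1, n - i + 1)"])
        (use 4 in \<open>auto simp: faces_def\<close>)
  next
    case (5 i)
    show ?thesis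
      by (rule exI[of _ "(i, 0, n - i)"], rule exI[of _ "(i - 1, 0, n - i + 1)"])
        (use 5 in \<open>auto simp: faces_def\<close>)
  next
    case (6 i)
    show ?thesis
      by (rule exI[of _ "(n - i + 1, i - 1, 0)"], rule exI[of _ "(n - i, i, 0)"])
        (use 6 in \<open>auto simp: faces_def\<close>)
  qed
  then obtain x y where *: "x \<noteq> y" "corners n u \<inter> corners n v = {x, y}" "x \<in> faces n" "y \<in> faces n"
    by blast
  show "card (corners n u \<inter> corners n v) = 2" and "corners n u \<inter> corners n v \<subseteq> faces n"
    unfolding *(2) using * by simp_all
qed

text \<open>The network is acyclic, hence the sums over paths below are finite.\<close>

fun vrank :: "nat \<Rightarrow> vertex \<Rightarrow> nat" where
  "vrank n (White a b c) = 2 * a + 1"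
| "vrank n (Black a b c) = 2 * a + 2"
| "vrank n (Source i) = 0"
| "vrank n (LeftSink i) = 2 * n + 1"
| "vrank n (BottomSink i) = 2 * n + 1"

lemma edge_vrank: "edge n u v \<Longrightarrow> vrank n u < vrank n v"
  by (induction rule: edge.induct) auto

lemma finite_paths: "finite (paths n s t)"
proof -
  let ?W = "(\<Union>a\<le>n. \<Union>b\<le>n. \<Union>c\<le>n. {White a b c, Black a b c})
    \<union> (\<Union>i\<le>n. {Source i, LeftSink i, BottomSink i}) \<union> {s}"
  have W: "v \<in> ?W" if "edge n u v" for u v
    using that by cases auto
  have "paths n s t \<subseteq> {P. set P \<subseteq> ?W \<and> distinct P}"
  proof
    fix P assume P: "P \<in> paths n s t"
    then have "successively (\<lambda>u v. vrank n u < vrank n v) P"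
      unfolding paths_def by (auto elim!: successively_mono intro: edge_vrank)
    then have "sorted_wrt (\<lambda>u v. vrank n u < vrank n v) P"
      by (subst (asm) successively_conv_sorted_wrt) (auto intro: transpI)
    moreover have "distinct P" if "sorted_wrt (\<lambda>u v. vrank n u < vrank n v) P" for P
      using that by (induction P) auto
    ultimately have "distinct P" by blast
    moreover have "set P \<subseteq> insert (hd P) ?W" if "successively (edge n) P" for P
      using that by (induction P rule: induct_list012) (auto dest: W)
    then have "set P \<subseteq> insert s ?W" using P unfolding paths_def by blast
    then have "set P \<subseteq> ?W" by auto
    ultimately show "P \<in> {P. set P \<subseteq> ?W \<and> distinct P}" by blast
  qed
  moreover have "finite {P. set P \<subseteq> ?W \<and> distinct P}"
    by (rule finite_subset_distinct) simp
  ultimately show ?thesis by (rule finite_subset)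
qed

definition steps :: "vertex list \<Rightarrow> (vertex \<times> vertex) set" where
  "steps P = set (zip P (tl P))"

text \<open>
  A path \<open>P\<close> from a source to a sink cuts the triangle into two regions. Since all sources lie on the
  right side of the triangle, the region to the right of \<open>P\<close> is the one containing the top face
  \<open>(0, 0, n)\<close>: the region above \<open>P\<close> if \<open>P\<close> ends on the left side, and the region that also contains
  \<open>(n, 0, 0)\<close> if \<open>P\<close> ends at the bottom. It consists of the faces that can be reached from
  \<open>(0, 0, n)\<close> by passing between neighbouring faces without crossing an edge of \<open>P\<close>.
\<close>

definition adjacent_off :: "nat \<Rightarrow> vertex list \<Rightarrow> face \<Rightarrow> face \<Rightarrow> bool" where
  "adjacent_off n P \<alpha> \<beta> \<longleftrightarrow>
     (\<exists>u v. edge n u v \<and> (u, v) \<notin> steps P \<and> corners n u \<inter> corners n v = {\<alpha>, \<beta>})"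

definition right_faces :: "nat \<Rightarrow> vertex list \<Rightarrow> face set" where
  "right_faces n P = {\<alpha>. (adjacent_off n P)\<^sup>*\<^sup>* (0, 0, n) \<alpha>}"

definition path_weight :: "nat \<Rightarrow> vertex list \<Rightarrow> 'k::qfield qtorus" where
  "path_weight n P = weyl (right_faces n P) (\<lambda>_. 1)"


section \<open>Quantum transport matrices\<close>

definition calM1 :: "nat \<Rightarrow> nat \<Rightarrow> nat \<Rightarrow> 'k::qfield qtorus" where
  "calM1 n = (\<lambda>i j. \<Sum>P\<in>paths n (Source j) (LeftSink i). path_weight n P)"

definition calM2 :: "nat \<Rightarrow> nat \<Rightarrow> nat \<Rightarrow> 'k::qfield qtorus" where
  "calM2 n = (\<lambda>i j. \<Sum>P\<in>paths n (Source j) (BottomSink i). path_weight n P)"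

definition D1 :: "nat \<Rightarrow> 'k::qfield qtorus" where
  "D1 n = weyl (faces n) (\<lambda>(a, b, c). of_nat c / of_nat n)"

definition D2 :: "nat \<Rightarrow> 'k::qfield qtorus" where
  "D2 n = weyl (faces n) (\<lambda>(a, b, c). of_nat a / of_nat n)"

definition Q_mat :: "nat \<Rightarrow> nat \<Rightarrow> 'k::qfield" where
  "Q_mat = (\<lambda>i j. if i = j then qpow (of_nat j - 1 / 2) else 0)"

definition M1 :: "nat \<Rightarrow> nat \<Rightarrow> nat \<Rightarrow> 'k::qfield qtorus" where
  "M1 n = (\<lambda>i j. (scalar_mat qscale Q_mat \<odot>\<^bsub>{1..n}\<^esub> S_mat n \<odot>\<^bsub>{1..n}\<^esub> calM1 n) i j * minv (D1 n))"

definition M2 :: "nat \<Rightarrow> nat \<Rightarrow> nat \<Rightarrow> 'k::qfield qtorus" where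
  "M2 n = (\<lambda>i j. (scalar_mat qscale Q_mat \<odot>\<^bsub>{1..n}\<^esub> S_mat n \<odot>\<^bsub>{1..n}\<^esub> calM2 n) i j
             * minv (D1 n) * minv (D2 n))"

definition A_mat :: "nat \<Rightarrow> nat \<Rightarrow> nat \<Rightarrow> 'k::qfield qtorus" where
  "A_mat n = trans_mat (M1 n) \<odot>\<^bsub>{1..n}\<^esub> M2 n"

definition A_gen :: "nat \<Rightarrow> (nat \<Rightarrow> nat \<Rightarrow> 'b::ring_1) \<Rightarrow> (nat \<Rightarrow> nat \<Rightarrow> 'b) \<Rightarrow> nat \<Rightarrow> nat \<Rightarrow> 'b" where
  "A_gen n A M = trans_mat M \<odot>\<^bsub>{1..n}\<^esub> trans_mat (S_mat n) \<odot>\<^bsub>{1..n}\<^esub> A \<odot>\<^bsub>{1..n}\<^esub> S_mat n \<odot>\<^bsub>{1..n}\<^esub> M"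

end

theory Submission
  imports Defs
begin

text \<open>
  Write \<open>U\<close> for \<open>calM1 D1\<^sup>-\<^sup>1\<close> and \<open>V\<close> for \<open>calM2 D1\<^sup>-\<^sup>1 D2\<^sup>-\<^sup>1\<close> with its rows rescaled. Since \<open>Q S\<close> acts on the rows
  of both transport matrices in the same way, it disappears from \<open>A = M1\<^sup>T M2\<close> up to the rescaling, and
  \<open>A = U\<^sup>T V\<close>. The reflection equation for \<open>A\<close> follows from the three exchange relations
  \<open>R U\<^sub>1 U\<^sub>2 = U\<^sub>2 U\<^sub>1 R\<close>, \<open>R V\<^sub>1 V\<^sub>2 = V\<^sub>2 V\<^sub>1 R\<close> and \<open>U\<^sub>1 V\<^sub>2 = V\<^sub>2 U\<^sub>1 R\<close>: transposing the last one in one tensor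
  factor shows how \<open>V\<^sub>1\<close> and \<open>U\<^sub>2\<^sup>T\<close> pass each other by using up the inner, partially transposed R-matrix, and the
  outer \<open>R\<close> is then carried through by the first two (\<open>reflection_product\<close>). The same formalism shows that
  the reflection equation is preserved by \<open>A \<mapsto> W\<^sup>T A W\<close> if \<open>R W\<^sub>1 W\<^sub>2 = W\<^sub>2 W\<^sub>1 R\<close> and the entries of \<open>W\<close> commute
  with those of \<open>A\<close> (\<open>reflection_congruence\<close>). The theorem is the case \<open>W = S M\<close>: multiplication by \<open>S\<close>
  reverses the rows of \<open>M\<close> and thereby replaces \<open>R\<^sup>T\<close> by \<open>R\<close> in the relation assumed for \<open>M\<close>.

  For the exchange relations, put the rows of \<open>calM1\<close> on top of those of \<open>calM2\<close>. In the resulting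
  matrix the rows are indexed by the sinks in the order in which they lie on the boundary of the
  triangle, starting at the top, and all three relations say the same thing, namely that any two rows
  satisfy the relations \<open>row_exchange\<close> of a quantum matrix (\<open>transport_rows\<close>). This is proved by cutting
  the network along the lines \<open>a = const\<close>, one level after the other, starting from the corner
  \<open>(n, 0, 0)\<close>. When level \<open>a\<close> is added to the levels beyond it, a path entering in column \<open>j\<close> continues in
  column \<open>j\<close> or \<open>j - 1\<close>, so an old row \<open>v\<close> is replaced by \<open>X\<^sub>j (q\<^sup>-\<^sup>1\<^sup>/\<^sup>2 v\<^sub>j + q\<^sup>1\<^sup>/\<^sup>2 v\<^sub>j\<^sub>-\<^sub>1)\<close>, where \<open>X\<^sub>j\<close> is
  the monomial of the first \<open>j\<close> faces of line \<open>a\<close>; this operation preserves the relations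
  (\<open>row_exchange_extend\<close>). In addition the level has two sinks of its own, whose rows have a single entry
  and which enter the order at its two ends.

  The quantities \<open>D1\<close> and \<open>D2\<close> pair under the skew form only with the three corners of the triangle, so they
  commute with all path weights up to a power of \<open>q\<close> depending only on the side on which the path ends.
  These powers produce the factor \<open>q\<^sup>-\<^sup>1\<^sup>/\<^sup>n\<close> in \<open>U\<^sub>1 V\<^sub>2 = V\<^sub>2 U\<^sub>1 R\<close>.
\<close>


section \<open>Matrices on the tensor square\<close>

lemma finite_pairs [simp]: "finite (pairs n)"
  by (simp add: pairs_def)

lemma sum_pairs: "(\<Sum>x\<in>pairs n. f x) = (\<Sum>a=1..n. \<Sum>b=1..n. f (a, b))"
  by (simp add: pairs_def sum.cartesian_product)

lemma mmul_assoc: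
  fixes A B C :: "'i \<Rightarrow> 'i \<Rightarrow> 'b::semiring_0"
  shows "A \<odot>\<^bsub>X\<^esub> B \<odot>\<^bsub>X\<^esub> C = A \<odot>\<^bsub>X\<^esub> (B \<odot>\<^bsub>X\<^esub> C)"
proof (intro ext)
  fix i j
  have "(A \<odot>\<^bsub>X\<^esub> B \<odot>\<^bsub>X\<^esub> C) i j = (\<Sum>k\<in>X. \<Sum>l\<in>X. A i l * B l k * C k j)"
    by (simp add: mmul_def sum_distrib_right)
  also have "\<dots> = (\<Sum>l\<in>X. \<Sum>k\<in>X. A i l * B l k * C k j)"
    by (rule sum.swap)
  also have "\<dots> = (A \<odot>\<^bsub>X\<^esub> (B \<odot>\<^bsub>X\<^esub> C)) i j"
    by (simp add: mmul_def sum_distrib_left mult.assoc)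
  finally show "(A \<odot>\<^bsub>X\<^esub> B \<odot>\<^bsub>X\<^esub> C) i j = (A \<odot>\<^bsub>X\<^esub> (B \<odot>\<^bsub>X\<^esub> C)) i j" .
qed

text \<open>
  Cutting matrices off outside \<open>X\<close> turns \<open>mat_eq\<close> into equality, so that relations can be applied inside
  longer products.
\<close>

definition cut :: "'i set \<Rightarrow> ('i \<Rightarrow> 'i \<Rightarrow> 'b::zero) \<Rightarrow> 'i \<Rightarrow> 'i \<Rightarrow> 'b" where
  "cut X A = (\<lambda>i j. if i \<in> X \<and> j \<in> X then A i j else 0)"

lemma mat_eq_iff_cut: "mat_eq X A B \<longleftrightarrow> cut X A = cut X B"
  by (auto simp: mat_eq_def cut_def fun_eq_iff)

lemma cut_mmul:
  fixes A B :: "'i \<Rightarrow> 'i \<Rightarrow> 'b::semiring_0"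
  shows "cut X (A \<odot>\<^bsub>X\<^esub> B) = cut X A \<odot>\<^bsub>X\<^esub> cut X B"
  by (auto simp: cut_def mmul_def fun_eq_iff intro!: sum.cong)

lemma if_distribs:
  fixes x y :: "'b::ring_1"
  shows "(if P then x else 0) * y = (if P then x * y else 0)"
    "y * (if P then x else 0) = (if P then y * x else 0)"
  by simp_all

lemma in_first_mmul:
  assumes "k \<in> {1..n}"
  shows "(in_first A \<odot>\<^bsub>pairs n\<^esub> T) (i, k) y = (\<Sum>a=1..n. A i a * T (a, k) y)"
proof -
  have "(\<Sum>b=1..n. A i a * id_mat k b * T (a, b) y) = A i a * T (a, k) y" for a
    using assms by (simp add: id_mat_def if_distribs)
  then show ?thesis by (simp add: mmul_def sum_pairs in_first_def tensor12_def)
qed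

lemma in_second_mmul:
  assumes "i \<in> {1..n}"
  shows "(in_second A \<odot>\<^bsub>pairs n\<^esub> T) (i, k) y = (\<Sum>b=1..n. A k b * T (i, b) y)"
proof -
  have "(\<Sum>a=1..n. id_mat i a * A k b * T (a, b) y) = A k b * T (i, b) y" for b
    using assms by (simp add: id_mat_def if_distribs)
  then show ?thesis
    unfolding mmul_def sum_pairs
    by (subst sum.swap) (simp add: in_second_def tensor12_def)
qed

lemma mmul_in_first:
  assumes "l \<in> {1..n}"
  shows "(T \<odot>\<^bsub>pairs n\<^esub> in_first A) x (j, l) = (\<Sum>a=1..n. T x (a, l) * A a j)"
proof -
  have "(\<Sum>b=1..n. T x (a, b) * (A a j * id_mat b l)) = T x (a, l) * A a j" for a
    using assms by (simp add: id_mat_def if_distribs)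
  then show ?thesis by (simp add: mmul_def sum_pairs in_first_def tensor12_def)
qed

lemma mmul_in_second:
  assumes "j \<in> {1..n}"
  shows "(T \<odot>\<^bsub>pairs n\<^esub> in_second A) x (j, l) = (\<Sum>b=1..n. T x (j, b) * A b l)"
proof -
  have "(\<Sum>a=1..n. T x (a, b) * (id_mat a j * A b l)) = T x (j, b) * A b l" for b
    using assms by (simp add: id_mat_def if_distribs)
  then show ?thesis
    unfolding mmul_def sum_pairs
    by (subst sum.swap) (simp add: in_second_def tensor12_def)
qed

lemma mat_eq_pairsI:
  assumes "\<And>i k j l. \<lbrakk>i \<in> {1..n}; k \<in> {1..n}; j \<in> {1..n}; l \<in> {1..n}\<rbrakk> \<Longrightarrow> A (i, k) (j, l) = B (i, k) (j, l)"
  shows "mat_eq (pairs n) A B"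
  using assms by (auto simp: mat_eq_def pairs_def)

lemma mat_eq_pairsD:
  assumes "mat_eq (pairs n) A B" "i \<in> {1..n}" "k \<in> {1..n}" "j \<in> {1..n}" "l \<in> {1..n}"
  shows "A (i, k) (j, l) = B (i, k) (j, l)"
  using assms by (auto simp: mat_eq_def pairs_def)

lemma in_first_in_second:
  "mat_eq (pairs n) (in_first A \<odot>\<^bsub>pairs n\<^esub> in_second B) (tensor12 A B)"
  by (rule mat_eq_pairsI)
    (simp add: in_first_mmul, simp add: in_second_def tensor12_def id_mat_def if_distribs
       flip: mult.assoc)

lemma in_second_in_first:
  "mat_eq (pairs n) (in_second B \<odot>\<^bsub>pairs n\<^esub> in_first A) (tensor21 B A)"
  by (rule mat_eq_pairsI)
    (simp add: in_second_mmul, simp add: in_first_def tensor12_def tensor21_def id_mat_def if_distribs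
       flip: mult.assoc)

lemma in_first_product:
  "mat_eq (pairs n) (in_first (A \<odot>\<^bsub>{1..n}\<^esub> B)) (in_first A \<odot>\<^bsub>pairs n\<^esub> in_first B)"
  by (rule mat_eq_pairsI)
    (simp add: in_first_mmul, simp add: in_first_def tensor12_def mmul_def sum_distrib_right mult.assoc)

lemma in_second_product:
  "mat_eq (pairs n) (in_second (A \<odot>\<^bsub>{1..n}\<^esub> B)) (in_second A \<odot>\<^bsub>pairs n\<^esub> in_second B)"
  by (rule mat_eq_pairsI)
    (simp add: in_second_mmul, auto simp: in_second_def tensor12_def mmul_def id_mat_def)

lemma in_first_in_second_commute:
  assumes "\<And>i j k l. \<lbrakk>i \<in> {1..n}; j \<in> {1..n}; k \<in> {1..n}; l \<in> {1..n}\<rbrakk> \<Longrightarrow> A i j * B k l = B k l * A i j"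
  shows "mat_eq (pairs n) (in_first A \<odot>\<^bsub>pairs n\<^esub> in_second B) (in_second B \<odot>\<^bsub>pairs n\<^esub> in_first A)"
proof -
  have "mat_eq (pairs n) (tensor12 A B) (tensor21 B A)"
    by (rule mat_eq_pairsI) (simp add: tensor12_def tensor21_def assms)
  then show ?thesis
    using in_first_in_second[of n A B] in_second_in_first[of n B A] by (simp add: mat_eq_iff_cut)
qed


section \<open>The reflection equation from exchange relations\<close>

definition RTT :: "nat \<Rightarrow> (nat \<times> nat \<Rightarrow> nat \<times> nat \<Rightarrow> 'b::ring_1) \<Rightarrow> (nat \<Rightarrow> nat \<Rightarrow> 'b) \<Rightarrow> bool" where
  "RTT n R W \<longleftrightarrow> mat_eq (pairs n) (R \<odot>\<^bsub>pairs n\<^esub> tensor12 W W) (tensor21 W W \<odot>\<^bsub>pairs n\<^esub> R)"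

definition reflection :: "nat \<Rightarrow> (nat \<times> nat \<Rightarrow> nat \<times> nat \<Rightarrow> 'b::ring_1) \<Rightarrow> (nat \<Rightarrow> nat \<Rightarrow> 'b) \<Rightarrow> bool" where
  "reflection n R A \<longleftrightarrow> mat_eq (pairs n)
     (R \<odot>\<^bsub>pairs n\<^esub> in_first A \<odot>\<^bsub>pairs n\<^esub> trans1 R \<odot>\<^bsub>pairs n\<^esub> in_second A)
     (in_second A \<odot>\<^bsub>pairs n\<^esub> trans1 R \<odot>\<^bsub>pairs n\<^esub> in_first A \<odot>\<^bsub>pairs n\<^esub> R)"

text \<open>
  The property \<open>flip\<close> says that \<open>R\<close> does not change if it is transposed and the two tensor factors are
  exchanged. It is the reason why transposed relations can again be expressed by \<open>R\<close>.
\<close>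

locale exchange_matrix =
  fixes n :: nat and R :: "nat \<times> nat \<Rightarrow> nat \<times> nat \<Rightarrow> 'b::ring_1"
  assumes central: "R x y * z = z * R x y"
    and flip: "R (i, k) (j, l) = R (l, j) (k, i)"
begin

abbreviation mult2 (infixl "\<star>" 70)
  where "A \<star> B \<equiv> A \<odot>\<^bsub>pairs n\<^esub> B"

lemma RTT_entry:
  assumes "RTT n R W" "i \<in> {1..n}" "k \<in> {1..n}" "j \<in> {1..n}" "l \<in> {1..n}"
  shows "(\<Sum>a=1..n. \<Sum>b=1..n. R (i, k) (a, b) * (W a j * W b l))
       = (\<Sum>a=1..n. \<Sum>b=1..n. W k b * W i a * R (a, b) (j, l))"
  using mat_eq_pairsD[OF assms(1)[unfolded RTT_def] assms(2-)]
  by (simp add: mmul_def sum_pairs tensor12_def tensor21_def)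

lemma RTT_words:
  assumes "RTT n R W"
  shows "mat_eq (pairs n) (R \<star> in_first W \<star> in_second W)
           (in_second W \<star> in_first W \<star> R)"
  using assms in_first_in_second[of n W W] in_second_in_first[of n W W]
  by (simp add: RTT_def mat_eq_iff_cut mmul_assoc cut_mmul flip: mmul_assoc[of "cut _ (in_second W)"])

text \<open>
  Transposing both tensor factors of \<open>R W\<^sub>1 W\<^sub>2 = W\<^sub>2 W\<^sub>1 R\<close> reverses the order of the matrices, but not of the
  entries, and transposes \<open>R\<close>. Exchanging the two tensor factors turns \<open>R\<^sup>T\<close> back into \<open>R\<close>.
\<close>

lemma RTT_transposed:
  assumes "RTT n R W"
  shows "mat_eq (pairs n)
    (R \<star> in_first (trans_mat W) \<star> in_second (trans_mat W))
    (in_second (trans_mat W) \<star> in_first (trans_mat W) \<star> R)"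
proof (rule mat_eq_pairsI)
  fix i k j l assume ix: "i \<in> {1..n}" "k \<in> {1..n}" "j \<in> {1..n}" "l \<in> {1..n}"
  have "(R \<star> in_first (trans_mat W) \<star> in_second (trans_mat W)) (i, k) (j, l)
      = (\<Sum>b=1..n. \<Sum>a=1..n. R (i, k) (a, b) * W j a * W l b)"
    using ix by (simp add: mmul_in_second mmul_in_first sum_distrib_right trans_mat_def)
  also have "\<dots> = (\<Sum>b=1..n. \<Sum>a=1..n. W j a * W l b * R (b, a) (k, i))"
    by (intro sum.cong refl) (simp add: central flip[of i k] mult.assoc)
  also have "\<dots> = (\<Sum>b=1..n. \<Sum>a=1..n. R (l, j) (b, a) * (W b k * W a i))"
    by (rule RTT_entry[OF assms, symmetric]) (use ix in auto)
  also have "\<dots> = (\<Sum>b=1..n. \<Sum>a=1..n. W b k * (W a i * R (a, b) (j, l)))"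
    by (intro sum.cong refl) (metis central flip mult.assoc)
  also have "\<dots> = (in_second (trans_mat W) \<star> in_first (trans_mat W) \<star> R) (i, k) (j, l)"
    using ix by (simp add: mmul_assoc in_second_mmul in_first_mmul sum_distrib_left trans_mat_def)
  finally show "(R \<star> in_first (trans_mat W) \<star> in_second (trans_mat W)) (i, k) (j, l)
    = (in_second (trans_mat W) \<star> in_first (trans_mat W) \<star> R) (i, k) (j, l)" .
qed

lemma first_trans1_second:
  assumes "k \<in> {1..n}" "j \<in> {1..n}"
  shows "(in_first A \<star> trans1 R \<star> in_second B) (i, k) (j, l)
    = (\<Sum>b=1..n. \<Sum>a=1..n. A i a * B b l * R (j, k) (a, b))"
  using assms
  by (simp add: mmul_in_second in_first_mmul sum_distrib_right trans1_def mult.assoc central)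

lemma second_trans1_first:
  assumes "i \<in> {1..n}" "l \<in> {1..n}"
  shows "(in_second B \<star> trans1 R \<star> in_first A) (i, k) (j, l)
    = (\<Sum>a=1..n. \<Sum>b=1..n. B k b * A a j * R (a, b) (i, l))"
  using assms
  by (simp add: mmul_in_first in_second_mmul sum_distrib_right trans1_def mult.assoc central)

text \<open>
  If only one tensor factor is transposed, the two sides of \<open>R W\<^sub>1 W\<^sub>2 = W\<^sub>2 W\<^sub>1 R\<close> become products in which
  the partial transpose of \<open>R\<close> stands between \<open>W\<close> and \<open>W\<^sup>T\<close>. Exchanging the tensor factors first makes the
  order of the matrices agree with the order in which their entries are multiplied.
\<close>

lemma RTT_half_transposed:
  assumes "RTT n R W"
  shows "mat_eq (pairs n) (in_first W \<star> trans1 R \<star> in_second (trans_mat W))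
           (in_second (trans_mat W) \<star> trans1 R \<star> in_first W)"
    and "mat_eq (pairs n) (in_second W \<star> trans1 R \<star> in_first (trans_mat W))
           (in_first (trans_mat W) \<star> trans1 R \<star> in_second W)"
proof -
  have key: "(\<Sum>b=1..n. \<Sum>a=1..n. W i a * W l b * R (j, k) (a, b))
      = (\<Sum>b=1..n. \<Sum>a=1..n. W b k * W a j * R (a, b) (i, l))"
    if ix: "i \<in> {1..n}" "k \<in> {1..n}" "j \<in> {1..n}" "l \<in> {1..n}" for i k j l
  proof -
    have "(\<Sum>b=1..n. \<Sum>a=1..n. W i a * W l b * R (j, k) (a, b))
        = (\<Sum>b=1..n. \<Sum>a=1..n. W i a * W l b * R (b, a) (k, j))"
      by (simp add: flip[of j k])
    also have "\<dots> = (\<Sum>b=1..n. \<Sum>a=1..n. R (l, i) (b, a) * (W b k * W a j))"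
      by (rule RTT_entry[OF assms, symmetric]) (use ix in auto)
    also have "\<dots> = (\<Sum>b=1..n. \<Sum>a=1..n. W b k * W a j * R (a, b) (i, l))"
      by (intro sum.cong refl) (metis central flip)
    finally show ?thesis .
  qed
  show "mat_eq (pairs n) (in_first W \<star> trans1 R \<star> in_second (trans_mat W))
           (in_second (trans_mat W) \<star> trans1 R \<star> in_first W)"
  proof (rule mat_eq_pairsI)
    fix i k j l assume ix: "i \<in> {1..n}" "k \<in> {1..n}" "j \<in> {1..n}" "l \<in> {1..n}"
    have "(\<Sum>b=1..n. \<Sum>a=1..n. W i a * W l b * R (j, k) (a, b))
        = (\<Sum>a=1..n. \<Sum>b=1..n. W b k * W a j * R (a, b) (i, l))"
      by (subst sum.swap) (rule key[OF ix])
    then show "(in_first W \<star> trans1 R \<star> in_second (trans_mat W)) (i, k) (j, l) =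
           (in_second (trans_mat W) \<star> trans1 R \<star> in_first W) (i, k) (j, l)"
      using ix by (simp add: first_trans1_second second_trans1_first trans_mat_def)
  qed
  show "mat_eq (pairs n) (in_second W \<star> trans1 R \<star> in_first (trans_mat W))
           (in_first (trans_mat W) \<star> trans1 R \<star> in_second W)"
  proof (rule mat_eq_pairsI)
    fix i k j l assume ix: "i \<in> {1..n}" "k \<in> {1..n}" "j \<in> {1..n}" "l \<in> {1..n}"
    have "(\<Sum>a=1..n. \<Sum>b=1..n. W k b * W j a * R (a, b) (i, l))
        = (\<Sum>a=1..n. \<Sum>b=1..n. W k b * W j a * R (l, i) (b, a))"
      by (intro sum.cong refl) (metis flip)
    also have "\<dots> = (\<Sum>a=1..n. \<Sum>b=1..n. W a i * W b l * R (b, a) (k, j))"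
      by (rule key) (use ix in auto)
    also have "\<dots> = (\<Sum>b=1..n. \<Sum>a=1..n. W a i * W b l * R (j, k) (a, b))"
      by (subst sum.swap, intro sum.cong refl) (metis flip)
    finally show "(in_second W \<star> trans1 R \<star> in_first (trans_mat W)) (i, k) (j, l) =
           (in_first (trans_mat W) \<star> trans1 R \<star> in_second W) (i, k) (j, l)"
      using ix by (simp add: first_trans1_second second_trans1_first trans_mat_def)
  qed
qed

text \<open>
  The origin of the partially transposed matrix in the reflection equation: it is what an exchange
  relation with \<open>R\<close> on one side only turns into when the factor \<open>U\<close> is transposed.
\<close>

lemma exchange_half_transposed:
  assumes "mat_eq (pairs n) (tensor12 U V) (tensor21 V U \<star> R)"
  shows "mat_eq (pairs n) (in_first V \<star> trans1 R \<star> in_second (trans_mat U))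
           (in_second (trans_mat U) \<star> in_first V)"
    and "mat_eq (pairs n) (in_second V \<star> trans1 R \<star> in_first (trans_mat U))
           (in_first (trans_mat U) \<star> in_second V)"
proof -
  have key: "U i j * V k l = (\<Sum>a=1..n. \<Sum>b=1..n. V k b * U i a * R (a, b) (j, l))"
    if ix: "i \<in> {1..n}" "k \<in> {1..n}" "j \<in> {1..n}" "l \<in> {1..n}" for i k j l
    using mat_eq_pairsD[OF assms ix] by (simp add: mmul_def sum_pairs tensor12_def tensor21_def)
  have *: "(in_second A \<star> in_first B) (i, k) (j, l) = A k l * B i j"
    "(in_first A \<star> in_second B) (i, k) (j, l) = A i j * B k l"
    if ix: "i \<in> {1..n}" "k \<in> {1..n}" "j \<in> {1..n}" "l \<in> {1..n}" for A B :: "nat \<Rightarrow> nat \<Rightarrow> 'b" and i j k l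
    using mat_eq_pairsD[OF in_second_in_first ix] mat_eq_pairsD[OF in_first_in_second ix]
    by (simp_all add: tensor12_def tensor21_def)
  show "mat_eq (pairs n) (in_first V \<star> trans1 R \<star> in_second (trans_mat U))
           (in_second (trans_mat U) \<star> in_first V)"
  proof (rule mat_eq_pairsI)
    fix i k j l assume ix: "i \<in> {1..n}" "k \<in> {1..n}" "j \<in> {1..n}" "l \<in> {1..n}"
    have "(\<Sum>b=1..n. \<Sum>a=1..n. V i a * U l b * R (j, k) (a, b))
        = (\<Sum>b=1..n. \<Sum>a=1..n. V i a * U l b * R (b, a) (k, j))"
      by (simp add: flip[of j k])
    also have "\<dots> = U l k * V i j"
      using key[of l i k j] ix by simp
    finally show "(in_first V \<star> trans1 R \<star> in_second (trans_mat U)) (i, k) (j, l) =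
           (in_second (trans_mat U) \<star> in_first V) (i, k) (j, l)"
      using ix by (simp add: first_trans1_second * trans_mat_def)
  qed
  show "mat_eq (pairs n) (in_second V \<star> trans1 R \<star> in_first (trans_mat U))
           (in_first (trans_mat U) \<star> in_second V)"
    by (rule mat_eq_pairsI) (simp add: second_trans1_first * trans_mat_def key)
qed

text \<open>
  \<open>R U\<^sub>1\<^sup>T V\<^sub>1 R\<^sup>t U\<^sub>2\<^sup>T V\<^sub>2 = R U\<^sub>1\<^sup>T U\<^sub>2\<^sup>T V\<^sub>1 V\<^sub>2 = U\<^sub>2\<^sup>T U\<^sub>1\<^sup>T R V\<^sub>1 V\<^sub>2 = U\<^sub>2\<^sup>T U\<^sub>1\<^sup>T V\<^sub>2 V\<^sub>1 R\<close>, and in the last expression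
  \<open>U\<^sub>1\<^sup>T V\<^sub>2\<close> can be replaced by \<open>V\<^sub>2 R\<^sup>t U\<^sub>1\<^sup>T\<close>, where \<open>R\<^sup>t\<close> is the partial transpose.
\<close>

theorem reflection_product:
  assumes U: "RTT n R U" and V: "RTT n R V"
    and UV: "mat_eq (pairs n) (tensor12 U V) (tensor21 V U \<star> R)"
  shows "reflection n R (trans_mat U \<odot>\<^bsub>{1..n}\<^esub> V)"
proof -
  let ?X = "pairs n"
  define r where "r = cut ?X R"
  define t where "t = cut ?X (trans1 R)"
  define u1 where "u1 = cut ?X (in_first (trans_mat U))"
  define u2 where "u2 = cut ?X (in_second (trans_mat U))"
  define v1 where "v1 = cut ?X (in_first V)"
  define v2 where "v2 = cut ?X (in_second V)"
  note defs = r_def t_def u1_def u2_def v1_def v2_def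
  have a: "v1 \<star> t \<star> u2 = u2 \<star> v1" "v2 \<star> t \<star> u1 = u1 \<star> v2"
    using exchange_half_transposed[OF UV] by (simp_all add: mat_eq_iff_cut cut_mmul defs)
  have b: "r \<star> u1 \<star> u2 = u2 \<star> u1 \<star> r" "r \<star> v1 \<star> v2 = v2 \<star> v1 \<star> r"
    using RTT_transposed[OF U] RTT_words[OF V] by (simp_all add: mat_eq_iff_cut cut_mmul defs)
  have "r \<star> (u1 \<star> v1) \<star> t \<star> (u2 \<star> v2) = r \<star> u1 \<star> (v1 \<star> t \<star> u2 \<star> v2)"
    by (simp only: mmul_assoc)
  also have "\<dots> = r \<star> u1 \<star> u2 \<star> (v1 \<star> v2)"
    by (simp only: a) (simp only: mmul_assoc)
  also have "\<dots> = u2 \<star> u1 \<star> (r \<star> v1 \<star> v2)"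
    by (simp only: b(1)) (simp only: mmul_assoc)
  also have "\<dots> = u2 \<star> (u1 \<star> v2 \<star> (v1 \<star> r))"
    by (simp only: b(2)) (simp only: mmul_assoc)
  also have "\<dots> = u2 \<star> v2 \<star> t \<star> (u1 \<star> v1) \<star> r"
    by (simp only: a(2)[symmetric]) (simp only: mmul_assoc)
  finally show ?thesis
    using in_first_product[of n "trans_mat U" V] in_second_product[of n "trans_mat U" V]
    by (simp add: reflection_def mat_eq_iff_cut cut_mmul flip: defs)
qed

text \<open>
  The factors \<open>W\<^sub>1\<close> and \<open>W\<^sub>2\<^sup>T\<close> next to the inner R-matrix pass each other (\<open>half\<close>), after which all factors
  from \<open>W\<^sup>T\<close> can be collected on the left and those from \<open>W\<close> on the right; \<open>R\<close> then passes the former, the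
  reflection equation of \<open>A\<close> applies, and \<open>R\<close> passes the latter.
\<close>

theorem reflection_congruence:
  assumes W: "RTT n R W" and A: "reflection n R A"
    and comm: "\<And>i j k l. \<lbrakk>i \<in> {1..n}; j \<in> {1..n}; k \<in> {1..n}; l \<in> {1..n}\<rbrakk> \<Longrightarrow> W i j * A k l = A k l * W i j"
  shows "reflection n R (trans_mat W \<odot>\<^bsub>{1..n}\<^esub> A \<odot>\<^bsub>{1..n}\<^esub> W)"
proof -
  let ?X = "pairs n"
  define r where "r = cut ?X R"
  define t where "t = cut ?X (trans1 R)"
  define y1 where "y1 = cut ?X (in_first (trans_mat W))"
  define y2 where "y2 = cut ?X (in_second (trans_mat W))"
  define w1 where "w1 = cut ?X (in_first W)"
  define w2 where "w2 = cut ?X (in_second W)"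
  define a1 where "a1 = cut ?X (in_first A)"
  define a2 where "a2 = cut ?X (in_second A)"
  note defs = r_def t_def y1_def y2_def w1_def w2_def a1_def a2_def
  have half: "w1 \<star> t \<star> y2 = y2 \<star> t \<star> w1" "w2 \<star> t \<star> y1 = y1 \<star> t \<star> w2"
    using RTT_half_transposed[OF W] by (simp_all add: mat_eq_iff_cut cut_mmul defs)
  have rtt: "r \<star> y1 \<star> y2 = y2 \<star> y1 \<star> r" "r \<star> w1 \<star> w2 = w2 \<star> w1 \<star> r"
    using RTT_transposed[OF W] RTT_words[OF W] by (simp_all add: mat_eq_iff_cut cut_mmul defs)
  have refl: "r \<star> a1 \<star> t \<star> a2 = a2 \<star> t \<star> a1 \<star> r"
    using A by (simp add: reflection_def mat_eq_iff_cut cut_mmul defs)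
  have commute: "a1 \<star> y2 = y2 \<star> a1" "w1 \<star> a2 = a2 \<star> w1" "y1 \<star> a2 = a2 \<star> y1" "a1 \<star> w2 = w2 \<star> a1"
    using in_first_in_second_commute[of n A "trans_mat W"] in_first_in_second_commute[of n W A]
      in_first_in_second_commute[of n "trans_mat W" A] in_first_in_second_commute[of n A W]
    by (simp_all add: mat_eq_iff_cut cut_mmul defs comm trans_mat_def)
  have "r \<star> (y1 \<star> a1 \<star> w1) \<star> t \<star> (y2 \<star> a2 \<star> w2)
      = r \<star> y1 \<star> a1 \<star> (w1 \<star> t \<star> y2 \<star> (a2 \<star> w2))"
    by (simp only: mmul_assoc)
  also have "\<dots> = r \<star> y1 \<star> (a1 \<star> y2 \<star> (t \<star> (w1 \<star> a2 \<star> w2)))"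
    by (simp only: half) (simp only: mmul_assoc)
  also have "\<dots> = r \<star> y1 \<star> y2 \<star> (a1 \<star> (t \<star> (a2 \<star> (w1 \<star> w2))))"
    by (simp only: commute) (simp only: mmul_assoc)
  also have "\<dots> = y2 \<star> y1 \<star> (r \<star> a1 \<star> t \<star> a2 \<star> (w1 \<star> w2))"
    by (simp only: rtt) (simp only: mmul_assoc)
  also have "\<dots> = y2 \<star> y1 \<star> (a2 \<star> t \<star> (a1 \<star> (r \<star> w1 \<star> w2)))"
    by (simp only: refl) (simp only: mmul_assoc)
  also have "\<dots> = y2 \<star> (y1 \<star> a2 \<star> (t \<star> (a1 \<star> w2 \<star> (w1 \<star> r))))"
    by (simp only: rtt) (simp only: mmul_assoc)
  also have "\<dots> = y2 \<star> a2 \<star> (y1 \<star> t \<star> w2 \<star> (a1 \<star> (w1 \<star> r)))"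
    by (simp only: commute) (simp only: mmul_assoc)
  also have "\<dots> = y2 \<star> a2 \<star> w2 \<star> t \<star> (y1 \<star> a1 \<star> w1) \<star> r"
    by (simp only: half(2)[symmetric]) (simp only: mmul_assoc)
  finally have "r \<star> (y1 \<star> a1 \<star> w1) \<star> t \<star> (y2 \<star> a2 \<star> w2)
      = y2 \<star> a2 \<star> w2 \<star> t \<star> (y1 \<star> a1 \<star> w1) \<star> r" .
  moreover have "cut ?X (in_first (trans_mat W \<odot>\<^bsub>{1..n}\<^esub> A \<odot>\<^bsub>{1..n}\<^esub> W)) = y1 \<star> a1 \<star> w1"
      "cut ?X (in_second (trans_mat W \<odot>\<^bsub>{1..n}\<^esub> A \<odot>\<^bsub>{1..n}\<^esub> W)) = y2 \<star> a2 \<star> w2"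
    using in_first_product[of n "trans_mat W" A] in_first_product[of n "trans_mat W \<odot>\<^bsub>{1..n}\<^esub> A" W]
      in_second_product[of n "trans_mat W" A] in_second_product[of n "trans_mat W \<odot>\<^bsub>{1..n}\<^esub> A" W]
    by (simp_all add: mat_eq_iff_cut cut_mmul defs)
  ultimately show ?thesis
    by (simp add: reflection_def mat_eq_iff_cut cut_mmul flip: r_def t_def)
qed

end


section \<open>The R-matrix\<close>

lemma qpow_nonzero [simp]: "qpow r \<noteq> (0 :: 'k::qfield)"
proof
  assume "qpow r = (0 :: 'k)"
  then have "qpow (r + - r) = (0 :: 'k)" by (simp only: qpow_add) simp
  then show False by (simp add: qpow_0)
qed

lemma R_mat_entry:
  "R_mat n (i, k) (j, l) = (if i \<in> {1..n} \<and> k \<in> {1..n} then qpow (- 1 / of_nat n) *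
     ((if i = j \<and> k = l then if i = k then qpow 1 else 1 else 0)
       + (if i = l \<and> k = j \<and> k < i then qpow 1 - qpow (- 1) else 0)) else (0 :: 'k::qfield))"
proof -
  have 1: "(\<Sum>a=1..n. \<Sum>b=1..n. tensor12 (unit_mat a a) (unit_mat b b) (i, k) (j, l))
      = (if i \<in> {1..n} \<and> k \<in> {1..n} \<and> i = j \<and> k = l then 1 else (0 :: 'k))"
  proof -
    have "tensor12 (unit_mat a a) (unit_mat b b) (i, k) (j, l)
        = (if i = a then (if k = b then (if i = j \<and> k = l then 1 else 0) else 0) else (0 :: 'k))" for a b
      by (auto simp: tensor12_def unit_mat_def)
    moreover have "(\<Sum>b=1..n. if i = a then f b else 0) = (if i = a then \<Sum>b=1..n. f b else 0)"
      for a and f :: "nat \<Rightarrow> 'k"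
      by simp
    ultimately show ?thesis by (simp add: sum.delta)
  qed
  have 2: "(\<Sum>a=1..n. tensor12 (unit_mat a a) (unit_mat a a) (i, k) (j, l))
      = (if i \<in> {1..n} \<and> i = k \<and> i = j \<and> k = l then 1 else (0 :: 'k))"
  proof -
    have "tensor12 (unit_mat a a) (unit_mat a a) (i, k) (j, l)
        = (if i = a then (if i = k \<and> i = j \<and> k = l then 1 else 0) else (0 :: 'k))" for a
      by (auto simp: tensor12_def unit_mat_def)
    then show ?thesis by simp
  qed
  have 3: "(\<Sum>(a, b)\<in>{(a, b)\<in>pairs n. a > b}. tensor12 (unit_mat a b) (unit_mat b a) (i, k) (j, l))
      = (if (i, k) \<in> pairs n \<and> i = l \<and> k = j \<and> k < i then 1 else (0 :: 'k))"
  proof -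
    have fin: "finite {(a, b)\<in>pairs n. a > b}"
      by (rule finite_subset[OF _ finite_pairs[of n]]) auto
    have "(\<Sum>(a, b)\<in>{(a, b)\<in>pairs n. a > b}. tensor12 (unit_mat a b) (unit_mat b a) (i, k) (j, l))
        = (\<Sum>x\<in>{(a, b)\<in>pairs n. a > b}. if (i, k) = x then (if i = l \<and> k = j then 1 else 0) else (0 :: 'k))"
      by (rule sum.cong) (auto simp: tensor12_def unit_mat_def split: if_splits)
    then show ?thesis using fin by (simp add: sum.delta)
  qed
  show ?thesis
  proof (cases "i \<in> {1..n} \<and> k \<in> {1..n}")
    case True
    then have "(i, k) \<in> pairs n" by (simp add: pairs_def)
    with True show ?thesis
      unfolding R_mat_def 1 2 3 by (cases "i = k"; cases "i = j \<and> k = l") simp_all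
  next
    case False
    then have "(i \<in> {1..n} \<and> k \<in> {1..n} \<and> i = j \<and> k = l) = False"
      "(i \<in> {1..n} \<and> i = k \<and> i = j \<and> k = l) = False"
      "((i, k) \<in> pairs n \<and> i = l \<and> k = j \<and> k < i) = False"
      "(i \<in> {1..n} \<and> k \<in> {1..n}) = False"
      by (auto simp: pairs_def)
    then show ?thesis
      unfolding R_mat_def 1 2 3 by (simp only: if_False) simp
  qed
qed

lemma R_mat_flip: "R_mat n (i, k) (j, l) = (R_mat n (l, j) (k, i) :: 'k::qfield)"
proof (cases "i = j \<and> k = l \<or> i = l \<and> k = j")
  case True
  moreover have "R_mat n (i, k) (i, k) = (R_mat n (k, i) (k, i) :: 'k)"
  proof (cases "i = k")
    case False
    then have "(i = k \<and> k = i \<and> k < i) = False" "(k = i \<and> i = k \<and> i < k) = False" "k \<noteq> i"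
      by auto
    with False show ?thesis
      by (simp add: R_mat_entry conj_commute[of "i \<in> _"])
  qed simp
  ultimately show ?thesis by auto
next
  case False
  then have "(i = j \<and> k = l) = False" "(i = l \<and> k = j \<and> k < i) = False"
    "(l = k \<and> j = i) = False" "(l = i \<and> j = k \<and> j < l) = False"
    by blast+
  then show ?thesis by (simp only: R_mat_entry if_False) simp
qed

lemma R_mat_row:
  assumes "i \<in> {1..n}" "k \<in> {1..n}"
  shows "R_mat n (i, k) x = (qpow (- 1 / of_nat n) *
     ((if x = (i, k) then if i = k then qpow 1 else 1 else 0)
       + (if x = (k, i) then if k < i then qpow 1 - qpow (- 1) else 0 else 0)) :: 'k::qfield)"
proof -
  obtain j l where x: "x = (j, l)" by (cases x)
  have "(x = (i, k)) = (i = j \<and> k = l)" "(i = l \<and> k = j \<and> k < i) = (x = (k, i) \<and> k < i)"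
    by (auto simp: x)
  moreover have "(if P \<and> Q then a else 0) = (if P then if Q then a else 0 else 0)" for P Q and a :: 'k
    by simp
  ultimately show ?thesis
    unfolding x R_mat_entry using assms by (simp only: simp_thms if_True)
qed

lemma R_mat_column:
  assumes "j \<in> {1..n}" "l \<in> {1..n}"
  shows "R_mat n x (j, l) = (qpow (- 1 / of_nat n) *
     ((if x = (j, l) then if j = l then qpow 1 else 1 else 0)
       + (if x = (l, j) then if j < l then qpow 1 - qpow (- 1) else 0 else 0)) :: 'k::qfield)"
proof -
  obtain a b where x: "x = (a, b)" by (cases x)
  have "((b, a) = (l, j)) = (x = (j, l))" "((b, a) = (j, l)) = (x = (l, j))" "(l = j) = (j = l)"
    by (auto simp: x)
  then show ?thesis
    unfolding x R_mat_flip[of n a b] R_mat_row[OF assms(2,1)] by (simp only:)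
qed

locale q_algebra = assoc_algebra scale
  for scale :: "'k::qfield \<Rightarrow> 'b::ring_1 \<Rightarrow> 'b"
begin

lemma exchange_matrix_R: "exchange_matrix (scalar_mat scale (R_mat n))"
  by standard (auto simp: scalar_mat_def scale_mult_left scale_mult_right R_mat_flip split: prod.splits)

abbreviation "R n \<equiv> scalar_mat scale (R_mat n)"

abbreviation "\<Lambda> \<equiv> qpow 1 - qpow (- 1) :: 'k"

lemma scale_if: "scale (if P then c else 0) x = (if P then scale c x else 0)"
  by simp

lemma scale_two_deltas:
  assumes "finite X" "u \<in> X" "v \<in> X"
  shows "(\<Sum>x\<in>X. scale (c * ((if x = u then a else 0) + (if x = v then b else 0))) (f x))
    = scale c (scale a (f u) + scale b (f v))"
  using assms
  by (simp add: scale_left_distrib scale_if sum.distrib sum.delta flip: scale_scale scale_sum_right)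

lemma R_mult_left:
  assumes "i \<in> {1..n}" "k \<in> {1..n}"
  shows "(R n \<odot>\<^bsub>pairs n\<^esub> T) (i, k) y = scale (qpow (- 1 / of_nat n))
    (scale (if i = k then qpow 1 else 1) (T (i, k) y) + scale (if k < i then \<Lambda> else 0) (T (k, i) y))"
proof -
  have "(R n \<odot>\<^bsub>pairs n\<^esub> T) (i, k) y = (\<Sum>x\<in>pairs n. scale (R_mat n (i, k) x) (T x y))"
    by (simp add: mmul_def scalar_mat_def scale_mult_left)
  also have "\<dots> = scale (qpow (- 1 / of_nat n))
    (scale (if i = k then qpow 1 else 1) (T (i, k) y) + scale (if k < i then \<Lambda> else 0) (T (k, i) y))"
    unfolding R_mat_row[OF assms] by (rule scale_two_deltas) (use assms in \<open>auto simp: pairs_def\<close>)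
  finally show ?thesis .
qed

lemma R_transposed_mult_left:
  assumes "i \<in> {1..n}" "k \<in> {1..n}"
  shows "(trans_mat (R n) \<odot>\<^bsub>pairs n\<^esub> T) (i, k) y = scale (qpow (- 1 / of_nat n))
    (scale (if i = k then qpow 1 else 1) (T (i, k) y) + scale (if i < k then \<Lambda> else 0) (T (k, i) y))"
proof -
  have "(trans_mat (R n) \<odot>\<^bsub>pairs n\<^esub> T) (i, k) y = (\<Sum>x\<in>pairs n. scale (R_mat n x (i, k)) (T x y))"
    by (simp add: mmul_def scalar_mat_def trans_mat_def scale_mult_left)
  also have "\<dots> = scale (qpow (- 1 / of_nat n))
    (scale (if i = k then qpow 1 else 1) (T (i, k) y) + scale (if i < k then \<Lambda> else 0) (T (k, i) y))"
    unfolding R_mat_column[OF assms] by (rule scale_two_deltas) (use assms in \<open>auto simp: pairs_def\<close>)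
  finally show ?thesis .
qed

lemma R_mult_right:
  assumes "j \<in> {1..n}" "l \<in> {1..n}"
  shows "(T \<odot>\<^bsub>pairs n\<^esub> R n) x (j, l) = scale (qpow (- 1 / of_nat n))
    (scale (if j = l then qpow 1 else 1) (T x (j, l)) + scale (if j < l then \<Lambda> else 0) (T x (l, j)))"
proof -
  have "(T \<odot>\<^bsub>pairs n\<^esub> R n) x (j, l) = (trans_mat (R n) \<odot>\<^bsub>pairs n\<^esub> trans_mat T) (j, l) x"
    by (simp add: mmul_def trans_mat_def scalar_mat_def scale_mult_left scale_mult_right)
  then show ?thesis
    using assms by (simp add: R_transposed_mult_left) (simp add: trans_mat_def)
qed


section \<open>Exchange relations between rows\<close>

text \<open>
  For \<open>\<pi> = 1\<close> these are the relations between an earlier row \<open>v\<close> and a later row \<open>w\<close> of a matrix \<open>W\<close> with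
  \<open>R W\<^sub>1 W\<^sub>2 = W\<^sub>2 W\<^sub>1 R\<close>, and \<open>row_self 1\<close> those within one row. Rows coming from the part of the network
  that begins at a line in the interior of the triangle satisfy the relations with \<open>\<pi> = 0\<close>: two neighbouring
  faces on such a line are joined by two half-arrows and not by one as on the boundary, and the second
  half-arrow contributes a further power of \<open>q\<close> to the products of entries in different columns.
\<close>

definition row_exchange :: "rat \<Rightarrow> (nat \<Rightarrow> 'b) \<Rightarrow> (nat \<Rightarrow> 'b) \<Rightarrow> bool" where
  "row_exchange \<pi> v w \<longleftrightarrow>
     (\<forall>j. v j * w j = scale (qpow 1) (w j * v j)) \<and>
     (\<forall>j l. j < l \<longrightarrow> v l * w j = scale (qpow (1 - \<pi>)) (w j * v l)) \<and>
     (\<forall>j l. j < l \<longrightarrow> v j * w l = scale (qpow (\<pi> - 1)) (w l * v j) + scale \<Lambda> (w j * v l))"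

definition row_self :: "rat \<Rightarrow> (nat \<Rightarrow> 'b) \<Rightarrow> bool" where
  "row_self \<pi> v \<longleftrightarrow> (\<forall>j l. j < l \<longrightarrow> v j * v l = scale (qpow \<pi>) (v l * v j))"

text \<open>
  For rows \<open>i > k\<close> the relation is that of the pair \<open>k < i\<close>, solved for the other product. This uses that an
  entry of the earlier row commutes with the entries of the later row standing further to the left.
\<close>

lemma RTT_rows:
  assumes self: "\<And>i. i \<in> {1..n} \<Longrightarrow> row_self 1 (W i)"
    and exch: "\<And>i k. \<lbrakk>i \<in> {1..n}; k \<in> {1..n}; i < k\<rbrakk> \<Longrightarrow> row_exchange 1 (W i) (W k)"
  shows "RTT n (R n) W"
  unfolding RTT_def
proof (rule mat_eq_pairsI)
  fix i k j l assume ix: "i \<in> {1..n}" "k \<in> {1..n}" "j \<in> {1..n}" "l \<in> {1..n}"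
  have eq: "scale (if i = k then qpow 1 else 1) (W i j * W k l) + scale (if k < i then \<Lambda> else 0) (W k j * W i l)
      = scale (if j = l then qpow 1 else 1) (W k l * W i j) + scale (if j < l then \<Lambda> else 0) (W k j * W i l)"
  proof (cases i k rule: linorder_cases)
    case less
    from exch[OF ix(1,2) less] less show ?thesis
      by (cases j l rule: linorder_cases) (auto simp: row_exchange_def qpow_0)
  next
    case equal
    from self[OF ix(1)] equal show ?thesis
      by (cases j l rule: linorder_cases)
        (auto simp: row_self_def qpow_0 qpow_add[symmetric] left_diff_distrib scale_left_diff_distrib)
  next
    case greater
    from exch[OF ix(2,1) greater] greater show ?thesis
      by (cases j l rule: linorder_cases)
        (auto simp: row_exchange_def qpow_0 qpow_add[symmetric] left_diff_distrib scale_left_diff_distrib)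
  qed
  show "(R n \<odot>\<^bsub>pairs n\<^esub> tensor12 W W) (i, k) (j, l) = (tensor21 W W \<odot>\<^bsub>pairs n\<^esub> R n) (i, k) (j, l)"
    unfolding R_mult_left[OF ix(1,2)] R_mult_right[OF ix(3,4)]
    by (simp only: tensor12_def tensor21_def prod.case eq)
qed


section \<open>Adding a level to the rows\<close>

text \<open>
  The effect of a further level on a row: \<open>X j\<close> is the contribution of the new level to a path which
  enters it in column \<open>j\<close>, and the path leaves the new level in column \<open>j\<close> or \<open>j - 1\<close>. The coefficients are
  those of Weyl ordering.
\<close>

definition extend :: "(nat \<Rightarrow> 'b) \<Rightarrow> (nat \<Rightarrow> 'b) \<Rightarrow> nat \<Rightarrow> 'b" where
  "extend X v = (\<lambda>j. X j * (scale (qpow (- 1 / 2)) (v j) + scale (qpow (1 / 2)) (v (j - 1))))"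

text \<open>
  The exponent of \<open>q\<close> in the commutation of \<open>X j\<close> with an entry in column \<open>k\<close>.
\<close>

definition shift_exp :: "nat \<Rightarrow> nat \<Rightarrow> rat" where
  "shift_exp k j = (if j \<le> k then - 1 else 1)"

lemma extend_mult:
  assumes "\<And>k. v k * X l = scale (qpow (shift_exp k l)) (X l * v k)"
  shows "extend X v j * extend X w l = X j * X l *
    (scale (qpow (shift_exp j l - 1)) (v j * w l) + scale (qpow (shift_exp j l)) (v j * w (l - 1))
     + scale (qpow (shift_exp (j - 1) l)) (v (j - 1) * w l)
     + scale (qpow (shift_exp (j - 1) l + 1)) (v (j - 1) * w (l - 1)))"
proof -
  have push: "v k * (X l * z) = scale (qpow (shift_exp k l)) (X l * (v k * z))" for k z
    using arg_cong[OF assms[of k], of "\<lambda>x. x * z"] by (simp add: mult.assoc scale_mult_left)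
  show ?thesis
    by (simp add: extend_def distrib_left distrib_right scale_right_distrib scale_mult_left
        scale_mult_right mult.assoc push flip: qpow_add) (simp add: ac_simps)
qed

text \<open>
  A row with columns \<open>1, \<dots>, T - 1\<close>. Columns \<open>0\<close> and \<open>T\<close> are filled with zeros, which spares separate formulas
  for the first and the last column of the extended row.
\<close>

definition extendable :: "nat \<Rightarrow> (nat \<Rightarrow> 'b) \<Rightarrow> (nat \<Rightarrow> 'b) \<Rightarrow> bool" where
  "extendable T X v \<longleftrightarrow> v 0 = 0 \<and> (\<forall>k\<ge>T. v k = 0) \<and>
     (\<forall>j k. 1 \<le> j \<and> j \<le> T \<longrightarrow> v k * X j = scale (qpow (shift_exp k j)) (X j * v k))"

text \<open>
  On line \<open>a\<close> of the triangle the exponent \<open>2 - \<pi>\<close> is \<open>arrow_weight a\<close>: the rows being extended satisfy the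
  relations with \<open>\<pi> = 0\<close>, and the value of \<open>\<pi>\<close> for the extended rows is determined by the new line.
\<close>

context
  fixes T :: nat and \<pi> :: rat and X :: "nat \<Rightarrow> 'b"
  assumes X_rel: "\<And>j l. \<lbrakk>1 \<le> j; j < l; l \<le> T\<rbrakk> \<Longrightarrow> X l * X j = scale (qpow (2 - \<pi>)) (X j * X l)"
begin

lemma extend_outside:
  assumes "extendable T X v" "\<not> (1 \<le> j \<and> j \<le> T)"
  shows "extend X v j = 0"
proof -
  have "v j = 0" "v (j - 1) = 0" using assms by (auto simp: extendable_def not_le)
  then show ?thesis by (simp add: extend_def)
qed

lemma extend_mult_less:
  assumes "extendable T X v" "1 \<le> j" "j < l" "l \<le> T"
  shows "extend X v j * extend X w l = X j * X l *
      (v j * w l + scale (qpow 1) (v j * w (l - 1)) + scale (qpow 1) (v (j - 1) * w l)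
       + scale (qpow 2) (v (j - 1) * w (l - 1)))"
    and "extend X v l * extend X w j = X j * X l * scale (qpow (2 - \<pi>))
      (scale (qpow (- 2)) (v l * w j) + scale (qpow (- 1)) (v l * w (j - 1))
       + scale (qpow (- 1)) (v (l - 1) * w j) + v (l - 1) * w (j - 1))"
proof -
  have "shift_exp j l = 1" "shift_exp (j - 1) l = 1" "shift_exp l j = - 1" "shift_exp (l - 1) j = - 1"
    using assms by (auto simp: shift_exp_def)
  then show "extend X v j * extend X w l = X j * X l *
      (v j * w l + scale (qpow 1) (v j * w (l - 1)) + scale (qpow 1) (v (j - 1) * w l)
       + scale (qpow 2) (v (j - 1) * w (l - 1)))"
    and "extend X v l * extend X w j = X j * X l * scale (qpow (2 - \<pi>))
      (scale (qpow (- 2)) (v l * w j) + scale (qpow (- 1)) (v l * w (j - 1))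
       + scale (qpow (- 1)) (v (l - 1) * w j) + v (l - 1) * w (j - 1))"
    using extend_mult[of v X l j w] extend_mult[of v X j l w] assms X_rel[of j l]
    by (simp_all add: extendable_def qpow_0 scale_mult_left scale_mult_right)
qed

lemma row_self_extend:
  assumes v: "extendable T X v" and self: "row_self 0 v"
  shows "row_self \<pi> (extend X v)"
  unfolding row_self_def
proof (intro allI impI)
  fix j l :: nat assume "j < l"
  have comm: "v a * v b = v b * v a" for a b
    using self by (cases a b rule: linorder_cases) (auto simp: row_self_def qpow_0)
  show "extend X v j * extend X v l = scale (qpow \<pi>) (extend X v l * extend X v j)"
  proof (cases "1 \<le> j \<and> l \<le> T")
    case True
    then show ?thesis
      using \<open>j < l\<close>
      by (simp add: extend_mult_less[OF v] comm[of l] comm[of "l - Suc 0"] qpow_0 scale_mult_right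
          scale_right_distrib distrib_left flip: qpow_add)
  next
    case False
    then have "extend X v j = 0 \<or> extend X v l = 0" using \<open>j < l\<close> extend_outside[OF v] by auto
    then show ?thesis by auto
  qed
qed

text \<open>
  All terms of the products match one by one except those in which the columns \<open>j - 1\<close> and \<open>j\<close> occur in
  both orders. There the last summand of \<open>row_exchange\<close> is needed, by way of \<open>1 + q (q - q\<^sup>-\<^sup>1) = q\<^sup>2\<close>.
\<close>

lemma row_exchange_extend:
  assumes v: "extendable T X v" and w: "extendable T X w" and exch: "row_exchange 0 v w"
  shows "row_exchange \<pi> (extend X v) (extend X w)"
proof -
  \<comment> \<open>For equal columns the two formulas agree because \<open>q\<^sup>-\<^sup>1 + (q - q\<^sup>-\<^sup>1) = q\<close>. Therefore no step below has
    to distinguish whether \<open>j\<close> and \<open>l\<close> are neighbours.\<close>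

  have ge: "v a * w b = scale (qpow 1) (w b * v a)" if "b \<le> a" for a b
    using exch that by (cases "a = b") (auto simp: row_exchange_def)
  have le: "v a * w b = scale (qpow (- 1)) (w b * v a) + scale (qpow 1) (w a * v b) - scale (qpow (- 1)) (w a * v b)"
    if "a \<le> b" for a b
    using exch that
    by (cases "a = b") (auto simp: row_exchange_def scale_left_diff_distrib)
  have outside: "extend X v j = 0" "extend X w j = 0" if "\<not> (1 \<le> j \<and> j \<le> T)" for j
    using extend_outside v w that by auto
  show ?thesis
    unfolding row_exchange_def
  proof (intro conjI allI impI)
    fix j
    show "extend X v j * extend X w j = scale (qpow 1) (extend X w j * extend X v j)"
    proof (cases "1 \<le> j \<and> j \<le> T")
      case True
      then have "shift_exp j j = - 1" "shift_exp (j - 1) j = 1"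
        by (auto simp: shift_exp_def)
      then show ?thesis
        using extend_mult[of v X j j w] extend_mult[of w X j j v] v w True
        by (simp add: extendable_def ge le[of "j - Suc 0" j] qpow_0 scale_mult_right scale_right_distrib
            scale_right_diff_distrib distrib_left right_diff_distrib flip: qpow_add)
    next
      case False
      then show ?thesis using outside[of j] by auto
    qed
  next
    fix j l :: nat assume jl: "j < l"
    show "extend X v l * extend X w j = scale (qpow (1 - \<pi>)) (extend X w j * extend X v l)"
    proof (cases "1 \<le> j \<and> l \<le> T")
      case True
      then show ?thesis
        using jl by (simp add: extend_mult_less[OF v] extend_mult_less[OF w] ge scale_mult_right
          scale_right_distrib distrib_left flip: qpow_add)
    next
      case False
      then have "extend X w j = 0 \<or> extend X v l = 0" using jl outside[of j] outside[of l] by auto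
      then show ?thesis by auto
    qed
    show "extend X v j * extend X w l = scale (qpow (\<pi> - 1)) (extend X w l * extend X v j)
        + scale \<Lambda> (extend X w j * extend X v l)"
    proof (cases "1 \<le> j \<and> l \<le> T")
      case True
      then show ?thesis
        using jl by (simp add: extend_mult_less[OF v] extend_mult_less[OF w] le scale_mult_right
          scale_right_distrib scale_right_diff_distrib scale_left_diff_distrib distrib_left
          right_diff_distrib left_diff_distrib flip: qpow_add)
    next
      case False
      then have "extend X v j = 0 \<and> extend X w j = 0 \<or> extend X v l = 0 \<and> extend X w l = 0"
        using jl outside[of j] outside[of l] by auto
      then show ?thesis by auto
    qed
  qed
qed

end

lemma row_self_single: "row_self \<pi> (\<lambda>j. if j = t then x else 0)"
  by (auto simp: row_self_def)

text \<open>
  The two kinds of rows that are new on a level: the row of its left sink, which is reached from the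
  first column only, and the row of its bottom sink, which is reached from the last column only.
\<close>

lemma row_exchange_first:
  assumes "w 0 = 0" "x * w 1 = scale (qpow 1) (w 1 * x)"
    and "\<And>l. 1 < l \<Longrightarrow> x * w l = scale (qpow (\<pi> - 1)) (w l * x)"
  shows "row_exchange \<pi> (\<lambda>j. if j = 1 then x else 0) w"
  using assms by (auto simp: row_exchange_def)

lemma row_exchange_last:
  assumes "\<And>l. t < l \<Longrightarrow> v l = 0" "v t * x = scale (qpow 1) (x * v t)"
    and "\<And>j. j < t \<Longrightarrow> v j * x = scale (qpow (\<pi> - 1)) (x * v j)"
  shows "row_exchange \<pi> v (\<lambda>j. if j = t then x else 0)"
  using assms by (auto simp: row_exchange_def)


section \<open>Rescaling the rows\<close>

text \<open>
  Multiplying rows from the right by elements that commute with the entries up to powers of \<open>q\<close> changes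
  the exchange relations by a common power of \<open>q\<close>.
\<close>

lemma row_scale:
  assumes "C * C' = scale (qpow r) (C' * C)"
    and "\<And>l. C * w l = scale (qpow s) (w l * C)"
    and "\<And>j. C' * v j = scale (qpow t) (v j * C')"
  shows "(v j * C) * (w l * C') = scale (qpow s) (v j * w l * (C * C'))"
    and "(w l * C') * (v j * C) = scale (qpow (t - r)) (w l * v j * (C * C'))"
proof -
  have "(v j * C) * (w l * C') = v j * (C * w l) * C'" by (simp add: mult.assoc)
  then show "(v j * C) * (w l * C') = scale (qpow s) (v j * w l * (C * C'))"
    by (simp add: assms scale_mult_left scale_mult_right mult.assoc)
  have "(w l * C') * (v j * C) = w l * (C' * v j) * C" by (simp add: mult.assoc)
  then have "(w l * C') * (v j * C) = scale (qpow t) (w l * v j * (C' * C))"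
    by (simp add: assms scale_mult_left scale_mult_right mult.assoc)
  moreover have "C' * C = scale (qpow (- r)) (C * C')"
    using assms(1) by (simp add: qpow_0 flip: qpow_add)
  ultimately show "(w l * C') * (v j * C) = scale (qpow (t - r)) (w l * v j * (C * C'))"
    by (simp add: scale_mult_right flip: qpow_add)
qed

lemma RTT_scale:
  assumes C: "\<And>i j. \<lbrakk>i \<in> {1..n}\<rbrakk> \<Longrightarrow> C * v i j = v i j * C"
    and self: "\<And>i. i \<in> {1..n} \<Longrightarrow> row_self 1 (v i)"
    and exch: "\<And>i k. \<lbrakk>i \<in> {1..n}; k \<in> {1..n}; i < k\<rbrakk> \<Longrightarrow> row_exchange 1 (v i) (v k)"
  shows "RTT n (R n) (\<lambda>i j. scale (g i) (v i j * C))"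
proof (rule RTT_rows)
  have prod: "scale (g i) (v i j * C) * scale (g k) (v k l * C) = scale (g i * g k) (v i j * v k l * (C * C))"
    if "k \<in> {1..n}" for i j k l
  proof -
    have "v i j * C * (v k l * C) = v i j * (C * v k l) * C" by (simp add: mult.assoc)
    then show ?thesis using C[OF that] by (simp add: scale_mult_left scale_mult_right mult.assoc mult.commute)
  qed
  fix i assume i: "i \<in> {1..n}"
  show "row_self 1 (\<lambda>j. scale (g i) (v i j * C))"
    using self[OF i] unfolding row_self_def prod[OF i]
    by (simp add: scale_mult_left mult.commute)
  fix k assume k: "k \<in> {1..n}" and less: "i < k"
  from exch[OF i k less] show "row_exchange 1 (\<lambda>j. scale (g i) (v i j * C)) (\<lambda>j. scale (g k) (v k j * C))"
    unfolding row_exchange_def prod[OF i] prod[OF k]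
    by (simp add: scale_mult_left mult.commute distrib_right scale_right_distrib)
qed

end


section \<open>The skew form on the lines of the triangle\<close>

text \<open>
  Two faces are neighbours if they share one coordinate \<open>m\<close> and the other two differ by one. They are
  joined by two half-arrows, from the white and from the black triangle at the edge between them, unless
  \<open>m = 0\<close>: then this edge lies on the boundary and there is no black triangle.
\<close>

definition arrow_weight :: "nat \<Rightarrow> rat" where
  "arrow_weight m = (if m = 0 then 1 else 2)"

lemma num_arrows_eq:
  "of_nat (num_arrows (a, b, c) (x, y, z)) =
     (if a = x + 1 \<and> y = b \<and> z = c + 1 then arrow_weight b else 0)
     + (if x = a \<and> y = b + 1 \<and> c = z + 1 then arrow_weight a else 0)
     + (if x = a + 1 \<and> b = y + 1 \<and> z = c then arrow_weight c else 0)"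
proof -
  have white: "{t. white_arrow t (a, b, c) (x, y, z)} =
      (if a = x + 1 \<and> y = b \<and> z = c + 1 then {(x, b, c)} else {})
      \<union> (if x = a \<and> y = b + 1 \<and> c = z + 1 then {(a, b, z)} else {})
      \<union> (if x = a + 1 \<and> b = y + 1 \<and> z = c then {(a, y, c)} else {})"
    by (auto split: if_splits)
  have black: "{t. black_arrow t (a, b, c) (x, y, z)} =
      (if a = x + 1 \<and> y = b \<and> z = c + 1 \<and> b > 0 then {(x, b - 1, c)} else {})
      \<union> (if x = a \<and> y = b + 1 \<and> c = z + 1 \<and> a > 0 then {(a - 1, b, z)} else {})
      \<union> (if x = a + 1 \<and> b = y + 1 \<and> z = c \<and> c > 0 then {(a, y, c - 1)} else {})"
    by (auto split: if_splits)
  show ?thesis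
    unfolding num_arrows_def white black arrow_weight_def by auto
qed

text \<open>
  The pairing of \<open>\<kappa>\<close> with a single face: the sum of \<open>\<kappa>\<close> over the neighbours with an arrow towards the
  face, minus the sum over those with an arrow from it (\<open>skew_flow\<close>).
\<close>

definition flow :: "expo \<Rightarrow> face \<Rightarrow> rat" where
  "flow \<kappa> = (\<lambda>(x, y, z).
     ((if z > 0 then arrow_weight y * Poly_Mapping.lookup \<kappa> (x + 1, y, z - 1) else 0)
    + (if y > 0 then arrow_weight x * Poly_Mapping.lookup \<kappa> (x, y - 1, z + 1) else 0)
    + (if x > 0 then arrow_weight z * Poly_Mapping.lookup \<kappa> (x - 1, y + 1, z) else 0)
    - (if x > 0 then arrow_weight y * Poly_Mapping.lookup \<kappa> (x - 1, y, z + 1) else 0)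
    - (if z > 0 then arrow_weight x * Poly_Mapping.lookup \<kappa> (x, y + 1, z - 1) else 0)
    - (if y > 0 then arrow_weight z * Poly_Mapping.lookup \<kappa> (x + 1, y - 1, z) else 0)) / 2)"

lemma face_form_eq:
  "face_form \<alpha> (x, y, z) =
     ((if \<alpha> = (x + 1, y, z - 1) then if z > 0 then arrow_weight y else 0 else 0)
    + (if \<alpha> = (x, y - 1, z + 1) then if y > 0 then arrow_weight x else 0 else 0)
    + (if \<alpha> = (x - 1, y + 1, z) then if x > 0 then arrow_weight z else 0 else 0)
    - (if \<alpha> = (x - 1, y, z + 1) then if x > 0 then arrow_weight y else 0 else 0)
    - (if \<alpha> = (x, y + 1, z - 1) then if z > 0 then arrow_weight x else 0 else 0)
    - (if \<alpha> = (x + 1, y - 1, z) then if y > 0 then arrow_weight z else 0 else 0)) / 2"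
proof -
  obtain a b c where \<alpha>: "\<alpha> = (a, b, c)" by (cases \<alpha>)
  have nested: "(if P then if Q then r else 0 else 0) = (if P \<and> Q then r else (0::rat))" for P Q r
    by simp
  have "(\<alpha> = (x + 1, y, z - 1) \<and> z > 0) = (a = x + 1 \<and> y = b \<and> z = c + 1)"
    "(\<alpha> = (x, y - 1, z + 1) \<and> y > 0) = (x = a \<and> y = b + 1 \<and> c = z + 1)"
    "(\<alpha> = (x - 1, y + 1, z) \<and> x > 0) = (x = a + 1 \<and> b = y + 1 \<and> z = c)"
    "(\<alpha> = (x - 1, y, z + 1) \<and> x > 0) = (x = a + 1 \<and> b = y \<and> c = z + 1)"
    "(\<alpha> = (x, y + 1, z - 1) \<and> z > 0) = (a = x \<and> b = y + 1 \<and> z = c + 1)"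
    "(\<alpha> = (x + 1, y - 1, z) \<and> y > 0) = (a = x + 1 \<and> y = b + 1 \<and> c = z)"
    by (auto simp: \<alpha>)
  note conds = this
  have weights: "(if a = x + 1 \<and> y = b \<and> z = c + 1 then arrow_weight b else 0)
      = (if a = x + 1 \<and> y = b \<and> z = c + 1 then arrow_weight y else 0)"
    "(if x = a \<and> y = b + 1 \<and> c = z + 1 then arrow_weight a else 0)
      = (if x = a \<and> y = b + 1 \<and> c = z + 1 then arrow_weight x else 0)"
    "(if x = a + 1 \<and> b = y + 1 \<and> z = c then arrow_weight c else 0)
      = (if x = a + 1 \<and> b = y + 1 \<and> z = c then arrow_weight z else 0)"
    by auto
  show ?thesis
    unfolding nested conds unfolding \<alpha> face_form_def num_arrows_eq weights by simp
qed

lemma skew_flow: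
  assumes "finite B" "Poly_Mapping.keys \<mu> \<subseteq> B"
  shows "skew \<kappa> \<mu> = (\<Sum>\<beta>\<in>B. Poly_Mapping.lookup \<mu> \<beta> * flow \<kappa> \<beta>)"
proof -
  have "(\<Sum>\<alpha>\<in>Poly_Mapping.keys \<kappa>. Poly_Mapping.lookup \<kappa> \<alpha> * face_form \<alpha> \<beta>) = flow \<kappa> \<beta>" for \<beta>
  proof -
    obtain x y z where \<beta>: "\<beta> = (x, y, z)" by (cases \<beta>)
    define A where "A = Poly_Mapping.keys \<kappa> \<union> {(x + 1, y, z - 1), (x, y - 1, z + 1), (x - 1, y + 1, z),
      (x - 1, y, z + 1), (x, y + 1, z - 1), (x + 1, y - 1, z)}"
    have fin: "finite A" by (simp add: A_def)
    have delta: "(\<Sum>\<alpha>\<in>A. Poly_Mapping.lookup \<kappa> \<alpha> * (if \<alpha> = \<gamma> then r else 0)) = Poly_Mapping.lookup \<kappa> \<gamma> * r"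
      if "\<gamma> \<in> A" for \<gamma> r
    proof -
      have "(\<Sum>\<alpha>\<in>A. Poly_Mapping.lookup \<kappa> \<alpha> * (if \<alpha> = \<gamma> then r else 0))
          = (\<Sum>\<alpha>\<in>A. if \<alpha> = \<gamma> then Poly_Mapping.lookup \<kappa> \<gamma> * r else 0)"
        by (intro sum.cong) auto
      also have "\<dots> = Poly_Mapping.lookup \<kappa> \<gamma> * r" using fin that by simp
      finally show ?thesis .
    qed
    have mem: "(x + 1, y, z - 1) \<in> A" "(x, y - 1, z + 1) \<in> A" "(x - 1, y + 1, z) \<in> A"
      "(x - 1, y, z + 1) \<in> A" "(x, y + 1, z - 1) \<in> A" "(x + 1, y - 1, z) \<in> A"
      by (auto simp: A_def)
    have "(\<Sum>\<alpha>\<in>Poly_Mapping.keys \<kappa>. Poly_Mapping.lookup \<kappa> \<alpha> * face_form \<alpha> \<beta>)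
        = (\<Sum>\<alpha>\<in>A. Poly_Mapping.lookup \<kappa> \<alpha> * face_form \<alpha> \<beta>)"
      by (rule sum.mono_neutral_left[OF fin]) (auto simp: A_def in_keys_iff)
    also have "\<dots> = flow \<kappa> \<beta>"
      unfolding \<beta> face_form_eq times_divide_eq_right distrib_left right_diff_distrib
        sum_divide_distrib[symmetric] sum.distrib sum_subtractf delta[OF mem(1)] delta[OF mem(2)]
        delta[OF mem(3)] delta[OF mem(4)] delta[OF mem(5)] delta[OF mem(6)]
      by (simp add: flow_def)
    finally show ?thesis .
  qed
  note star = this
  have "skew \<kappa> \<mu> = (\<Sum>\<alpha>\<in>Poly_Mapping.keys \<kappa>. \<Sum>\<beta>\<in>B. Poly_Mapping.lookup \<kappa> \<alpha> * Poly_Mapping.lookup \<mu> \<beta> * face_form \<alpha> \<beta>)"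
    by (rule skew_superset) (use assms in auto)
  also have "\<dots> = (\<Sum>\<beta>\<in>B. Poly_Mapping.lookup \<mu> \<beta> * (\<Sum>\<alpha>\<in>Poly_Mapping.keys \<kappa>. Poly_Mapping.lookup \<kappa> \<alpha> * face_form \<alpha> \<beta>))"
    by (subst sum.swap) (simp add: sum_distrib_left mult_ac)
  finally show ?thesis by (simp only: star)
qed

definition face_sum :: "face set \<Rightarrow> expo" where
  "face_sum A = (\<Sum>\<alpha>\<in>A. Poly_Mapping.single \<alpha> 1)"

lemma lookup_sum_single:
  assumes "finite A"
  shows "Poly_Mapping.lookup (\<Sum>\<alpha>\<in>A. Poly_Mapping.single \<alpha> (r \<alpha>)) \<beta> = (if \<beta> \<in> A then r \<beta> else (0 :: rat))"
  using assms by (simp add: lookup_sum lookup_single when_def)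

lemma lookup_face_sum: "finite A \<Longrightarrow> Poly_Mapping.lookup (face_sum A) \<beta> = (if \<beta> \<in> A then 1 else 0)"
  by (simp add: face_sum_def lookup_sum_single)

lemma keys_face_sum: "finite A \<Longrightarrow> Poly_Mapping.keys (face_sum A) = A"
  by (auto simp: in_keys_iff lookup_face_sum split: if_splits)

lemma face_sum_Un: "finite A \<Longrightarrow> finite B \<Longrightarrow> A \<inter> B = {} \<Longrightarrow> face_sum (A \<union> B) = face_sum A + face_sum B"
  by (simp add: face_sum_def sum.union_disjoint)

lemma skew_face_sum: "finite B \<Longrightarrow> skew \<kappa> (face_sum B) = (\<Sum>\<beta>\<in>B. flow \<kappa> \<beta>)"
  by (subst skew_flow[of B]) (simp_all add: keys_face_sum lookup_face_sum)

text \<open>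
  The first \<open>j\<close> faces of a line, counted from the left side of the triangle; meaningful for
  \<open>j \<le> n - a + 1\<close>, because of the truncated subtraction.
\<close>

definition line :: "nat \<Rightarrow> nat \<Rightarrow> nat \<Rightarrow> face set" where
  "line n a j = (\<lambda>b. (a, b, n - a - b)) ` {..<j}"

definition deeper :: "nat \<Rightarrow> nat \<Rightarrow> face set" where
  "deeper n a = {(x, y, z). x + y + z = n \<and> a < x}"

lemma mem_line: "(x, y, z) \<in> line n a j \<longleftrightarrow> x = a \<and> y < j \<and> z = n - a - y"
  by (auto simp: line_def)

lemma mem_deeper: "(x, y, z) \<in> deeper n a \<longleftrightarrow> x + y + z = n \<and> a < x"
  by (simp add: deeper_def)

lemma sum_line: "sum f (line n a j) = (\<Sum>b<j. f (a, b, n - a - b))"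
  unfolding line_def by (subst sum.reindex) (auto simp: inj_on_def)

lemma finite_faces [simp]: "finite (faces n)"
  by (rule finite_subset[of _ "{..n} \<times> {..n} \<times> {..n}"]) (auto simp: faces_def)

lemma finite_line [simp]: "finite (line n a j)"
  by (simp add: line_def)

lemma finite_deeper [simp]: "finite (deeper n a)"
  by (rule finite_subset[OF _ finite_faces[of n]]) (auto simp: deeper_def faces_def)

lemma deeper_split:
  assumes "a < n"
  shows "deeper n a = line n (a + 1) (n - a) \<union> deeper n (a + 1)"
    and "line n (a + 1) (n - a) \<inter> deeper n (a + 1) = {}"
  using assms by (auto simp: mem_deeper mem_line)

lemma flow_line_next:
  "flow (face_sum (line (a + 1 + b + c) a j)) (a + 1, b, c)
     = ((if b + 1 < j then arrow_weight c else 0) - (if b < j then arrow_weight b else 0)) / 2"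
  by (simp add: flow_def lookup_face_sum mem_line)

lemma flow_line_same:
  "flow (face_sum (line (a + b + c) a j)) (a, b, c)
     = arrow_weight a * ((if 0 < b \<and> b - 1 < j then 1 else 0) - (if 0 < c \<and> b + 1 < j then 1 else 0)) / 2"
  by (cases a) (simp_all add: flow_def lookup_face_sum mem_line)

text \<open>
  A face \<open>(a + 1, b, c)\<close> has an arrow towards \<open>(a, b, c + 1)\<close> and one from \<open>(a, b + 1, c)\<close>. They cancel when
  both neighbours belong to \<open>line n a j\<close>. This leaves the face at \<open>b = 0\<close>, where one of the two arrows is only
  a half-arrow, and the face at the end of the \<open>j\<close> faces. The last hypothesis excludes two complete
  lines: their pairing is zero.
\<close>

lemma skew_adjacent_lines:
  assumes j: "1 \<le> j" "j \<le> n - a + 1" and k: "1 \<le> k" "k \<le> n - a" and "a < n" and "j \<le> n - a \<or> k < n - a"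
  shows "skew (face_sum (line n a j)) (face_sum (line n (a + 1) k)) = (if j \<le> k then - 1 / 2 else 1 / 2)"
proof -
  have "skew (face_sum (line n a j)) (face_sum (line n (a + 1) k))
      = (\<Sum>b<k. flow (face_sum (line n a j)) (a + 1, b, n - (a + 1) - b))"
    by (simp add: skew_face_sum sum_line)
  also have "\<dots> = (\<Sum>b<k. (if b + 1 < j then 1 else 0) - (if b < j then if b = 0 then 1 / 2 else 1 else 0))"
  proof (rule sum.cong[OF refl])
    fix b assume b: "b \<in> {..<k}"
    define c where "c = n - (a + 1) - b"
    have n: "n = a + 1 + b + c" using b assms by (auto simp: c_def)
    have "b + 1 < j \<Longrightarrow> 0 < c" using b assms n by auto
    then have "flow (face_sum (line n a j)) (a + 1, b, c)
        = (if b + 1 < j then 1 else 0) - (if b < j then if b = 0 then 1 / 2 else 1 else 0)"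
      unfolding n flow_line_next by (auto simp: arrow_weight_def)
    then show "flow (face_sum (line n a j)) (a + 1, b, n - (a + 1) - b)
        = (if b + 1 < j then 1 else 0) - (if b < j then if b = 0 then 1 / 2 else 1 else 0)"
      by (simp only: c_def)
  qed
  also have "\<dots> = (if j \<le> k then - 1 / 2 else 1 / 2)"
    using k(1) j(1)
  proof (induction k rule: dec_induct)
    case (step k)
    then show ?case by auto
  qed auto
  finally show ?thesis .
qed

text \<open>
  Only the arrow from the last of the \<open>j\<close> faces to the next one is not cancelled.
\<close>

lemma skew_same_line:
  assumes "1 \<le> j" "j < l" "l \<le> n - a + 1" "a \<le> n"
  shows "skew (face_sum (line n a j)) (face_sum (line n a l)) = arrow_weight a / 2"
proof -
  have count: "(\<Sum>b<l. if b \<in> B then 1 else (0 :: rat)) = of_nat (card ({..<l} \<inter> B))" for B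
    by (simp add: sum.If_cases)
  have "skew (face_sum (line n a j)) (face_sum (line n a l))
      = (\<Sum>b<l. flow (face_sum (line n a j)) (a, b, n - a - b))"
    by (simp add: skew_face_sum sum_line)
  also have "\<dots> = (\<Sum>b<l. ((if b \<in> {1..j} then 1 else 0) - (if b \<in> {..<j - 1} then 1 else 0)) * (arrow_weight a / 2))"
  proof (rule sum.cong[OF refl])
    fix b assume b: "b \<in> {..<l}"
    define c where "c = n - a - b"
    have n: "n = a + b + c" using b assms by (auto simp: c_def)
    have "(0 < b \<and> b - 1 < j) = (b \<in> {1..j})" "(0 < c \<and> b + 1 < j) = (b \<in> {..<j - 1})"
      using b assms n by auto
    then have "flow (face_sum (line n a j)) (a, b, c)
        = ((if b \<in> {1..j} then 1 else 0) - (if b \<in> {..<j - 1} then 1 else 0)) * (arrow_weight a / 2)"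
      unfolding n flow_line_same by (simp only: mult.commute times_divide_eq_right)
    then show "flow (face_sum (line n a j)) (a, b, n - a - b)
        = ((if b \<in> {1..j} then 1 else 0) - (if b \<in> {..<j - 1} then 1 else 0)) * (arrow_weight a / 2)"
      by (simp only: c_def)
  qed
  also have "\<dots> = (of_nat (card ({..<l} \<inter> {1..j})) - of_nat (card ({..<l} \<inter> {..<j - 1}))) * (arrow_weight a / 2)"
    unfolding sum_distrib_right[symmetric] sum_subtractf count ..
  also have "{..<l} \<inter> {1..j} = {1..j}"
    using assms by auto
  also have "{..<l} \<inter> {..<j - 1} = {..<j - 1}"
    using assms by auto
  finally show ?thesis using assms by (simp add: of_nat_diff)
qed

lemma skew_line_distant:
  assumes "Poly_Mapping.keys \<mu> \<subseteq> deeper n (a + 1)"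
  shows "skew (face_sum (line n a j)) \<mu> = 0"
proof -
  have "flow (face_sum (line n a j)) \<beta> = 0" if "\<beta> \<in> deeper n (a + 1)" for \<beta>
  proof -
    obtain x y z where \<beta>: "\<beta> = (x, y, z)" by (cases \<beta>)
    then have "a + 1 < x" using that by (simp add: mem_deeper)
    then have "x \<noteq> a" "x - 1 \<noteq> a" "x + 1 \<noteq> a" by auto
    then show ?thesis by (simp add: \<beta> flow_def lookup_face_sum mem_line)
  qed
  then show ?thesis
    by (subst skew_flow[OF finite_deeper assms]) simp
qed

text \<open>
  Every triangle is an oriented cycle, so that each face has as many incoming as outgoing half-arrows and
  the sum of all faces pairs to zero with everything. A face beyond line \<open>a\<close> has no neighbours before line
  \<open>a\<close>, so for it the faces on line \<open>a\<close> and beyond are as good as all faces.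
\<close>

lemma skew_deeper:
  assumes "Poly_Mapping.keys \<mu> \<subseteq> deeper n a" "a < n"
  shows "skew (face_sum (deeper n a)) \<mu> = - skew (face_sum (line n a (n - a + 1))) \<mu>"
proof -
  have "flow (face_sum (deeper n a)) \<beta> = - flow (face_sum (line n a (n - a + 1))) \<beta>"
    if "\<beta> \<in> deeper n a" for \<beta>
  proof -
    obtain x y z where \<beta>: "\<beta> = (x, y, z)" by (cases \<beta>)
    have sum: "Poly_Mapping.lookup (face_sum (deeper n a)) \<gamma>
        = 1 - Poly_Mapping.lookup (face_sum (line n a (n - a + 1))) \<gamma>"
      if "\<gamma> \<in> deeper n a \<or> \<gamma> \<in> line n a (n - a + 1)" for \<gamma>
      using that by (cases \<gamma>) (auto simp: lookup_face_sum mem_line mem_deeper)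
    have near: "z > 0 \<Longrightarrow> (x + 1, y, z - 1) \<in> deeper n a"
      "y > 0 \<Longrightarrow> (x, y - 1, z + 1) \<in> deeper n a"
      "x > 0 \<Longrightarrow> (x - 1, y + 1, z) \<in> deeper n a \<or> (x - 1, y + 1, z) \<in> line n a (n - a + 1)"
      "x > 0 \<Longrightarrow> (x - 1, y, z + 1) \<in> deeper n a \<or> (x - 1, y, z + 1) \<in> line n a (n - a + 1)"
      "z > 0 \<Longrightarrow> (x, y + 1, z - 1) \<in> deeper n a"
      "y > 0 \<Longrightarrow> (x + 1, y - 1, z) \<in> deeper n a"
      using that by (auto simp: \<beta> mem_deeper mem_line)
    show ?thesis
      unfolding \<beta> flow_def prod.case
      using near by (cases "x > 0"; cases "y > 0"; cases "z > 0")
        (simp_all add: sum arrow_weight_def field_simps)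
  qed
  then show ?thesis
    by (simp add: skew_flow[OF finite_deeper assms(1)] sum_negf)
qed

lemma skew_line_deeper:
  assumes "1 \<le> j" "j \<le> n - a" "a < n"
  shows "skew (face_sum (line n a j)) (face_sum (deeper n a)) = - 1 / 2"
proof -
  have "skew (face_sum (line n a j)) (face_sum (deeper n a))
      = skew (face_sum (line n a j)) (face_sum (line n (a + 1) (n - a)))
      + skew (face_sum (line n a j)) (face_sum (deeper n (a + 1)))"
    using assms by (simp add: deeper_split face_sum_Un skew_add_right del: One_nat_def)
  then show ?thesis
    using assms skew_adjacent_lines[of j n a "n - a"] by (simp add: skew_line_distant keys_face_sum)
qed

definition d1 :: "nat \<Rightarrow> expo" where
  "d1 n = (\<Sum>\<alpha>\<in>faces n. Poly_Mapping.single \<alpha> (case \<alpha> of (a, b, c) \<Rightarrow> of_nat c / of_nat n))"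

definition d2 :: "nat \<Rightarrow> expo" where
  "d2 n = (\<Sum>\<alpha>\<in>faces n. Poly_Mapping.single \<alpha> (case \<alpha> of (a, b, c) \<Rightarrow> of_nat a / of_nat n))"

lemma lookup_d1: "Poly_Mapping.lookup (d1 n) (a, b, c) = (if a + b + c = n then of_nat c / of_nat n else 0)"
  unfolding d1_def lookup_sum_single[OF finite_faces] by (simp add: faces_def)

lemma lookup_d2: "Poly_Mapping.lookup (d2 n) (a, b, c) = (if a + b + c = n then of_nat a / of_nat n else 0)"
  unfolding d2_def lookup_sum_single[OF finite_faces] by (simp add: faces_def)

text \<open>
  Except at a corner, the neighbours with an arrow towards a face and those with an arrow from it have the
  same weighted sum of positions. Hence linear functions of the coordinates have zero flow there.
\<close>

lemma flow_d1:
  assumes "\<beta> \<in> faces n" "n > 0"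
  shows "flow (d1 n) \<beta> = ((if \<beta> = (0, n, 0) then 1 else 0) - (if \<beta> = (n, 0, 0) then 1 else 0)) / (2 * of_nat n)"
proof -
  obtain x y z where \<beta>: "\<beta> = (x, y, z)" by (cases \<beta>)
  show ?thesis
    using assms unfolding \<beta>
    by (cases x; cases y; cases z)
      (auto simp: flow_def lookup_d1 faces_def arrow_weight_def field_simps)
qed

lemma flow_d2:
  assumes "\<beta> \<in> faces n" "n > 0"
  shows "flow (d2 n) \<beta> = ((if \<beta> = (0, 0, n) then 1 else 0) - (if \<beta> = (0, n, 0) then 1 else 0)) / (2 * of_nat n)"
proof -
  obtain x y z where \<beta>: "\<beta> = (x, y, z)" by (cases \<beta>)
  show ?thesis
    using assms unfolding \<beta>
    by (cases x; cases y; cases z)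
      (auto simp: flow_def lookup_d2 faces_def arrow_weight_def field_simps)
qed

lemma sum_corner:
  assumes "(x, y, z) \<in> faces n"
  shows "(\<Sum>\<beta>\<in>faces n. f \<beta> * ((if \<beta> = (x, y, z) then 1 else 0) :: rat)) = f (x, y, z)"
proof -
  have "(\<Sum>\<beta>\<in>faces n. f \<beta> * ((if \<beta> = (x, y, z) then 1 else 0) :: rat))
      = (\<Sum>\<beta>\<in>faces n. if \<beta> = (x, y, z) then f (x, y, z) else 0)"
    by (intro sum.cong) auto
  also have "\<dots> = f (x, y, z)" using assms by simp
  finally show ?thesis .
qed

lemma skew_d1:
  assumes "Poly_Mapping.keys \<mu> \<subseteq> faces n" "n > 0"
  shows "skew (d1 n) \<mu> = (Poly_Mapping.lookup \<mu> (0, n, 0) - Poly_Mapping.lookup \<mu> (n, 0, 0)) / (2 * of_nat n)"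
proof -
  have "skew (d1 n) \<mu> = (\<Sum>\<beta>\<in>faces n. Poly_Mapping.lookup \<mu> \<beta> *
      (((if \<beta> = (0, n, 0) then 1 else 0) - (if \<beta> = (n, 0, 0) then 1 else 0)) / (2 * of_nat n)))"
    unfolding skew_flow[OF finite_faces assms(1)]
    by (intro sum.cong refl) (simp only: flow_d1[OF _ assms(2)])
  also have "\<dots> = (Poly_Mapping.lookup \<mu> (0, n, 0) - Poly_Mapping.lookup \<mu> (n, 0, 0)) / (2 * of_nat n)"
    unfolding times_divide_eq_right sum_divide_distrib[symmetric] right_diff_distrib sum_subtractf
    by (subst (1 2) sum_corner) (auto simp: faces_def)
  finally show ?thesis .
qed

lemma skew_d2:
  assumes "Poly_Mapping.keys \<mu> \<subseteq> faces n" "n > 0"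
  shows "skew (d2 n) \<mu> = (Poly_Mapping.lookup \<mu> (0, 0, n) - Poly_Mapping.lookup \<mu> (0, n, 0)) / (2 * of_nat n)"
proof -
  have "skew (d2 n) \<mu> = (\<Sum>\<beta>\<in>faces n. Poly_Mapping.lookup \<mu> \<beta> *
      (((if \<beta> = (0, 0, n) then 1 else 0) - (if \<beta> = (0, n, 0) then 1 else 0)) / (2 * of_nat n)))"
    unfolding skew_flow[OF finite_faces assms(1)]
    by (intro sum.cong refl) (simp only: flow_d2[OF _ assms(2)])
  also have "\<dots> = (Poly_Mapping.lookup \<mu> (0, 0, n) - Poly_Mapping.lookup \<mu> (0, n, 0)) / (2 * of_nat n)"
    unfolding times_divide_eq_right sum_divide_distrib[symmetric] right_diff_distrib sum_subtractf
    by (subst (1 2) sum_corner) (auto simp: faces_def)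
  finally show ?thesis .
qed


section \<open>Paths of the network\<close>

text \<open>
  \<open>descent n t a b c P\<close>: \<open>P\<close> is a path from the white vertex \<open>(a, b, c)\<close> to the sink \<open>t\<close>. The rules follow a
  path by steps of one level, from a white vertex through a black one to the next white one.
\<close>

inductive descent :: "nat \<Rightarrow> vertex \<Rightarrow> nat \<Rightarrow> nat \<Rightarrow> nat \<Rightarrow> vertex list \<Rightarrow> bool" for n t where
  left: "\<lbrakk>a + c + 1 = n; t = LeftSink (a + 1)\<rbrakk> \<Longrightarrow> descent n t a 0 c [White a 0 c, t]"
| bottom: "\<lbrakk>a + b + 1 = n; t = BottomSink (b + 1)\<rbrakk> \<Longrightarrow> descent n t a b 0 [White a b 0, t]"
| down: "descent n t (a + 1) b c Q \<Longrightarrow> descent n t a (b + 1) c (White a (b + 1) c # Black a b c # Q)"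
| keep: "descent n t (a + 1) b c Q \<Longrightarrow> descent n t a b (c + 1) (White a b (c + 1) # Black a b c # Q)"

lemma descent_sum: "descent n t a b c P \<Longrightarrow> a + b + c + 1 = n"
  by (induction rule: descent.induct) auto

lemma descent_hd: "descent n t a b c P \<Longrightarrow> \<exists>P'. P' \<noteq> [] \<and> P = White a b c # P'"
  by (cases rule: descent.cases) (auto elim: descent.cases)

lemma descent_path: "descent n t a b c P \<Longrightarrow> P \<in> paths n (White a b c) t"
proof (induction rule: descent.induct)
  case (left a c)
  then show ?case using edge.intros(5)[of "a + 1" n] by (auto simp: paths_def)
next
  case (bottom a b)
  then show ?case using edge.intros(6)[of "b + 1" n] by (auto simp: paths_def)
next
  case (down a b c Q)
  then obtain Q' where "Q = White (a + 1) b c # Q'" using descent_hd by blast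
  then show ?case
    using down descent_sum[OF down.hyps] edge.intros(1)[of a "b + 1" c n] edge.intros(3)[of a b c n]
    by (auto simp: paths_def)
next
  case (keep a b c Q)
  then obtain Q' where "Q = White (a + 1) b c # Q'" using descent_hd by blast
  then show ?case
    using keep descent_sum[OF keep.hyps] edge.intros(2)[of a b "c + 1" n] edge.intros(3)[of a b c n]
    by (auto simp: paths_def)
qed

fun is_sink :: "vertex \<Rightarrow> bool" where
  "is_sink (LeftSink i) \<longleftrightarrow> True"
| "is_sink (BottomSink i) \<longleftrightarrow> True"
| "is_sink _ \<longleftrightarrow> False"

lemma path_Cons:
  assumes "P \<in> paths n s t" "s \<noteq> t"
  obtains v Q where "P = s # Q" "edge n s v" "Q \<in> paths n v t"
proof -
  obtain Q where P: "P = s # Q" using assms(1) by (cases P) (auto simp: paths_def)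
  then have "Q \<noteq> []" using assms by (auto simp: paths_def)
  then obtain v Q' where "Q = v # Q'" by (cases Q) auto
  then have "edge n s v" "Q \<in> paths n v t" using assms(1) P by (auto simp: paths_def)
  with P show ?thesis using that by blast
qed

lemma edge_not_sink: "edge n u v \<Longrightarrow> \<not> is_sink u"
  by (cases rule: edge.cases) auto

lemma path_sink:
  assumes P: "P \<in> paths n s t" and s: "is_sink s"
  shows "P = [s]" "t = s"
proof -
  have "s = t"
  proof (rule ccontr)
    assume "s \<noteq> t"
    with P obtain v Q where "edge n s v" by (rule path_Cons)
    with s show False using edge_not_sink by blast
  qed
  moreover obtain Q where Q: "P = s # Q" using P by (cases P) (auto simp: paths_def)
  moreover have "Q = []"
  proof (cases Q)
    case (Cons v Q')
    with P Q have "edge n s v" by (auto simp: paths_def)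
    with s show ?thesis using edge_not_sink by blast
  qed
  ultimately show "P = [s]" "t = s" by auto
qed

lemma path_descent:
  assumes "P \<in> paths n (White a b c) t" "is_sink t"
  shows "descent n t a b c P"
  using assms(1)
proof (induction "length P" arbitrary: P a b c rule: less_induct)
  case less
  have "White a b c \<noteq> t" using assms(2) by auto
  with less.prems obtain v Q where P: "P = White a b c # Q" and e: "edge n (White a b c) v"
    and Q: "Q \<in> paths n v t"
    by (rule path_Cons)
  from e show ?case
  proof cases
    case 1
    have "v \<noteq> t" using assms(2) 1 by auto
    with Q obtain w Q' where Q': "Q = v # Q'" and e': "edge n v w" and p: "Q' \<in> paths n w t"
      by (rule path_Cons)
    from e' 1 have "w = White (a + 1) (b - 1) c" by (auto elim: edge.cases)
    with p have "descent n t (a + 1) (b - 1) c Q'" using less.hyps[of Q'] P Q' by simp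
    from descent.down[OF this] show ?thesis using P Q' 1 by simp
  next
    case 2
    have "v \<noteq> t" using assms(2) 2 by auto
    with Q obtain w Q' where Q': "Q = v # Q'" and e': "edge n v w" and p: "Q' \<in> paths n w t"
      by (rule path_Cons)
    from e' 2 have "w = White (a + 1) b (c - 1)" by (auto elim: edge.cases)
    with p have "descent n t (a + 1) b (c - 1) Q'" using less.hyps[of Q'] P Q' by simp
    from descent.keep[OF this] show ?thesis using P Q' 2 by simp
  next
    case (5 i)
    with path_sink[OF Q] show ?thesis using P descent.left[of a c n t] by auto
  next
    case (6 i)
    with path_sink[OF Q] show ?thesis using P descent.bottom[of a b n t] by auto
  qed
qed

lemma paths_White: "is_sink t \<Longrightarrow> paths n (White a b c) t = {P. descent n t a b c P}"
  using path_descent descent_path by blast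

lemma paths_Source:
  assumes "j \<in> {1..n}" "is_sink t"
  shows "paths n (Source j) t = (#) (Source j) ` {Q. descent n t 0 (j - 1) (n - j) Q}"
proof (intro equalityI subsetI)
  fix P assume "P \<in> paths n (Source j) t"
  moreover have "Source j \<noteq> t" using assms(2) by auto
  ultimately obtain v Q where P: "P = Source j # Q" and e: "edge n (Source j) v" and Q: "Q \<in> paths n v t"
    by (rule path_Cons)
  from e have "v = White 0 (j - 1) (n - j)" by cases auto
  with P Q path_descent assms(2) show "P \<in> (#) (Source j) ` {Q. descent n t 0 (j - 1) (n - j) Q}" by auto
next
  fix P assume "P \<in> (#) (Source j) ` {Q. descent n t 0 (j - 1) (n - j) Q}"
  then obtain Q where P: "P = Source j # Q" and Q: "Q \<in> paths n (White 0 (j - 1) (n - j)) t"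
    using descent_path by blast
  moreover have "edge n (Source j) (White 0 (j - 1) (n - j))" using assms(1) by (rule edge.intros)
  ultimately show "P \<in> paths n (Source j) t" by (cases Q) (auto simp: paths_def)
qed


section \<open>The faces to the right of a path\<close>

text \<open>
  The part of the faces to the right of a path for which one of its vertices is responsible: a path
  through \<open>White a b c\<close> crosses line \<open>a\<close> just behind the face number \<open>b\<close>, and a path which leaves the
  triangle at the bottom has all lines beyond its last one on its right.
\<close>

fun shadow :: "nat \<Rightarrow> vertex \<Rightarrow> face set" where
  "shadow n (White a b c) = line n a (b + 1)"
| "shadow n (BottomSink i) = deeper n (n - i)"
| "shadow n _ = {}"

definition region :: "nat \<Rightarrow> vertex list \<Rightarrow> face set" where
  "region n P = (\<Union>v\<in>set P. shadow n v)"

lemma region_Cons [simp]: "region n (v # P) = shadow n v \<union> region n P" and region_Nil [simp]: "region n [] = {}"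
  by (simp_all add: region_def)

lemma finite_shadow [simp]: "finite (shadow n v)"
  by (cases v) auto

lemma finite_region [simp]: "finite (region n P)"
  by (simp add: region_def)

lemma region_level:
  assumes "descent n t a b c P"
  shows "(x, y, z) \<in> region n P \<Longrightarrow> x + y + z = n \<and> a \<le> x"
    and "(a, y, z) \<in> region n P \<longleftrightarrow> y \<le> b \<and> a + y + z = n"
proof -
  have "((x, y, z) \<in> region n P \<longrightarrow> x + y + z = n \<and> a \<le> x) \<and>
    ((a, y, z) \<in> region n P \<longleftrightarrow> y \<le> b \<and> a + y + z = n)" for x y z
    using assms
  proof (induction arbitrary: x y z rule: descent.induct)
    case (down a b c Q)
    have "(a, y, z) \<notin> region n Q" for y z using down.IH[of a y z] by auto
    moreover have "(x, y, z) \<in> region n Q \<longrightarrow> x + y + z = n \<and> a + 1 \<le> x" using down.IH by blast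
    ultimately show ?case using descent_sum[OF down.hyps] by (auto simp: mem_line)
  next
    case (keep a b c Q)
    have "(a, y, z) \<notin> region n Q" for y z using keep.IH[of a y z] by auto
    moreover have "(x, y, z) \<in> region n Q \<longrightarrow> x + y + z = n \<and> a + 1 \<le> x" using keep.IH by blast
    ultimately show ?case using descent_sum[OF keep.hyps] by (auto simp: mem_line)
  qed (auto simp: mem_line mem_deeper)
  then show "(x, y, z) \<in> region n P \<Longrightarrow> x + y + z = n \<and> a \<le> x"
    and "(a, y, z) \<in> region n P \<longleftrightarrow> y \<le> b \<and> a + y + z = n"
    by blast+
qed

lemma region_deeper:
  assumes "descent n t (a + 1) b c P"
  shows "region n P \<subseteq> deeper n a"
  using region_level(1)[OF assms] by (auto simp: mem_deeper) (force simp: mem_deeper)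

lemma steps_Cons2: "steps (u # v # P) = insert (u, v) (steps (v # P))"
  by (simp add: steps_def)

lemma steps_fst: "(u, v) \<in> steps P \<Longrightarrow> u \<in> set P"
  by (auto simp: steps_def dest: set_zip_leftD)

lemma descent_levels:
  assumes "descent n t a b c P"
  shows "White x y z \<in> set P \<Longrightarrow> a \<le> x" "Black x y z \<in> set P \<Longrightarrow> a \<le> x"
  using assms by (induction rule: descent.induct) fastforce+

text \<open>
  The edges starting from level \<open>x\<close> that are not used by \<open>P\<close> have both adjacent faces on the same side of
  \<open>P\<close>. Hence a walk which does not cross \<open>P\<close> cannot leave the region.
\<close>

definition separated :: "nat \<Rightarrow> vertex list \<Rightarrow> nat \<Rightarrow> bool" where
  "separated n P x \<longleftrightarrow>
    (\<forall>y z. x + y + z + 2 = n \<longrightarrow>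
      ((White x (y + 1) z, Black x y z) \<notin> steps P \<longrightarrow>
         ((x + 1, y + 1, z) \<in> region n P \<longleftrightarrow> (x, y + 1, z + 1) \<in> region n P)) \<and>
      ((White x y (z + 1), Black x y z) \<notin> steps P \<longrightarrow>
         ((x + 1, y, z + 1) \<in> region n P \<longleftrightarrow> (x, y + 1, z + 1) \<in> region n P)) \<and>
      ((Black x y z, White (x + 1) y z) \<notin> steps P \<longrightarrow>
         ((x + 1, y + 1, z) \<in> region n P \<longleftrightarrow> (x + 1, y, z + 1) \<in> region n P))) \<and>
    (\<forall>z. x + z + 1 = n \<longrightarrow> (White x 0 z, LeftSink (x + 1)) \<notin> steps P \<longrightarrow>
       ((x, 0, z + 1) \<in> region n P \<longleftrightarrow> (x + 1, 0, z) \<in> region n P)) \<and>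
    (\<forall>y. x + y + 1 = n \<longrightarrow> (White x y 0, BottomSink (y + 1)) \<notin> steps P \<longrightarrow>
       ((x, y + 1, 0) \<in> region n P \<longleftrightarrow> (x + 1, y, 0) \<in> region n P))"

lemma separated_tail:
  assumes "separated n Q x" "steps Q \<subseteq> steps P"
    and "\<And>y z. (x, y, z) \<in> region n P \<longleftrightarrow> (x, y, z) \<in> region n Q"
    and "\<And>y z. (x + 1, y, z) \<in> region n P \<longleftrightarrow> (x + 1, y, z) \<in> region n Q"
  shows "separated n P x"
  using assms unfolding separated_def by blast

lemma descent_separated:
  assumes "descent n t a b c P" "a \<le> x"
  shows "separated n P x"
  using assms
proof (induction arbitrary: x rule: descent.induct)
  case (left a c)
  then show ?case by (auto simp: separated_def mem_line steps_def)
next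
  case (bottom a b)
  then show ?case by (auto simp: separated_def mem_line mem_deeper steps_def)
next
  case (down a b c Q)
  let ?P = "White a (b + 1) c # Black a b c # Q"
  have P: "descent n t a (b + 1) c ?P" using down.hyps by (rule descent.down)
  obtain Q' where Q': "Q = White (a + 1) b c # Q'" using descent_hd[OF down.hyps] by blast
  have steps: "steps ?P = {(White a (b + 1) c, Black a b c), (Black a b c, White (a + 1) b c)} \<union> steps Q"
    by (auto simp: Q' steps_Cons2)
  have above: "(u, y, z) \<in> region n ?P \<longleftrightarrow> (u, y, z) \<in> region n Q" if "a + 1 \<le> u" for u y z
    using that by (auto simp: mem_line)
  show ?case
  proof (cases "x = a")
    case True
    show ?thesis
      unfolding True separated_def above[OF order_refl] region_level(2)[OF P] region_level(2)[OF down.hyps] steps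
      using descent_sum[OF down.hyps] by auto
  next
    case False
    with down.prems have "a + 1 \<le> x" by simp
    then show ?thesis
      using down.IH above steps by (intro separated_tail[of n Q x ?P]) auto
  qed
next
  case (keep a b c Q)
  let ?P = "White a b (c + 1) # Black a b c # Q"
  have P: "descent n t a b (c + 1) ?P" using keep.hyps by (rule descent.keep)
  obtain Q' where Q': "Q = White (a + 1) b c # Q'" using descent_hd[OF keep.hyps] by blast
  have steps: "steps ?P = {(White a b (c + 1), Black a b c), (Black a b c, White (a + 1) b c)} \<union> steps Q"
    by (auto simp: Q' steps_Cons2)
  have above: "(u, y, z) \<in> region n ?P \<longleftrightarrow> (u, y, z) \<in> region n Q" if "a + 1 \<le> u" for u y z
    using that by (auto simp: mem_line)
  show ?case
  proof (cases "x = a")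
    case True
    show ?thesis
      unfolding True separated_def above[OF order_refl] region_level(2)[OF P] region_level(2)[OF keep.hyps] steps
      using descent_sum[OF keep.hyps] by auto
  next
    case False
    with keep.prems have "a + 1 \<le> x" by simp
    then show ?thesis
      using keep.IH above steps by (intro separated_tail[of n Q x ?P]) auto
  qed
qed

text \<open>
  Together with the second part of \<open>descent_staircase\<close> this allows a walk from any face of the region
  to \<open>(0, 0, n)\<close> that does not cross \<open>P\<close>: first along a line to the left side of the triangle, and then up
  this side.
\<close>

definition staircase :: "nat \<Rightarrow> vertex list \<Rightarrow> bool" where
  "staircase n P \<longleftrightarrow> (\<forall>x y z.
     ((x, y + 1, z) \<in> region n P \<longrightarrow> (x, y, z + 1) \<in> region n P) \<and>
     ((Black x y z, White (x + 1) y z) \<in> steps P \<longrightarrow> (x + 1, y + 1, z) \<notin> region n P) \<and>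
     ((White x y z, LeftSink (x + 1)) \<in> steps P \<longrightarrow> (x + 1, 0, z) \<notin> region n P))"

lemma descent_staircase:
  assumes "descent n t a b c P"
  shows "staircase n P" and "\<lbrakk>a \<le> x; (x + 1, 0, z) \<in> region n P\<rbrakk> \<Longrightarrow> (x, 0, z + 1) \<in> region n P"
proof -
  have "staircase n P \<and> (\<forall>x\<ge>a. \<forall>z. (x + 1, 0, z) \<in> region n P \<longrightarrow> (x, 0, z + 1) \<in> region n P)"
    using assms
  proof (induction rule: descent.induct)
    case (left a c)
    then show ?case by (auto simp: staircase_def mem_line steps_def)
  next
    case (bottom a b)
    then show ?case by (auto simp: staircase_def mem_line mem_deeper steps_def)
  next
    case (down a b c Q)
    obtain Q' where Q': "Q = White (a + 1) b c # Q'" using descent_hd[OF down.hyps] by blast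
    let ?P = "White a (b + 1) c # Black a b c # Q"
    have lev: "a + 1 \<le> x" if "(Black x y z, v) \<in> steps Q \<or> (White x y z, v) \<in> steps Q" for x y z v
      using that descent_levels[OF down.hyps] steps_fst by blast
    have mem: "(x, y, z) \<in> region n ?P \<longleftrightarrow> x = a \<and> y \<le> b + 1 \<and> a + y + z = n \<or> (x, y, z) \<in> region n Q" for x y z
      using descent_sum[OF down.hyps] by (auto simp: mem_line)
    have steps: "steps ?P = {(White a (b + 1) c, Black a b c), (Black a b c, White (a + 1) b c)} \<union> steps Q"
      by (auto simp: Q' steps_Cons2)
    note level = region_level[OF down.hyps]
    have stairs: "(x, y + 1, z) \<in> region n Q \<Longrightarrow> (x, y, z + 1) \<in> region n Q"
      "(Black x y z, White (x + 1) y z) \<in> steps Q \<Longrightarrow> (x + 1, y + 1, z) \<notin> region n Q"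
      "(White x y z, LeftSink (x + 1)) \<in> steps Q \<Longrightarrow> (x + 1, 0, z) \<notin> region n Q" for x y z
      using down.IH unfolding staircase_def by blast+
    have "staircase n ?P"
      unfolding staircase_def
    proof (intro allI conjI impI)
      fix x y z
      show "(x, y + 1, z) \<in> region n ?P \<Longrightarrow> (x, y, z + 1) \<in> region n ?P"
        unfolding mem using stairs(1)[of x y z] by auto
      show "(x + 1, y + 1, z) \<notin> region n ?P" if "(Black x y z, White (x + 1) y z) \<in> steps ?P"
        using that stairs(2)[of x y z] lev[of x y z "White (x + 1) y z"] level(2)[of "b + 1" c] unfolding mem steps by auto
      show "(x + 1, 0, z) \<notin> region n ?P" if "(White x y z, LeftSink (x + 1)) \<in> steps ?P"
        using that stairs(3)[of x y z] lev[of x y z "LeftSink (x + 1)"] unfolding mem steps by auto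
    qed
    moreover have "(x, 0, z + 1) \<in> region n ?P" if "a \<le> x" "(x + 1, 0, z) \<in> region n ?P" for x z
    proof -
      have "(x + 1, 0, z) \<in> region n Q" using that unfolding mem by auto
      then show ?thesis
        using that(1) down.IH level(1)[of "x + 1" 0 z] unfolding mem by (cases "x = a") auto
    qed
    ultimately show ?case by blast
  next
    case (keep a b c Q)
    obtain Q' where Q': "Q = White (a + 1) b c # Q'" using descent_hd[OF keep.hyps] by blast
    let ?P = "White a b (c + 1) # Black a b c # Q"
    have lev: "a + 1 \<le> x" if "(Black x y z, v) \<in> steps Q \<or> (White x y z, v) \<in> steps Q" for x y z v
      using that descent_levels[OF keep.hyps] steps_fst by blast
    have mem: "(x, y, z) \<in> region n ?P \<longleftrightarrow> x = a \<and> y \<le> b \<and> a + y + z = n \<or> (x, y, z) \<in> region n Q" for x y z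
      using descent_sum[OF keep.hyps] by (auto simp: mem_line)
    have steps: "steps ?P = {(White a b (c + 1), Black a b c), (Black a b c, White (a + 1) b c)} \<union> steps Q"
      by (auto simp: Q' steps_Cons2)
    note level = region_level[OF keep.hyps]
    have stairs: "(x, y + 1, z) \<in> region n Q \<Longrightarrow> (x, y, z + 1) \<in> region n Q"
      "(Black x y z, White (x + 1) y z) \<in> steps Q \<Longrightarrow> (x + 1, y + 1, z) \<notin> region n Q"
      "(White x y z, LeftSink (x + 1)) \<in> steps Q \<Longrightarrow> (x + 1, 0, z) \<notin> region n Q" for x y z
      using keep.IH unfolding staircase_def by blast+
    have "staircase n ?P"
      unfolding staircase_def
    proof (intro allI conjI impI)
      fix x y z
      show "(x, y + 1, z) \<in> region n ?P \<Longrightarrow> (x, y, z + 1) \<in> region n ?P"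
        unfolding mem using stairs(1)[of x y z] by auto
      show "(x + 1, y + 1, z) \<notin> region n ?P" if "(Black x y z, White (x + 1) y z) \<in> steps ?P"
        using that stairs(2)[of x y z] lev[of x y z "White (x + 1) y z"] level(2)[of "b + 1" c] unfolding mem steps by auto
      show "(x + 1, 0, z) \<notin> region n ?P" if "(White x y z, LeftSink (x + 1)) \<in> steps ?P"
        using that stairs(3)[of x y z] lev[of x y z "LeftSink (x + 1)"] unfolding mem steps by auto
    qed
    moreover have "(x, 0, z + 1) \<in> region n ?P" if "a \<le> x" "(x + 1, 0, z) \<in> region n ?P" for x z
    proof -
      have "(x + 1, 0, z) \<in> region n Q" using that unfolding mem by auto
      then show ?thesis
        using that(1) keep.IH level(1)[of "x + 1" 0 z] unfolding mem by (cases "x = a") auto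
    qed
    ultimately show ?case by blast
  qed
  then show "staircase n P" and "\<lbrakk>a \<le> x; (x + 1, 0, z) \<in> region n P\<rbrakk> \<Longrightarrow> (x, 0, z + 1) \<in> region n P"
    by blast+
qed

lemma adjacent_off_separated:
  assumes j: "j \<in> {1..n}" and Q: "descent n t 0 (j - 1) (n - j) Q"
    and adj: "adjacent_off n (Source j # Q) \<alpha> \<beta>"
  shows "\<alpha> \<in> region n Q \<longleftrightarrow> \<beta> \<in> region n Q"
proof -
  obtain Q' where Q': "Q = White 0 (j - 1) (n - j) # Q'" using descent_hd[OF Q] by blast
  have steps: "steps (Source j # Q) = insert (Source j, White 0 (j - 1) (n - j)) (steps Q)"
    by (simp add: Q' steps_Cons2)
  note sep = descent_separated[OF Q le0, unfolded separated_def]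
  from adj obtain u v where e: "edge n u v" and off: "(u, v) \<notin> steps (Source j # Q)"
    and cross: "corners n u \<inter> corners n v = {\<alpha>, \<beta>}"
    unfolding adjacent_off_def by blast
  have "\<exists>p q. corners n u \<inter> corners n v = {p, q} \<and> (p \<in> region n Q \<longleftrightarrow> q \<in> region n Q)"
    using e
  proof cases
    case (1 a b c)
    then obtain y where y: "b = y + 1" by (cases b) auto
    show ?thesis
      by (rule exI[of _ "(a + 1, y + 1, c)"], rule exI[of _ "(a, y + 1, c + 1)"])
        (use 1 y off sep[of a] in \<open>auto simp: steps\<close>)
  next
    case (2 a b c)
    then obtain z where z: "c = z + 1" by (cases c) auto
    show ?thesis
      by (rule exI[of _ "(a + 1, b, z + 1)"], rule exI[of _ "(a, b + 1, z + 1)"])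
        (use 2 z off sep[of a] in \<open>auto simp: steps\<close>)
  next
    case (3 a b c)
    show ?thesis
      by (rule exI[of _ "(a + 1, b + 1, c)"], rule exI[of _ "(a + 1, b, c + 1)"])
        (use 3 off sep[of a] in \<open>auto simp: steps\<close>)
  next
    case (4 i)
    have "i \<noteq> j" using off 4 by (auto simp: steps)
    then show ?thesis
      by (intro exI[of _ "(0, i - 1, n - i + 1)"] exI[of _ "(0, i, n - i)"])
        (use 4 j region_level(2)[OF Q] in auto)
  next
    case (5 i)
    then obtain x where x: "i = x + 1" by (cases i) auto
    show ?thesis
      by (rule exI[of _ "(x, 0, n - i + 1)"], rule exI[of _ "(x + 1, 0, n - i)"])
        (use 5 x off sep[of x] in \<open>auto simp: steps\<close>)
  next
    case (6 i)
    then obtain y where y: "i = y + 1" by (cases i) auto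
    show ?thesis
      by (rule exI[of _ "(n - i, y + 1, 0)"], rule exI[of _ "(n - i + 1, y, 0)"])
        (use 6 y off sep[of "n - i"] in \<open>auto simp: steps\<close>)
  qed
  with cross show ?thesis by (auto simp: doubleton_eq_iff)
qed

lemma adjacent_offI:
  assumes "edge n u v" "(u, v) \<notin> steps P" "corners n u \<inter> corners n v = {\<alpha>, \<beta>}"
  shows "adjacent_off n P \<alpha> \<beta>"
  using assms unfolding adjacent_off_def by blast

lemma descent_no_Source: "descent n t a b c P \<Longrightarrow> Source i \<notin> set P"
  by (induction rule: descent.induct) auto

lemma region_reachable:
  assumes j: "j \<in> {1..n}" and Q: "descent n t 0 (j - 1) (n - j) Q"
  shows "(x, y, z) \<in> region n Q \<Longrightarrow> (adjacent_off n (Source j # Q))\<^sup>*\<^sup>* (0, 0, n) (x, y, z)"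
proof (induction "x + y" arbitrary: x y z rule: less_induct)
  case less
  obtain Q' where Q': "Q = White 0 (j - 1) (n - j) # Q'" using descent_hd[OF Q] by blast
  have steps: "steps (Source j # Q) = insert (Source j, White 0 (j - 1) (n - j)) (steps Q)"
    by (simp add: Q' steps_Cons2)
  note stairs = descent_staircase(1)[OF Q, unfolded staircase_def]
  have n: "x + y + z = n" using region_level(1)[OF Q less.prems] by simp
  show ?case
  proof (cases y)
    case (Suc y')
    have before: "(x, y', z + 1) \<in> region n Q" using stairs less.prems Suc by simp
    have "adjacent_off n (Source j # Q) (x, y', z + 1) (x, y, z)"
    proof (cases x)
      case 0
      have "y < j" using less.prems region_level(2)[OF Q, of y z] 0 j Suc by auto
      then show ?thesis
        using descent_no_Source[OF Q, of y] steps_fst[of "Source y" _ Q] n 0 Suc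
        by (intro adjacent_offI[OF edge.intros(4)[of y n]]) (auto simp: steps)
    next
      case x: (Suc x')
      have "(Black x' y' z, White (x' + 1) y' z) \<notin> steps Q"
        using stairs less.prems Suc x by auto
      then show ?thesis
        using n Suc x by (intro adjacent_offI[OF edge.intros(3)[of x' y' z n]]) (auto simp: steps)
    qed
    with less.hyps[OF _ before] Suc show ?thesis by (simp add: rtranclp.rtrancl_into_rtrancl)
  next
    case y: 0
    show ?thesis
    proof (cases x)
      case 0
      with y n show ?thesis by simp
    next
      case (Suc x')
      have before: "(x', 0, z + 1) \<in> region n Q"
        using descent_staircase(2)[OF Q, of x' z] less.prems Suc y by simp
      have "(White x' 0 z, LeftSink (x' + 1)) \<notin> steps Q"
        using stairs less.prems Suc y by auto
      then have "adjacent_off n (Source j # Q) (x', 0, z + 1) (x, y, z)"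
        using n Suc y by (intro adjacent_offI[OF edge.intros(5)[of x n]]) (auto simp: steps)
      with less.hyps[OF _ before] Suc y show ?thesis by (simp add: rtranclp.rtrancl_into_rtrancl)
    qed
  qed
qed

lemma right_faces_region:
  assumes j: "j \<in> {1..n}" and Q: "descent n t 0 (j - 1) (n - j) Q"
  shows "right_faces n (Source j # Q) = region n Q"
proof (intro equalityI subsetI)
  fix \<alpha> assume "\<alpha> \<in> right_faces n (Source j # Q)"
  then have "(adjacent_off n (Source j # Q))\<^sup>*\<^sup>* (0, 0, n) \<alpha>" by (simp add: right_faces_def)
  then show "\<alpha> \<in> region n Q"
  proof induction
    case base
    then show ?case using region_level(2)[OF Q] by simp
  next
    case (step \<alpha> \<beta>)
    then show ?case using adjacent_off_separated[OF j Q] by blast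
  qed
next
  fix \<alpha> assume "\<alpha> \<in> region n Q"
  then show "\<alpha> \<in> right_faces n (Source j # Q)"
    using region_reachable[OF j Q] by (cases \<alpha>) (simp add: right_faces_def)
qed

lemma path_weight_region:
  assumes "j \<in> {1..n}" "descent n t 0 (j - 1) (n - j) Q"
  shows "path_weight n (Source j # Q) = qZ (face_sum (region n Q))"
  unfolding path_weight_def right_faces_region[OF assms] by (simp add: weyl_def face_sum_def)

text \<open>
  The level at which a path starts contributes a full interval of its line, independently of the rest of
  the path; this is what makes the recursion over the levels possible.
\<close>

lemma face_sum_region_Cons:
  assumes "descent n t (a + 1) b' c' Q"
  shows "face_sum (region n (White a b c # Black x y z # Q))
    = face_sum (line n a (b + 1)) + face_sum (region n Q)"
proof -
  have "line n a (b + 1) \<inter> region n Q = {}"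
    using region_deeper[OF assms] by (auto simp: mem_line mem_deeper)
  then show ?thesis by (simp add: face_sum_Un)
qed

lemma finite_descents: "is_sink t \<Longrightarrow> finite {P. descent n t a b c P}"
  using finite_paths[of n "White a b c" t] by (simp add: paths_White)


section \<open>The rows of the network\<close>

interpretation torus: q_algebra "qscale :: 'k::qfield \<Rightarrow> 'k qtorus \<Rightarrow> 'k qtorus"
  by (rule q_algebra.intro[OF assoc_algebra_qscale])

lemma qZ_add: "qZ (\<kappa> + \<mu>) = qscale (qpow (skew \<kappa> \<mu>)) (qZ \<kappa> * qZ \<mu> :: 'k::qfield qtorus)"
  by (simp add: qZ_mult qpow_0 flip: qpow_add)

lemma qZ_swap: "qZ \<kappa> * qZ \<mu> = qscale (qpow (- 2 * skew \<kappa> \<mu>)) (qZ \<mu> * qZ \<kappa> :: 'k::qfield qtorus)"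
proof -
  have "qZ \<mu> * qZ \<kappa> = qscale (qpow (skew \<kappa> \<mu>)) (qZ (\<kappa> + \<mu>) :: 'k qtorus)"
    by (simp add: qZ_mult skew_antisym[of \<mu> \<kappa>] add.commute)
  then show ?thesis by (simp add: qZ_mult flip: qpow_add)
qed

lemma qZ_swap_sum:
  assumes "\<And>P. P \<in> A \<Longrightarrow> skew \<kappa> (f P) = s"
  shows "qZ \<kappa> * (\<Sum>P\<in>A. qZ (f P)) = qscale (qpow (- 2 * s)) ((\<Sum>P\<in>A. qZ (f P)) * qZ \<kappa> :: 'k::qfield qtorus)"
proof -
  have "qZ \<kappa> * qZ (f P) = qscale (qpow (- 2 * s)) (qZ (f P) * qZ \<kappa> :: 'k qtorus)" if "P \<in> A" for P
    using qZ_swap[of \<kappa> "f P"] assms[OF that] by simp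
  then show ?thesis
    by (simp add: sum_distrib_left sum_distrib_right torus.scale_sum_right)
qed

lemma qZ_swap_sum':
  assumes "\<And>P. P \<in> A \<Longrightarrow> skew \<kappa> (f P) = s"
  shows "(\<Sum>P\<in>A. qZ (f P)) * qZ \<kappa> = qscale (qpow (2 * s)) (qZ \<kappa> * (\<Sum>P\<in>A. qZ (f P)) :: 'k::qfield qtorus)"
  using qZ_swap_sum[of A \<kappa> f s, OF assms, where ?'k = 'k] by (simp add: qpow_0 flip: qpow_add)

lemma descent_shape:
  assumes "descent n t a b c P"
  obtains (left) "t = LeftSink (a + 1)" "face_sum (region n P) = face_sum (line n a (b + 1))"
  | (bottom) "t = BottomSink (n - a)"
      "face_sum (region n P) = face_sum (line n a (b + 1)) + face_sum (deeper n a)"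
  | (inner) b' c' Q where "descent n t (a + 1) b' c' Q"
      "face_sum (region n P) = face_sum (line n a (b + 1)) + face_sum (region n Q)"
  using assms
proof cases
  case left
  then show ?thesis using that(1) by simp
next
  case bottom
  have "line n a (b + 1) \<inter> deeper n a = {}" by (auto simp: mem_line mem_deeper)
  with bottom show ?thesis using that(2) by (auto simp: face_sum_Un)
next
  case (down b Q)
  then show ?thesis using that(3) face_sum_region_Cons[OF down(3)] by auto
next
  case (keep c Q)
  then show ?thesis using that(3) face_sum_region_Cons[OF keep(3)] by auto
qed

lemma skew_line_region:
  assumes P: "descent n t (a + 1) b c P" and j: "1 \<le> j" "j \<le> n - a + 1"
  shows "skew (face_sum (line n a j)) (face_sum (region n P)) = (if j \<le> b + 1 then - 1 / 2 else 1 / 2)"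
proof -
  have n: "a + 1 + b + c + 1 = n" using descent_sum[OF P] .
  have line: "skew (face_sum (line n a j)) (face_sum (line n (a + 1) (b + 1)))
      = (if j \<le> b + 1 then - 1 / 2 else 1 / 2)"
    by (rule skew_adjacent_lines) (use n j in auto)
  from P show ?thesis
  proof (cases rule: descent_shape)
    case bottom
    then show ?thesis
      using line by (simp add: skew_add_right skew_line_distant keys_face_sum)
  next
    case (inner b' c' Q)
    then show ?thesis
      using line region_deeper[OF inner(1)] by (simp add: skew_add_right skew_line_distant keys_face_sum)
  qed (use line in simp)
qed

lemma skew_deeper_region:
  assumes P: "descent n t (a + 1) b c P"
  shows "skew (face_sum (deeper n a)) (face_sum (region n P)) = - 1 / 2"
proof -
  have n: "a + 1 + b + c + 1 = n" using descent_sum[OF P] .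
  have "skew (face_sum (deeper n a)) (face_sum (region n P))
      = - skew (face_sum (line n a (n - a + 1))) (face_sum (region n P))"
    by (rule skew_deeper) (use n region_deeper[OF P] in \<open>simp_all add: keys_face_sum\<close>)
  then show ?thesis using skew_line_region[OF P, of "n - a + 1"] n by simp
qed

text \<open>
  This lemma and the next one give the powers of \<open>q\<close> in the commutation relations between the two
  single-entry rows of a level and all others. They depend only on the column in which the path enters
  the level, which is why sums over paths commute in the same way.
\<close>

lemma skew_first_region:
  assumes P: "descent n t a b c P" and t: "t \<noteq> LeftSink (a + 1)"
  shows "skew (face_sum (line n a 1)) (face_sum (region n P)) = (if b = 0 then 0 else arrow_weight a / 2) - 1 / 2"
proof -
  have n: "a + b + c + 1 = n" using descent_sum[OF P] .
  have line: "skew (face_sum (line n a 1)) (face_sum (line n a (b + 1))) = (if b = 0 then 0 else arrow_weight a / 2)"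
    using skew_same_line[of 1 "b + 1" n a] n by (cases "b = 0") simp_all
  from P show ?thesis
  proof (cases rule: descent_shape)
    case left
    with t show ?thesis by simp
  next
    case bottom
    then show ?thesis
      using line n skew_line_deeper[of 1 n a] by (simp add: skew_add_right)
  next
    case (inner b' c' Q)
    then show ?thesis
      using line n skew_line_region[OF inner(1), of 1] by (simp add: skew_add_right)
  qed
qed

lemma skew_last_region:
  assumes P: "descent n t a b c P" and t: "t \<noteq> BottomSink (n - a)"
  shows "skew (face_sum (line n a (n - a)) + face_sum (deeper n a)) (face_sum (region n P))
    = 1 / 2 - (if c = 0 then 0 else arrow_weight a / 2)"
proof -
  have n: "a + b + c + 1 = n" using descent_sum[OF P] .
  have line: "skew (face_sum (line n a (n - a))) (face_sum (line n a (b + 1))) = - (if c = 0 then 0 else arrow_weight a / 2)"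
  proof (cases "c = 0")
    case True
    then have "n - a = b + 1" using n by simp
    then show ?thesis using True by simp
  next
    case False
    then show ?thesis
      using n skew_same_line[of "b + 1" "n - a" n a] skew_antisym[of "face_sum (line n a (n - a))"] by simp
  qed
  have deep: "skew (face_sum (deeper n a)) (face_sum (line n a (b + 1))) = 1 / 2"
    using n skew_line_deeper[of "b + 1" n a] skew_antisym[of "face_sum (deeper n a)"] by simp
  from P show ?thesis
  proof (cases rule: descent_shape)
    case left
    then show ?thesis using line deep by (simp add: skew_add_left)
  next
    case bottom
    with t show ?thesis by simp
  next
    case (inner b' c' Q)
    have "a + 1 + b' + c' + 1 = n" using descent_sum[OF inner(1)] .
    then have "skew (face_sum (line n a (n - a))) (face_sum (region n Q)) = 1 / 2"
      using skew_line_region[OF inner(1), of "n - a"] by simp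
    then show ?thesis
      using inner(2) line deep skew_deeper_region[OF inner(1)] by (simp add: skew_add_left skew_add_right)
  qed
qed

text \<open>
  The weights of the paths which enter level \<open>a\<close> in column \<open>j\<close> and end at \<open>t\<close>, counting only the faces from
  line \<open>a\<close> on. Columns are numbered from \<open>1\<close> to \<open>n - a\<close>, like the sources, with zeros outside.
\<close>

definition transport :: "nat \<Rightarrow> nat \<Rightarrow> vertex \<Rightarrow> nat \<Rightarrow> 'k::qfield qtorus" where
  "transport n a t j = (if 1 \<le> j \<and> a + j \<le> n
     then \<Sum>P | descent n t a (j - 1) (n - a - j) P. qZ (face_sum (region n P)) else 0)"

lemma transport_swap:
  assumes "\<And>P. \<lbrakk>1 \<le> j; a + j \<le> n; descent n t a (j - 1) (n - a - j) P\<rbrakk> \<Longrightarrow> skew \<kappa> (face_sum (region n P)) = s"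
  shows "qZ \<kappa> * transport n a t j = qscale (qpow (- 2 * s)) (transport n a t j * qZ \<kappa> :: 'k::qfield qtorus)"
    and "transport n a t j * qZ \<kappa> = qscale (qpow (2 * s)) (qZ \<kappa> * transport n a t j :: 'k qtorus)"
proof -
  let ?A = "{P. descent n t a (j - 1) (n - a - j) P}"
  have "qZ \<kappa> * transport n a t j = qscale (qpow (- 2 * s)) (transport n a t j * qZ \<kappa> :: 'k qtorus) \<and>
      transport n a t j * qZ \<kappa> = qscale (qpow (2 * s)) (qZ \<kappa> * transport n a t j :: 'k qtorus)"
  proof (cases "1 \<le> j \<and> a + j \<le> n")
    case True
    then have "skew \<kappa> (face_sum (region n P)) = s" if "P \<in> ?A" for P
      using that assms by simp
    note skew = this
    have "transport n a t j = (\<Sum>P\<in>?A. qZ (face_sum (region n P)) :: 'k qtorus)"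
      using True by (simp add: transport_def)
    then show ?thesis
      using qZ_swap_sum[of ?A \<kappa> "\<lambda>P. face_sum (region n P)", OF skew, where ?'k = 'k]
        qZ_swap_sum'[of ?A \<kappa> "\<lambda>P. face_sum (region n P)", OF skew, where ?'k = 'k]
      by simp
  qed (auto simp: transport_def)
  then show "qZ \<kappa> * transport n a t j = qscale (qpow (- 2 * s)) (transport n a t j * qZ \<kappa> :: 'k::qfield qtorus)"
    and "transport n a t j * qZ \<kappa> = qscale (qpow (2 * s)) (qZ \<kappa> * transport n a t j :: 'k qtorus)"
    by blast+
qed

lemma descent_sink_bound:
  assumes "descent n t a b c P"
  shows "t = LeftSink i \<Longrightarrow> a < i" "t = BottomSink i \<Longrightarrow> a + i \<le> n" "is_sink t"
  using assms by (induction rule: descent.induct) auto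

lemma transport_left:
  assumes "a < n"
  shows "transport n a (LeftSink (a + 1)) = (\<lambda>j. if j = 1 then qZ (face_sum (line n a 1)) else 0 :: 'k::qfield qtorus)"
proof
  fix j
  have shape: "b = 0 \<and> P = [White a 0 c, LeftSink (a + 1)]" if "descent n (LeftSink (a + 1)) a b c P" for b c P
    using that by cases (auto dest: descent_sink_bound(1)[OF _ refl])
  have "descent n (LeftSink (a + 1)) a 0 (n - a - 1) [White a 0 (n - a - 1), LeftSink (a + 1)]"
    by (rule descent.left) (use assms in auto)
  then have "{P. descent n (LeftSink (a + 1)) a 0 (n - a - 1) P} = {[White a 0 (n - a - 1), LeftSink (a + 1)]}"
    using shape[of 0 "n - a - 1"] by blast
  moreover have "transport n a (LeftSink (a + 1)) j = (0 :: 'k qtorus)" if "1 < j"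
  proof -
    have "{P. descent n (LeftSink (a + 1)) a (j - 1) (n - a - j) P} = {}"
      using shape[of "j - 1"] that by auto
    then show ?thesis by (simp only: transport_def sum.empty if_cancel)
  qed
  ultimately show "transport n a (LeftSink (a + 1)) j = (if j = 1 then qZ (face_sum (line n a 1)) else 0 :: 'k qtorus)"
    using assms by (cases "1 < j"; cases "j = 1") (simp_all add: transport_def)
qed

lemma transport_bottom:
  assumes "a < n"
  shows "transport n a (BottomSink (n - a))
    = (\<lambda>j. if j = n - a then qZ (face_sum (line n a (n - a)) + face_sum (deeper n a)) else 0 :: 'k::qfield qtorus)"
proof
  fix j
  have shape: "c = 0 \<and> P = [White a b 0, BottomSink (n - a)]" if "descent n (BottomSink (n - a)) a b c P" for b c P
    using that by cases (use assms in \<open>auto dest: descent_sink_bound(2)[OF _ refl]\<close>)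
  have "descent n (BottomSink (n - a)) a (n - a - 1) 0 [White a (n - a - 1) 0, BottomSink (n - a)]"
    by (rule descent.bottom) (use assms in auto)
  then have "{P. descent n (BottomSink (n - a)) a (n - a - 1) 0 P} = {[White a (n - a - 1) 0, BottomSink (n - a)]}"
    using shape[of "n - a - 1" 0] by blast
  moreover have "face_sum (region n [White a (n - a - 1) 0, BottomSink (n - a)])
      = face_sum (line n a (n - a)) + face_sum (deeper n a)"
  proof -
    have "line n a (n - a) \<inter> deeper n a = {}" by (auto simp: mem_line mem_deeper)
    moreover have "n - a - 1 + 1 = n - a" "n - (n - a) = a" using assms by auto
    ultimately show ?thesis
      by (simp only: region_Cons region_Nil shadow.simps Un_empty_right face_sum_Un finite_line finite_deeper)
  qed
  moreover have "transport n a (BottomSink (n - a)) j = (0 :: 'k qtorus)" if "j < n - a"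
  proof -
    have "n - a - j \<noteq> 0" using that by simp
    then have "\<not> descent n (BottomSink (n - a)) a (j - 1) (n - a - j) P" for P
      using shape[of "j - 1" "n - a - j" P] by metis
    then have "{P. descent n (BottomSink (n - a)) a (j - 1) (n - a - j) P} = {}"
      by (simp only: Collect_empty_eq simp_thms)
    then show ?thesis by (simp only: transport_def sum.empty if_cancel)
  qed
  ultimately show "transport n a (BottomSink (n - a)) j
      = (if j = n - a then qZ (face_sum (line n a (n - a)) + face_sum (deeper n a)) else 0 :: 'k qtorus)"
    using assms by (cases "j < n - a"; cases "j = n - a") (simp_all add: transport_def Suc_le_eq)
qed

lemma transport_extend:
  assumes a: "a < n" and t: "is_sink t" "t \<noteq> LeftSink (a + 1)" "t \<noteq> BottomSink (n - a)"
  shows "transport n a t = torus.extend (\<lambda>j. qZ (face_sum (line n a j))) (transport n (a + 1) t :: nat \<Rightarrow> 'k::qfield qtorus)"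
proof
  fix j
  show "transport n a t j = torus.extend (\<lambda>j. qZ (face_sum (line n a j))) (transport n (a + 1) t :: nat \<Rightarrow> 'k qtorus) j"
  proof (cases "1 \<le> j \<and> a + j \<le> n")
    case False
    then show ?thesis by (auto simp: transport_def torus.extend_def)
  next
    case True
    then obtain b where b: "j = b + 1" by (cases j) auto
    define c where "c = n - a - j"
    have n: "n = a + b + c + 1" using True b by (simp add: c_def)
    define w where "w P = (qZ (face_sum (region n P)) :: 'k qtorus)" for P
    let ?X = "qZ (face_sum (line n a j)) :: 'k qtorus"
    define D where "D = {P. \<exists>b' Q. b = b' + 1 \<and> descent n t (a + 1) b' c Q \<and> P = White a b c # Black a b' c # Q}"
    define K where "K = {P. \<exists>c' Q. c = c' + 1 \<and> descent n t (a + 1) b c' Q \<and> P = White a b c # Black a b c' # Q}"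
    have split: "{P. descent n t a b c P} = D \<union> K"
    proof (intro equalityI subsetI)
      fix P assume "P \<in> {P. descent n t a b c P}"
      then have "descent n t a b c P" by simp
      then show "P \<in> D \<union> K" by cases (use t n in \<open>auto simp: D_def K_def\<close>)
    qed (auto simp: D_def K_def intro: descent.intros[simplified])
    have fin: "finite (D \<union> K)" unfolding split[symmetric] by (rule finite_descents[OF t(1)])
    have disj: "D \<inter> K = {}" by (auto simp: D_def K_def)
    have D: "sum w D = ?X * qscale (qpow (1 / 2)) (transport n (a + 1) t (j - 1))"
    proof (cases b)
      case 0
      then show ?thesis using b by (simp add: D_def transport_def)
    next
      case (Suc b')
      have D: "D = (\<lambda>Q. White a b c # Black a b' c # Q) ` {Q. descent n t (a + 1) b' c Q}"
        by (auto simp: D_def Suc)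
      have w: "w (White a b c # Black a b' c # Q) = ?X * qscale (qpow (1 / 2)) (w Q)"
        if Q: "descent n t (a + 1) b' c Q" for Q
      proof -
        have "skew (face_sum (line n a (b + 1))) (face_sum (region n Q)) = 1 / 2"
          using skew_line_region[OF Q, of "b + 1"] n Suc by simp
        then show ?thesis
          unfolding w_def face_sum_region_Cons[OF Q] qZ_add b by (simp only: torus.scale_mult_right)
      qed
      have "sum w D = (\<Sum>Q | descent n t (a + 1) b' c Q. ?X * qscale (qpow (1 / 2)) (w Q))"
        unfolding D by (subst sum.reindex) (auto simp: inj_on_def w intro!: sum.cong)
      moreover have "transport n (a + 1) t (j - 1) = (\<Sum>Q | descent n t (a + 1) b' c Q. w Q)"
        using n Suc b by (simp add: transport_def w_def)
      ultimately show ?thesis by (simp add: sum_distrib_left torus.scale_sum_right)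
    qed
    have K: "sum w K = ?X * qscale (qpow (- 1 / 2)) (transport n (a + 1) t j)"
    proof (cases c)
      case 0
      then show ?thesis using b n by (simp add: K_def transport_def)
    next
      case (Suc c')
      have K: "K = (\<lambda>Q. White a b c # Black a b c' # Q) ` {Q. descent n t (a + 1) b c' Q}"
        by (auto simp: K_def Suc)
      have w: "w (White a b c # Black a b c' # Q) = ?X * qscale (qpow (- 1 / 2)) (w Q)"
        if Q: "descent n t (a + 1) b c' Q" for Q
      proof -
        have "skew (face_sum (line n a (b + 1))) (face_sum (region n Q)) = - 1 / 2"
          using skew_line_region[OF Q, of "b + 1"] n Suc by simp
        then show ?thesis
          unfolding w_def face_sum_region_Cons[OF Q] qZ_add b by (simp only: torus.scale_mult_right)
      qed
      have "sum w K = (\<Sum>Q | descent n t (a + 1) b c' Q. ?X * qscale (qpow (- 1 / 2)) (w Q))"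
        unfolding K by (subst sum.reindex) (auto simp: inj_on_def w intro!: sum.cong)
      moreover have "transport n (a + 1) t j = (\<Sum>Q | descent n t (a + 1) b c' Q. w Q)"
        using n Suc b by (simp add: transport_def w_def)
      ultimately show ?thesis by (simp add: sum_distrib_left torus.scale_sum_right)
    qed
    have "transport n a t j = sum w {P. descent n t a b c P}"
      using True b by (simp add: transport_def w_def c_def)
    also have "\<dots> = sum w D + sum w K"
      unfolding split using fin disj by (simp add: sum.union_disjoint)
    finally show ?thesis
      unfolding D K by (simp add: torus.extend_def distrib_left)
  qed
qed

lemma transport_extendable:
  assumes a: "a < n"
  shows "torus.extendable (n - a) (\<lambda>j. qZ (face_sum (line n a j))) (transport n (a + 1) t :: nat \<Rightarrow> 'k::qfield qtorus)"
  unfolding torus.extendable_def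
proof (intro conjI allI impI)
  fix j k assume j: "1 \<le> j \<and> j \<le> n - a"
  show "transport n (a + 1) t k * qZ (face_sum (line n a j))
      = qscale (qpow (torus.shift_exp k j)) (qZ (face_sum (line n a j)) * (transport n (a + 1) t k :: 'k qtorus))"
  proof -
    have "skew (face_sum (line n a j)) (face_sum (region n P)) = (if j \<le> k then - 1 / 2 else 1 / 2)"
      if "1 \<le> k" "a + 1 + k \<le> n" "descent n t (a + 1) (k - 1) (n - (a + 1) - k) P" for P
      using skew_line_region[OF that(3), of j] that j by simp
    then have "transport n (a + 1) t k * qZ (face_sum (line n a j)) = qscale (qpow (2 * (if j \<le> k then - 1 / 2 else 1 / 2)))
        (qZ (face_sum (line n a j)) * (transport n (a + 1) t k :: 'k qtorus))"
      by (rule transport_swap(2))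
    then show ?thesis
      by (simp add: torus.shift_exp_def split: if_splits)
  qed
qed (auto simp: transport_def)

text \<open>
  The sinks numbered along the boundary: down the left side from the top to the corner \<open>(n, 0, 0)\<close>, then
  along the bottom. From level \<open>a\<close> exactly the sinks \<open>a + 1, \<dots>, 2 n - a\<close> can be reached.
\<close>

definition exit_vertex :: "nat \<Rightarrow> nat \<Rightarrow> vertex" where
  "exit_vertex n r = (if r \<le> n then LeftSink r else BottomSink (r - n))"

lemma is_sink_exit [simp]: "is_sink (exit_vertex n r)"
  by (simp add: exit_vertex_def)

lemma row_exchange_left:
  assumes a: "a < n" and t: "t \<noteq> LeftSink (a + 1)"
  shows "torus.row_exchange (2 - arrow_weight a) (transport n a (LeftSink (a + 1))) (transport n a t :: nat \<Rightarrow> 'k::qfield qtorus)"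
  unfolding transport_left[OF a]
proof (rule torus.row_exchange_first)
  have skew: "skew (face_sum (line n a 1)) (face_sum (region n P)) = (if l = 1 then - 1 / 2 else arrow_weight a / 2 - 1 / 2)"
    if "1 \<le> l" "a + l \<le> n" "descent n t a (l - 1) (n - a - l) P" for P l
    using skew_first_region[OF that(3) t] that by auto
  have swap: "qZ (face_sum (line n a 1)) * transport n a t l
      = qscale (qpow (- 2 * (if l = 1 then - 1 / 2 else arrow_weight a / 2 - 1 / 2)))
        (transport n a t l * (qZ (face_sum (line n a 1)) :: 'k qtorus))" for l
    by (rule transport_swap(1)) (rule skew)
  show "qZ (face_sum (line n a 1)) * transport n a t 1 = qscale (qpow 1) (transport n a t 1 * (qZ (face_sum (line n a 1)) :: 'k qtorus))"
    using swap[of 1] by simp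
  show "qZ (face_sum (line n a 1)) * transport n a t l
      = qscale (qpow (2 - arrow_weight a - 1)) (transport n a t l * (qZ (face_sum (line n a 1)) :: 'k qtorus))" if "1 < l" for l
    using swap[of l] that by (simp add: algebra_simps)
qed (simp add: transport_def)

lemma row_exchange_bottom:
  assumes a: "a < n" and t: "t \<noteq> BottomSink (n - a)"
  shows "torus.row_exchange (2 - arrow_weight a) (transport n a t) (transport n a (BottomSink (n - a)) :: nat \<Rightarrow> 'k::qfield qtorus)"
  unfolding transport_bottom[OF a]
proof (rule torus.row_exchange_last)
  let ?\<beta> = "face_sum (line n a (n - a)) + face_sum (deeper n a)"
  have skew: "skew ?\<beta> (face_sum (region n P)) = (if j = n - a then 1 / 2 else 1 / 2 - arrow_weight a / 2)"
    if "1 \<le> j" "a + j \<le> n" "descent n t a (j - 1) (n - a - j) P" for P j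
    using skew_last_region[OF that(3) t] that by auto
  have swap: "transport n a t j * qZ ?\<beta>
      = qscale (qpow (2 * (if j = n - a then 1 / 2 else 1 / 2 - arrow_weight a / 2)))
        (qZ ?\<beta> * (transport n a t j :: 'k qtorus))" for j
    by (rule transport_swap(2)) (rule skew)
  show "transport n a t (n - a) * qZ ?\<beta> = qscale (qpow 1) (qZ ?\<beta> * (transport n a t (n - a) :: 'k qtorus))"
    using swap[of "n - a"] by simp
  show "transport n a t j * qZ ?\<beta> = qscale (qpow (2 - arrow_weight a - 1)) (qZ ?\<beta> * (transport n a t j :: 'k qtorus))"
    if "j < n - a" for j
    using swap[of j] that by (simp add: algebra_simps)
qed (auto simp: transport_def)

text \<open>
  Passing from level \<open>a + 1\<close> to level \<open>a\<close> extends the old rows and adds one new row at each end of the range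
  of sinks. The exponent \<open>2 - arrow_weight a\<close> is \<open>1\<close> on the right side of the triangle, where \<open>a = 0\<close>, and \<open>0\<close>
  on all other lines.
\<close>

theorem transport_rows:
  assumes "a \<le> n"
  shows "\<lbrakk>a < r; r < s; s \<le> 2 * n - a\<rbrakk> \<Longrightarrow> torus.row_exchange (2 - arrow_weight a)
       (transport n a (exit_vertex n r)) (transport n a (exit_vertex n s) :: nat \<Rightarrow> 'k::qfield qtorus)"
    and "\<lbrakk>a < r; r \<le> 2 * n - a\<rbrakk> \<Longrightarrow> torus.row_self (2 - arrow_weight a)
       (transport n a (exit_vertex n r) :: nat \<Rightarrow> 'k qtorus)"
proof -
  let ?row = "\<lambda>a r. transport n a (exit_vertex n r) :: nat \<Rightarrow> 'k qtorus"
  have "(\<forall>r s. a < r \<and> r < s \<and> s \<le> 2 * n - a \<longrightarrow> torus.row_exchange (2 - arrow_weight a) (?row a r) (?row a s)) \<and>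
    (\<forall>r. a < r \<and> r \<le> 2 * n - a \<longrightarrow> torus.row_self (2 - arrow_weight a) (?row a r))"
    using assms
  proof (induction a rule: inc_induct)
    case base
    then show ?case by auto
  next
    case (step a)
    then have a: "a < n" by simp
    have first: "exit_vertex n (a + 1) = LeftSink (a + 1)" and last: "exit_vertex n (2 * n - a) = BottomSink (n - a)"
      using a by (auto simp: exit_vertex_def)
    have not_first: "exit_vertex n r \<noteq> LeftSink (a + 1)" if "r \<noteq> a + 1" for r
      using that by (auto simp: exit_vertex_def)
    have not_last: "exit_vertex n r \<noteq> BottomSink (n - a)" if "r \<noteq> 2 * n - a" for r
      using that a by (auto simp: exit_vertex_def)
    have weight: "2 - arrow_weight (Suc a) = 0" by (simp add: arrow_weight_def)
    have X: "qZ (face_sum (line n a l)) * qZ (face_sum (line n a j))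
        = qscale (qpow (2 - (2 - arrow_weight a))) (qZ (face_sum (line n a j)) * (qZ (face_sum (line n a l)) :: 'k qtorus))"
      if "1 \<le> j" "j < l" "l \<le> n - a" for j l
      using qZ_swap[of "face_sum (line n a l)" "face_sum (line n a j)", where ?'k = 'k] skew_same_line[of j l n a]
        skew_antisym[of "face_sum (line n a l)"] that a by simp
    have old: "?row a r = torus.extend (\<lambda>j. qZ (face_sum (line n a j))) (?row (a + 1) r)"
      if "r \<noteq> a + 1" "r \<noteq> 2 * n - a" for r
      using that not_first not_last by (intro transport_extend[OF a]) auto
    note extendable = transport_extendable[OF a, where ?'k = 'k]
    show ?case
    proof (intro conjI allI impI)
      fix r s assume rs: "a < r \<and> r < s \<and> s \<le> 2 * n - a"
      consider "r = a + 1" | "s = 2 * n - a" | "a + 1 < r" "s < 2 * n - a" using rs by linarith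
      then show "torus.row_exchange (2 - arrow_weight a) (?row a r) (?row a s)"
      proof cases
        case 1
        then show ?thesis using row_exchange_left[OF a not_first[of s]] rs first by simp
      next
        case 2
        then show ?thesis using row_exchange_bottom[OF a not_last[of r]] rs last by simp
      next
        case 3
        then have "torus.row_exchange 0 (?row (a + 1) r) (?row (a + 1) s)"
          using step.IH rs weight by simp
        then show ?thesis
          using 3 rs old[of r] old[of s] torus.row_exchange_extend[OF X extendable extendable] by simp
      qed
    next
      fix r assume r: "a < r \<and> r \<le> 2 * n - a"
      consider "r = a + 1" | "r = 2 * n - a" | "a + 1 < r" "r < 2 * n - a" using r by linarith
      then show "torus.row_self (2 - arrow_weight a) (?row a r)"
      proof cases
        case 1
        show ?thesis unfolding 1 first transport_left[OF a] by (rule torus.row_self_single)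
      next
        case 2
        show ?thesis unfolding 2 last transport_bottom[OF a] by (rule torus.row_self_single)
      next
        case 3
        then have "torus.row_self 0 (?row (a + 1) r)"
          using step.IH r weight by simp
        then show ?thesis
          using 3 r old[of r] torus.row_self_extend[OF X extendable] by simp
      qed
    qed
  qed
  then show "\<lbrakk>a < r; r < s; s \<le> 2 * n - a\<rbrakk> \<Longrightarrow> torus.row_exchange (2 - arrow_weight a) (?row a r) (?row a s)"
    and "\<lbrakk>a < r; r \<le> 2 * n - a\<rbrakk> \<Longrightarrow> torus.row_self (2 - arrow_weight a) (?row a r)"
    by blast+
qed


section \<open>The quantum transport matrices\<close>

lemma transport_paths:
  assumes j: "j \<in> {1..n}" and t: "is_sink t"
  shows "(\<Sum>P\<in>paths n (Source j) t. path_weight n P) = (transport n 0 t j :: 'k::qfield qtorus)"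
proof -
  have "(\<Sum>P\<in>paths n (Source j) t. path_weight n P)
      = (\<Sum>Q | descent n t 0 (j - 1) (n - j) Q. path_weight n (Source j # Q) :: 'k qtorus)"
    unfolding paths_Source[OF j t] by (subst sum.reindex) (simp_all add: inj_on_def)
  also have "\<dots> = (\<Sum>Q | descent n t 0 (j - 1) (n - j) Q. qZ (face_sum (region n Q)))"
    by (rule sum.cong) (use path_weight_region[OF j] in auto)
  finally show ?thesis using j by (simp add: transport_def)
qed

lemma calM1_transport: "j \<in> {1..n} \<Longrightarrow> calM1 n i j = (transport n 0 (LeftSink i) j :: 'k::qfield qtorus)"
  and calM2_transport: "j \<in> {1..n} \<Longrightarrow> calM2 n i j = (transport n 0 (BottomSink i) j :: 'k::qfield qtorus)"
  by (simp_all add: calM1_def calM2_def transport_paths del: One_nat_def)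

lemma region_corner: "descent n t a b c P \<Longrightarrow> (n, 0, 0) \<in> region n P \<longleftrightarrow> (\<exists>i. t = BottomSink i)"
proof (induction rule: descent.induct)
  case (down a b c Q)
  then show ?case using descent_sum[OF down.hyps] by (auto simp: mem_line)
next
  case (keep a b c Q)
  then show ?case using descent_sum[OF keep.hyps] by (auto simp: mem_line)
qed (auto simp: mem_line mem_deeper)

lemma keys_region: "descent n t a b c P \<Longrightarrow> Poly_Mapping.keys (face_sum (region n P)) \<subseteq> faces n"
  using region_level(1) by (fastforce simp: keys_face_sum faces_def)

lemma skew_minus_left: "skew (- \<kappa>) \<mu> = - skew \<kappa> \<mu>"
  using skew_antisym[of "- \<kappa>" \<mu>] skew_antisym[of \<kappa> \<mu>] by (simp add: skew_minus_right)

text \<open>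
  Of the three corners, \<open>(0, 0, n)\<close> lies to the right of every path, \<open>(0, n, 0)\<close> of none, and \<open>(n, 0, 0)\<close> of
  exactly those ending at the bottom.
\<close>

lemma skew_d1_region:
  assumes P: "descent n t 0 b c P"
  shows "skew (d1 n) (face_sum (region n P)) = (if \<exists>i. t = BottomSink i then - 1 / (2 * of_nat n) else 0)"
proof -
  have "b + c + 1 = n" using descent_sum[OF P] by simp
  then have "n > 0" "(0, n, 0) \<notin> region n P" using region_level(2)[OF P, of n 0] by auto
  then show ?thesis
    using region_corner[OF P] by (simp add: skew_d1[OF keys_region[OF P]] lookup_face_sum)
qed

lemma skew_d2_region:
  assumes P: "descent n t 0 b c P"
  shows "skew (d2 n) (face_sum (region n P)) = 1 / (2 * of_nat n)"
proof -
  have "b + c + 1 = n" using descent_sum[OF P] by simp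
  then have "n > 0" "(0, n, 0) \<notin> region n P" "(0, 0, n) \<in> region n P"
    using region_level(2)[OF P, of n 0] region_level(2)[OF P, of 0 n] by auto
  then show ?thesis
    by (simp add: skew_d2[OF keys_region[OF P]] lookup_face_sum)
qed

lemma skew_d1_d2: "n > 0 \<Longrightarrow> skew (d1 n) (d2 n) = - 1 / (2 * of_nat n)"
proof -
  assume n: "n > 0"
  have "Poly_Mapping.keys (d2 n) \<subseteq> faces n"
  proof
    fix \<beta> assume "\<beta> \<in> Poly_Mapping.keys (d2 n)"
    then show "\<beta> \<in> faces n"
      by (cases \<beta>) (auto simp: in_keys_iff lookup_d2 faces_def split: if_splits)
  qed
  with n show ?thesis by (simp add: skew_d1 lookup_d2)
qed

lemma D1_eq: "D1 n = (qZ (d1 n) :: 'k::qfield qtorus)" and D2_eq: "D2 n = (qZ (d2 n) :: 'k qtorus)"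
  unfolding D1_def D2_def weyl_def d1_def d2_def by (rule refl)+

definition D1_inv :: "nat \<Rightarrow> 'k::qfield qtorus" where "D1_inv n = qZ (- d1 n)"
definition D2_inv :: "nat \<Rightarrow> 'k::qfield qtorus" where "D2_inv n = qZ (- d2 n)"

lemma D1_inv_left: "D1_inv n * transport n 0 (LeftSink i) j = transport n 0 (LeftSink i) j * (D1_inv n :: 'k::qfield qtorus)"
proof -
  have "D1_inv n * transport n 0 (LeftSink i) j
      = qscale (qpow (- 2 * - 0)) (transport n 0 (LeftSink i) j * (D1_inv n :: 'k qtorus))"
    unfolding D1_inv_def
    by (rule transport_swap(1)) (simp only: skew_minus_left skew_d1_region vertex.distinct simp_thms if_False)
  then show ?thesis by (simp add: qpow_0)
qed

lemma D1_inv_bottom: "D1_inv n * transport n 0 (BottomSink i) j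
    = qscale (qpow (- 1 / of_nat n)) (transport n 0 (BottomSink i) j * (D1_inv n :: 'k::qfield qtorus))"
proof -
  have "D1_inv n * transport n 0 (BottomSink i) j
      = qscale (qpow (- 2 * - (- 1 / (2 * of_nat n)))) (transport n 0 (BottomSink i) j * (D1_inv n :: 'k qtorus))"
    unfolding D1_inv_def
    by (rule transport_swap(1)) (simp only: skew_minus_left skew_d1_region vertex.inject simp_thms if_True)
  then show ?thesis by simp
qed

lemma D2_inv_transport: "D2_inv n * transport n 0 t j
    = qscale (qpow (1 / of_nat n)) (transport n 0 t j * (D2_inv n :: 'k::qfield qtorus))"
proof -
  have "D2_inv n * transport n 0 t j
      = qscale (qpow (- 2 * - (1 / (2 * of_nat n)))) (transport n 0 t j * (D2_inv n :: 'k qtorus))"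
    unfolding D2_inv_def
    by (rule transport_swap(1)) (simp only: skew_minus_left skew_d2_region)
  then show ?thesis by simp
qed

lemma D1_inv_D2_inv: "n > 0 \<Longrightarrow> D1_inv n * D2_inv n = qscale (qpow (1 / of_nat n)) (D2_inv n * D1_inv n :: 'k::qfield qtorus)"
  unfolding D1_inv_def D2_inv_def
  by (subst qZ_swap) (simp add: skew_minus_left skew_minus_right skew_d1_d2)

text \<open>
  The coefficient by which \<open>Q S\<close> multiplies a row, apart from reversing the order of the rows.
\<close>

definition row_coeff :: "nat \<Rightarrow> nat \<Rightarrow> 'k::qfield" where
  "row_coeff n i = qpow (of_nat i - 1 / 2) * (- 1) ^ (n - i)"

lemma QS_mult:
  assumes "i \<in> {1..n}"
  shows "(scalar_mat qscale Q_mat \<odot>\<^bsub>{1..n}\<^esub> S_mat n \<odot>\<^bsub>{1..n}\<^esub> B) i j = qscale (row_coeff n i) (B (n + 1 - i) j :: 'k::qfield qtorus)"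
proof -
  have rev: "n + 1 - i \<in> {1..n}" using assms by auto
  have S: "(S_mat n \<odot>\<^bsub>{1..n}\<^esub> B) k j = (- 1) ^ (n - k) * B (n + 1 - k) j" if "k \<in> {1..n}" for k
    using that by (auto simp: mmul_def S_mat_def if_distribs)
  have "(scalar_mat qscale Q_mat \<odot>\<^bsub>{1..n}\<^esub> (S_mat n \<odot>\<^bsub>{1..n}\<^esub> B)) i j
      = (\<Sum>k=1..n. if k = i then qscale (qpow (of_nat i - 1 / 2)) ((S_mat n \<odot>\<^bsub>{1..n}\<^esub> B) i j) else 0)"
    unfolding mmul_def[of "scalar_mat qscale Q_mat"]
    by (intro sum.cong) (auto simp: scalar_mat_def Q_mat_def torus.scale_mult_left)
  also have "\<dots> = qscale (qpow (of_nat i - 1 / 2)) ((- 1) ^ (n - i) * B (n + 1 - i) j)"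
    using assms S[OF assms] by simp
  also have "\<dots> = qscale (row_coeff n i) (B (n + 1 - i) j)"
    by (cases "even (n - i)") (simp_all add: row_coeff_def torus.scale_minus_left torus.scale_minus_right)
  finally show ?thesis by (simp only: mmul_assoc)
qed

text \<open>
  In \<open>A = M1\<^sup>T M2\<close> the rows of both matrices are reversed and multiplied by \<open>row_coeff\<close>. The reversal does
  not affect the product, and both coefficients are attributed to the second factor.
\<close>

definition left_matrix :: "nat \<Rightarrow> nat \<Rightarrow> nat \<Rightarrow> 'k::qfield qtorus" where
  "left_matrix n i j = transport n 0 (LeftSink i) j * D1_inv n"

definition bottom_matrix :: "nat \<Rightarrow> nat \<Rightarrow> nat \<Rightarrow> 'k::qfield qtorus" where
  "bottom_matrix n i j = qscale (row_coeff n (n + 1 - i) ^ 2) (transport n 0 (BottomSink i) j * (D1_inv n * D2_inv n))"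

lemma A_mat_eq:
  assumes ij: "i \<in> {1..n}" "j \<in> {1..n}"
  shows "A_mat n i j = (trans_mat (left_matrix n) \<odot>\<^bsub>{1..n}\<^esub> bottom_matrix n) i j"
proof -
  have M1: "M1 n k i = qscale (row_coeff n k) (transport n 0 (LeftSink (n + 1 - k)) i * D1_inv n :: 'a qtorus)"
    and M2: "M2 n k j = qscale (row_coeff n k) (transport n 0 (BottomSink (n + 1 - k)) j * (D1_inv n * D2_inv n) :: 'a qtorus)"
    if "k \<in> {1..n}" for k
    unfolding M1_def M2_def QS_mult[OF that] calM1_transport[OF ij(1)] calM2_transport[OF ij(2)] D1_eq D2_eq minv_qZ
    by (simp_all add: D1_inv_def D2_inv_def torus.scale_mult_left mult.assoc)
  have "A_mat n i j = (\<Sum>k=1..n. M1 n k i * M2 n k j :: 'a qtorus)"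
    by (simp add: A_mat_def mmul_def trans_mat_def)
  also have "\<dots> = (\<Sum>k=1..n. left_matrix n (n + 1 - k) i * bottom_matrix n (n + 1 - k) j)"
  proof (rule sum.cong[OF refl])
    fix k assume k: "k \<in> {1..n}"
    then have "n + 1 - (n + 1 - k) = k" by auto
    then show "M1 n k i * M2 n k j = (left_matrix n (n + 1 - k) i * bottom_matrix n (n + 1 - k) j :: 'a qtorus)"
      unfolding M1[OF k] M2[OF k] left_matrix_def bottom_matrix_def
      by (simp add: torus.scale_mult_left torus.scale_mult_right power2_eq_square)
  qed
  also have "\<dots> = (\<Sum>k=1..n. left_matrix n k i * bottom_matrix n k j)"
    by (subst (2) sum.atLeastAtMost_rev) simp
  finally show ?thesis by (simp add: mmul_def trans_mat_def)
qed

lemma transport_rows_0: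
  assumes "0 < r" "r < s" "s \<le> 2 * n"
  shows "torus.row_exchange 1 (transport n 0 (exit_vertex n r)) (transport n 0 (exit_vertex n s) :: nat \<Rightarrow> 'k::qfield qtorus)"
    and "torus.row_self 1 (transport n 0 (exit_vertex n r) :: nat \<Rightarrow> 'k qtorus)"
  using transport_rows(1)[of 0 n r s, where ?'k = 'k] transport_rows(2)[of 0 n r, where ?'k = 'k] assms
  by (simp_all add: arrow_weight_def)

lemma RTT_left: "RTT n (torus.R n) (left_matrix n :: nat \<Rightarrow> nat \<Rightarrow> 'k::qfield qtorus)"
proof -
  have "RTT n (torus.R n) (\<lambda>i j. qscale ((\<lambda>_. 1) i) (transport n 0 (LeftSink i) j * D1_inv n :: 'k qtorus))"
  proof (rule torus.RTT_scale)
    fix i assume i: "i \<in> {1..n}"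
    show "torus.row_self 1 (transport n 0 (LeftSink i) :: nat \<Rightarrow> 'k qtorus)"
      using transport_rows_0(2)[of i "2 * n" n, where ?'k = 'k] i by (simp add: exit_vertex_def)
    fix k assume "k \<in> {1..n}" "i < k"
    then show "torus.row_exchange 1 (transport n 0 (LeftSink i)) (transport n 0 (LeftSink k) :: nat \<Rightarrow> 'k qtorus)"
      using transport_rows_0(1)[of i k n, where ?'k = 'k] i by (simp add: exit_vertex_def)
  qed (rule D1_inv_left)
  then show ?thesis by (simp add: left_matrix_def[abs_def])
qed

lemma D_inv_bottom: "D1_inv n * D2_inv n * transport n 0 (BottomSink i) j
    = transport n 0 (BottomSink i) j * (D1_inv n * D2_inv n :: 'k::qfield qtorus)"
proof -
  have "D1_inv n * D2_inv n * transport n 0 (BottomSink i) j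
      = D1_inv n * (D2_inv n * transport n 0 (BottomSink i) j :: 'k qtorus)"
    by (simp add: mult.assoc)
  also have "\<dots> = qscale (qpow (1 / of_nat n)) (D1_inv n * transport n 0 (BottomSink i) j * D2_inv n)"
    by (simp add: D2_inv_transport torus.scale_mult_right mult.assoc)
  also have "\<dots> = transport n 0 (BottomSink i) j * (D1_inv n * D2_inv n)"
    by (simp add: D1_inv_bottom torus.scale_mult_left mult.assoc qpow_0 flip: qpow_add)
  finally show ?thesis .
qed

lemma D_inv_left: "D1_inv n * D2_inv n * transport n 0 (LeftSink i) j
    = qscale (qpow (1 / of_nat n)) (transport n 0 (LeftSink i) j * (D1_inv n * D2_inv n :: 'k::qfield qtorus))"
proof -
  have "D1_inv n * D2_inv n * transport n 0 (LeftSink i) j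
      = D1_inv n * (D2_inv n * transport n 0 (LeftSink i) j :: 'k qtorus)"
    by (simp add: mult.assoc)
  also have "\<dots> = qscale (qpow (1 / of_nat n)) (D1_inv n * transport n 0 (LeftSink i) j * D2_inv n)"
    by (simp add: D2_inv_transport torus.scale_mult_right mult.assoc)
  finally show ?thesis by (simp add: D1_inv_left mult.assoc)
qed

lemma RTT_bottom: "RTT n (torus.R n) (bottom_matrix n :: nat \<Rightarrow> nat \<Rightarrow> 'k::qfield qtorus)"
  unfolding bottom_matrix_def[abs_def]
proof (rule torus.RTT_scale)
  fix i assume i: "i \<in> {1..n}"
  show "torus.row_self 1 (transport n 0 (BottomSink i) :: nat \<Rightarrow> 'k qtorus)"
    using transport_rows(2)[of 0 n "n + i", where ?'k = 'k] i by (simp add: exit_vertex_def arrow_weight_def)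
  fix k assume "k \<in> {1..n}" "i < k"
  then show "torus.row_exchange 1 (transport n 0 (BottomSink i)) (transport n 0 (BottomSink k) :: nat \<Rightarrow> 'k qtorus)"
    using transport_rows_0(1)[of "n + i" "n + k" n, where ?'k = 'k] i by (simp add: exit_vertex_def)
qed (rule D_inv_bottom)

text \<open>
  The rows of left sinks precede those of bottom sinks, hence \<open>row_exchange\<close> gives the relation up to a
  power of \<open>q\<close>. Moving \<open>D1\<^sup>-\<^sup>1\<close> and \<open>D1\<^sup>-\<^sup>1 D2\<^sup>-\<^sup>1\<close> past the path weights and past each other contributes
  \<open>q\<^sup>-\<^sup>1\<^sup>/\<^sup>n\<close>, the normalization of \<open>R\<close>.
\<close>

lemma exchange_left_bottom:
  "mat_eq (pairs n) (tensor12 (left_matrix n) (bottom_matrix n))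
     (tensor21 (bottom_matrix n) (left_matrix n) \<odot>\<^bsub>pairs n\<^esub> torus.R n :: _ \<Rightarrow> _ \<Rightarrow> 'k::qfield qtorus)"
proof (rule mat_eq_pairsI)
  fix i k j l assume ix: "i \<in> {1..n}" "k \<in> {1..n}" "j \<in> {1..n}" "l \<in> {1..n}"
  define g where "g = (row_coeff n (n + 1 - k) ^ 2 :: 'k)"
  define v where "v = (transport n 0 (LeftSink i) :: nat \<Rightarrow> 'k qtorus)"
  define w where "w = (transport n 0 (BottomSink k) :: nat \<Rightarrow> 'k qtorus)"
  define C where "C = (D1_inv n :: 'k qtorus)"
  define C' where "C' = (D1_inv n * D2_inv n :: 'k qtorus)"
  have n: "n > 0" using ix by auto
  have CC': "C * C' = qscale (qpow (1 / of_nat n)) (C' * C)"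
    unfolding C_def C'_def mult.assoc
    by (subst D1_inv_D2_inv[OF n]) (rule torus.scale_mult_right)
  have Cw: "C * w l = qscale (qpow (- 1 / of_nat n)) (w l * C)" for l
    unfolding C_def w_def by (rule D1_inv_bottom)
  have C'v: "C' * v j = qscale (qpow (1 / of_nat n)) (v j * C')" for j
    unfolding C'_def v_def by (rule D_inv_left)
  have left: "left_matrix n i j = v j * C" and bottom: "bottom_matrix n k l = qscale g (w l * C')" for j l
    by (simp_all only: left_matrix_def bottom_matrix_def v_def w_def C_def C'_def g_def)
  note products = torus.row_scale[of C C' "1 / of_nat n" w "- 1 / of_nat n" v "1 / of_nat n", OF CC' Cw C'v]
  have "torus.row_exchange 1 v w"
    using transport_rows_0(1)[of i "n + k" n, where ?'k = 'k] ix by (simp add: exit_vertex_def v_def w_def)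
  then have vw: "v j * w l = qscale (if j = l then qpow 1 else 1) (w l * v j)
      + qscale (if j < l then torus.\<Lambda> else 0) (w j * v l)"
    by (cases j l rule: linorder_cases) (auto simp: torus.row_exchange_def qpow_0)
  have "tensor12 (left_matrix n) (bottom_matrix n) (i, k) (j, l)
      = qscale (g * qpow (- 1 / of_nat n)) (v j * w l * (C * C'))"
    unfolding tensor12_def prod.case left bottom torus.scale_mult_right products(1) torus.scale_scale ..
  also have "\<dots> = qscale (qpow (- 1 / of_nat n))
      (qscale (if j = l then qpow 1 else 1) (qscale g (w l * v j * (C * C')))
       + qscale (if j < l then torus.\<Lambda> else 0) (qscale g (w j * v l * (C * C'))))"
    unfolding vw distrib_right torus.scale_mult_left torus.scale_scale torus.scale_right_distrib
    by (simp only: ac_simps)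
  also have "\<dots> = (tensor21 (bottom_matrix n) (left_matrix n) \<odot>\<^bsub>pairs n\<^esub> torus.R n) (i, k) (j, l)"
  proof -
    have "tensor21 (bottom_matrix n) (left_matrix n) (i, k) (j', l') = qscale g (w l' * v j' * (C * C'))" for j' l'
      unfolding tensor21_def prod.case left bottom torus.scale_mult_left products(2) by (simp add: qpow_0)
    then show ?thesis unfolding torus.R_mult_right[OF ix(3,4)] by simp
  qed
  finally show "tensor12 (left_matrix n) (bottom_matrix n) (i, k) (j, l)
    = ((tensor21 (bottom_matrix n) (left_matrix n) \<odot>\<^bsub>pairs n\<^esub> torus.R n) (i, k) (j, l) :: 'k qtorus)" .
qed

lemma reflection_cong:
  assumes "\<And>i j. \<lbrakk>i \<in> {1..n}; j \<in> {1..n}\<rbrakk> \<Longrightarrow> A i j = B i j"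
  shows "reflection n R A \<longleftrightarrow> reflection n R B"
proof -
  have "cut (pairs n) (in_first A) = cut (pairs n) (in_first B)"
    "cut (pairs n) (in_second A) = cut (pairs n) (in_second B)"
    using assms by (auto simp: cut_def in_first_def in_second_def tensor12_def pairs_def fun_eq_iff)
  then show ?thesis
    by (simp add: reflection_def mat_eq_iff_cut cut_mmul)
qed

theorem A_mat_reflection: "reflection n (torus.R n) (A_mat n :: nat \<Rightarrow> nat \<Rightarrow> 'k::qfield qtorus)"
proof -
  have "reflection n (torus.R n) (A_mat n :: nat \<Rightarrow> nat \<Rightarrow> 'k qtorus)
      \<longleftrightarrow> reflection n (torus.R n) (trans_mat (left_matrix n) \<odot>\<^bsub>{1..n}\<^esub> bottom_matrix n :: _ \<Rightarrow> _ \<Rightarrow> 'k qtorus)"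
    by (rule reflection_cong) (rule A_mat_eq)
  then show ?thesis
    using exchange_matrix.reflection_product[OF torus.exchange_matrix_R RTT_left RTT_bottom exchange_left_bottom]
    by blast
qed


section \<open>The reflection equation for the conjugated matrix\<close>

text \<open>
  All entries of the products in the reflection equation lie in the subalgebra generated by the entries of
  \<open>A\<close>, the only place where \<open>\<phi>\<close> is known to be a homomorphism.
\<close>

lemma reflection_embedding:
  fixes scale :: "'k::qfield \<Rightarrow> 'b::ring_1 \<Rightarrow> 'b" and A :: "nat \<Rightarrow> nat \<Rightarrow> 'k qtorus"
  assumes alg: "assoc_algebra scale"
    and emb: "algebra_embedding qscale scale
                (subalgebra_generated qscale {A i j |i j. i \<in> {1..n} \<and> j \<in> {1..n}}) \<phi>"
    and refl: "reflection n (scalar_mat qscale r) A"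
  shows "reflection n (scalar_mat scale r) (\<lambda>i j. \<phi> (A i j))"
proof -
  interpret assoc_algebra scale by (rule alg)
  define U where "U = subalgebra_generated qscale {A i j |i j. i \<in> {1..n} \<and> j \<in> {1..n}}"
  have \<phi>1: "\<phi> 1 = 1" and \<phi>_add: "\<lbrakk>x \<in> U; y \<in> U\<rbrakk> \<Longrightarrow> \<phi> (x + y) = \<phi> x + \<phi> y"
    and \<phi>_mult: "\<lbrakk>x \<in> U; y \<in> U\<rbrakk> \<Longrightarrow> \<phi> (x * y) = \<phi> x * \<phi> y"
    and \<phi>_scale: "x \<in> U \<Longrightarrow> \<phi> (qscale c x) = scale c (\<phi> x)" for x y c
    using emb by (auto simp: algebra_embedding_def U_def)
  have U1: "1 \<in> U" and U_scale: "x \<in> U \<Longrightarrow> qscale c x \<in> U" and U_add: "\<lbrakk>x \<in> U; y \<in> U\<rbrakk> \<Longrightarrow> x + y \<in> U"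
    and U_mult: "\<lbrakk>x \<in> U; y \<in> U\<rbrakk> \<Longrightarrow> x * y \<in> U" for x y c
    by (auto simp: U_def intro: subalgebra_generated.intros)
  have U0: "0 \<in> U" and \<phi>0: "\<phi> 0 = 0"
    using U_scale[OF U1, of 0] \<phi>_scale[OF U1, of 0] by auto
  have sum: "(\<Sum>x\<in>X. f x) \<in> U \<and> \<phi> (\<Sum>x\<in>X. f x) = (\<Sum>x\<in>X. \<phi> (f x))"
    if "\<And>x. x \<in> X \<Longrightarrow> f x \<in> U" for X :: "(nat \<times> nat) set" and f
    using that by (induction X rule: infinite_finite_induct) (auto simp: U0 \<phi>0 U_add \<phi>_add)
  define good where "good P \<longleftrightarrow> (\<forall>x\<in>pairs n. \<forall>y\<in>pairs n. P x y \<in> U)" for P :: "nat \<times> nat \<Rightarrow> nat \<times> nat \<Rightarrow> 'k qtorus"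
  define image where "image P = cut (pairs n) (\<lambda>x y. \<phi> (P x y))" for P :: "nat \<times> nat \<Rightarrow> nat \<times> nat \<Rightarrow> 'k qtorus"
  have good_mmul: "good (P \<odot>\<^bsub>pairs n\<^esub> P')" and image_mmul: "image (P \<odot>\<^bsub>pairs n\<^esub> P') = image P \<odot>\<^bsub>pairs n\<^esub> image P'"
    if "good P" "good P'" for P P'
  proof -
    show "good (P \<odot>\<^bsub>pairs n\<^esub> P')"
      using that sum[of "pairs n" "\<lambda>z. P x z * P' z y" for x y] by (simp add: good_def mmul_def U_mult)
    have "\<phi> (\<Sum>z\<in>pairs n. P x z * P' z y) = (\<Sum>z\<in>pairs n. \<phi> (P x z) * \<phi> (P' z y))"
      if "x \<in> pairs n" "y \<in> pairs n" for x y
      using that \<open>good P\<close> \<open>good P'\<close> sum[of "pairs n" "\<lambda>z. P x z * P' z y"]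
      by (simp add: good_def U_mult \<phi>_mult)
    then show "image (P \<odot>\<^bsub>pairs n\<^esub> P') = image P \<odot>\<^bsub>pairs n\<^esub> image P'"
      by (auto simp: image_def cut_def mmul_def fun_eq_iff)
  qed
  let ?r = "scalar_mat qscale r" and ?r' = "scalar_mat scale r" and ?B = "\<lambda>i j. \<phi> (A i j)"
  have A: "A i j \<in> U" if "i \<in> {1..n}" "j \<in> {1..n}" for i j
    unfolding U_def using that by (intro subalgebra_generated.gen) blast
  have r: "?r x y \<in> U" "\<phi> (?r x y) = ?r' x y" for x y
    by (simp_all add: scalar_mat_def U1 U_scale \<phi>_scale \<phi>1)
  have good: "good ?r" "good (trans1 ?r)" "good (in_first A)" "good (in_second A)"
    using A r by (auto simp: good_def trans1_def in_first_def in_second_def tensor12_def id_mat_def pairs_def U0)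
  have image: "image ?r = cut (pairs n) ?r'" "image (trans1 ?r) = cut (pairs n) (trans1 ?r')"
    "image (in_first A) = cut (pairs n) (in_first ?B)" "image (in_second A) = cut (pairs n) (in_second ?B)"
    using r by (auto simp: image_def cut_def trans1_def in_first_def in_second_def tensor12_def id_mat_def \<phi>0 fun_eq_iff)
  have "image (?r \<odot>\<^bsub>pairs n\<^esub> in_first A \<odot>\<^bsub>pairs n\<^esub> trans1 ?r \<odot>\<^bsub>pairs n\<^esub> in_second A)
      = image (in_second A \<odot>\<^bsub>pairs n\<^esub> trans1 ?r \<odot>\<^bsub>pairs n\<^esub> in_first A \<odot>\<^bsub>pairs n\<^esub> ?r)"
    using refl by (auto simp: reflection_def mat_eq_def image_def cut_def fun_eq_iff)
  then show ?thesis
    by (simp add: image_mmul good_mmul good image reflection_def mat_eq_iff_cut cut_mmul)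
qed

context q_algebra begin

text \<open>
  Reversing the rows exchanges the conditions \<open>i < k\<close> and \<open>k < i\<close> on the rows, and thereby \<open>R\<^sup>T\<close> and \<open>R\<close> on the
  left-hand side. The signs in \<open>S\<close> cancel because every term of the relation contains one entry from each
  of the two rows.
\<close>

lemma RTT_antidiagonal:
  assumes "mat_eq (pairs n) (trans_mat (R n) \<odot>\<^bsub>pairs n\<^esub> tensor12 M M) (tensor21 M M \<odot>\<^bsub>pairs n\<^esub> R n)"
  shows "RTT n (R n) (S_mat n \<odot>\<^bsub>{1..n}\<^esub> M)"
  unfolding RTT_def
proof (rule mat_eq_pairsI)
  fix i k j l assume ix: "i \<in> {1..n}" "k \<in> {1..n}" "j \<in> {1..n}" "l \<in> {1..n}"
  define i' k' where "i' = n + 1 - i" and "k' = n + 1 - k"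
  have ix': "i' \<in> {1..n}" "k' \<in> {1..n}" and rev: "i' < k' \<longleftrightarrow> k < i" "i' = k' \<longleftrightarrow> i = k"
    using ix by (auto simp: i'_def k'_def)
  have inj: "scale (qpow (- 1 / of_nat n)) x = scale (qpow (- 1 / of_nat n)) y \<longleftrightarrow> x = y" for x y
    by simp
  have eq: "scale (if i = k then qpow 1 else 1) (M i' j * M k' l) + scale (if k < i then \<Lambda> else 0) (M k' j * M i' l)
      = scale (if j = l then qpow 1 else 1) (M k' l * M i' j) + scale (if j < l then \<Lambda> else 0) (M k' j * M i' l)"
    using mat_eq_pairsD[OF assms ix' ix(3,4)]
    unfolding R_transposed_mult_left[OF ix'] R_mult_right[OF ix(3,4)] inj rev
    by (simp only: tensor12_def tensor21_def prod.case)
  have S: "(S_mat n \<odot>\<^bsub>{1..n}\<^esub> M) a c = (- 1) ^ (n - a) * M (n + 1 - a) c" if "a \<in> {1..n}" for a c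
    using that by (auto simp: mmul_def S_mat_def if_distribs)
  define \<sigma> :: 'b where "\<sigma> = (- 1) ^ (n - i) * (- 1) ^ (n - k)"
  have sign: "(- 1) ^ m * x = x * (- 1 :: 'b) ^ m" for m x
    by (cases "even m") auto
  have *: "(- 1) ^ (n - i) * x * ((- 1) ^ (n - k) * y) = \<sigma> * (x * y)"
      "(- 1) ^ (n - k) * x * ((- 1) ^ (n - i) * y) = \<sigma> * (x * y)" for x y
    unfolding \<sigma>_def by (metis mult.assoc sign)+
  show "(R n \<odot>\<^bsub>pairs n\<^esub> tensor12 (S_mat n \<odot>\<^bsub>{1..n}\<^esub> M) (S_mat n \<odot>\<^bsub>{1..n}\<^esub> M)) (i, k) (j, l)
    = (tensor21 (S_mat n \<odot>\<^bsub>{1..n}\<^esub> M) (S_mat n \<odot>\<^bsub>{1..n}\<^esub> M) \<odot>\<^bsub>pairs n\<^esub> R n) (i, k) (j, l)"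
    unfolding R_mult_left[OF ix(1,2)] R_mult_right[OF ix(3,4)]
    by (simp only: tensor12_def tensor21_def prod.case S[OF ix(1)] S[OF ix(2)] *
        scale_mult_right[of \<sigma>, symmetric] distrib_left[symmetric] eq flip: i'_def k'_def)
qed

end

lemma A_gen_eq:
  fixes A M :: "nat \<Rightarrow> nat \<Rightarrow> 'b::ring_1"
  shows "A_gen n A M = trans_mat (S_mat n \<odot>\<^bsub>{1..n}\<^esub> M) \<odot>\<^bsub>{1..n}\<^esub> A \<odot>\<^bsub>{1..n}\<^esub> (S_mat n \<odot>\<^bsub>{1..n}\<^esub> M)"
proof -
  have S: "S_mat n i j * x = x * (S_mat n i j :: 'b)" for i j x
    by (cases "even (n - i)") (auto simp: S_mat_def)
  have "trans_mat M \<odot>\<^bsub>{1..n}\<^esub> trans_mat (S_mat n) = trans_mat (S_mat n \<odot>\<^bsub>{1..n}\<^esub> M)"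
    unfolding mmul_def trans_mat_def by (intro ext sum.cong refl S[symmetric])
  then show ?thesis
    unfolding A_gen_def by (simp add: mmul_assoc)
qed

theorem theorem4p2:
  fixes n :: nat
    and scale :: "'k::qfield \<Rightarrow> 'b::ring_1 \<Rightarrow> 'b"
    and \<phi> :: "'k qtorus \<Rightarrow> 'b"
    and M :: "nat \<Rightarrow> nat \<Rightarrow> 'b"
  assumes n: "n \<ge> 2"
    and alg: "assoc_algebra scale"
    and emb: "algebra_embedding qscale scale
                (subalgebra_generated qscale {A_mat n i j |i j. i \<in> {1..n} \<and> j \<in> {1..n}}) \<phi>"
    and rel: "mat_eq (pairs n)
                (trans_mat (scalar_mat scale (R_mat n)) \<odot>\<^bsub>pairs n\<^esub> tensor12 M M)
                (tensor21 M M \<odot>\<^bsub>pairs n\<^esub> scalar_mat scale (R_mat n))"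
    and comm: "\<And>i j k l. \<lbrakk>i \<in> {1..n}; j \<in> {1..n}; k \<in> {1..n}; l \<in> {1..n}\<rbrakk>
                \<Longrightarrow> M i j * \<phi> (A_mat n k l) = \<phi> (A_mat n k l) * M i j"
  shows "let X = pairs n;
             R = scalar_mat scale (R_mat n);
             Agen = A_gen n (\<lambda>i j. \<phi> (A_mat n i j)) M
         in mat_eq X
              (R \<odot>\<^bsub>X\<^esub> in_first Agen \<odot>\<^bsub>X\<^esub> trans1 R \<odot>\<^bsub>X\<^esub> in_second Agen)
              (in_second Agen \<odot>\<^bsub>X\<^esub> trans1 R \<odot>\<^bsub>X\<^esub> in_first Agen \<odot>\<^bsub>X\<^esub> R)"
proof -
  interpret q_algebra scale by (rule q_algebra.intro[OF alg])
  let ?W = "S_mat n \<odot>\<^bsub>{1..n}\<^esub> M" and ?A = "\<lambda>i j. \<phi> (A_mat n i j)"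
  have A: "reflection n (R n) ?A"
    by (rule reflection_embedding[OF alg emb A_mat_reflection])
  have "?W i j * ?A k l = ?A k l * ?W i j"
    if ix: "i \<in> {1..n}" "j \<in> {1..n}" "k \<in> {1..n}" "l \<in> {1..n}" for i j k l
  proof -
    have S: "S_mat n i m * x = x * (S_mat n i m :: 'b)" for m x
      by (cases "even (n - i)") (auto simp: S_mat_def)
    show ?thesis
      unfolding mmul_def sum_distrib_left sum_distrib_right
    proof (rule sum.cong[OF refl])
      fix m assume "m \<in> {1..n}"
      then show "S_mat n i m * M m j * ?A k l = ?A k l * (S_mat n i m * M m j)"
        using comm[of m j k l] ix by (metis S mult.assoc)
    qed
  qed
  then have "reflection n (R n) (trans_mat ?W \<odot>\<^bsub>{1..n}\<^esub> ?A \<odot>\<^bsub>{1..n}\<^esub> ?W)"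
    by (rule exchange_matrix.reflection_congruence[OF exchange_matrix_R RTT_antidiagonal[OF rel] A])
  then show ?thesis
    by (simp add: A_gen_eq reflection_def Let_def)
qed

end
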